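(* Let $\ell$ be a positive integer and $k=5\ell$. There is a constant $c>0$ depending only on $k,\ell$ such that for every integer $N\geq 3$, \[ \mathscr{M}_{(k,\ell)}(N)\geq \frac{N}{k+\ell}+c\,\frac{\log N}{\log\log N}. \]
   Context: For positive integers $k>\ell$, a set $S$ of positive integers is $(k,\ell)$-sum-free if for all (not necessarily distinct) $x_1,\dots,x_k,y_1,\dots,y_\ell\in S$ one has $x_1+\dots+x_k\neq y_1+\dots+y_\ell$. For a finite set $A$ of positive integers, $\mathscr{M}_{(k,\ell)}(A)$ is the maximum size of a $(k,\ell)$-sum-free subset of $A$, and $\mathscr{M}_{(k,\ell)}(N)=\inf\{\mathscr{M}_{(k,\ell)}(A): A\subseteq\mathbb{Z}_{>0},\ |A|=N\}$. *)

theory Defs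
  imports Complex_Main
begin

(* Sets of positive integers are rendered as sets of naturals not containing 0.
   Positivity is not demanded here: for k, l > 0 a set containing 0 is never sum-free,
   since 0 + ... + 0 = 0 + ... + 0. *)
definition kl_sum_free :: "nat \<Rightarrow> nat \<Rightarrow> nat set \<Rightarrow> bool" where
  "kl_sum_free k l S \<longleftrightarrow>
     (\<forall>x y :: nat \<Rightarrow> nat.
        (\<forall>i\<in>{1..k}. x i \<in> S) \<longrightarrow> (\<forall>j\<in>{1..l}. y j \<in> S) \<longrightarrow>
        (\<Sum>i=1..k. x i) \<noteq> (\<Sum>j=1..l. y j))"

(* For finite A and k > 0 the set below is finite and nonempty (the empty set is sum-free). *)
definition max_kl_sum_free :: "nat \<Rightarrow> nat \<Rightarrow> nat set \<Rightarrow> nat" where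
  "max_kl_sum_free k l A = Max {card S |S. S \<subseteq> A \<and> kl_sum_free k l S}"

definition min_max_kl_sum_free :: "nat \<Rightarrow> nat \<Rightarrow> nat \<Rightarrow> nat" where
  "min_max_kl_sum_free k l N =
     Inf {max_kl_sum_free k l A |A. A \<subseteq> {0<..} \<and> finite A \<and> card A = N}"

end

theory Submission
  imports Defs "HOL-Analysis.Analysis" "HOL-Computational_Algebra.Primes"
begin

text \<open>
  Let \<open>F(x) = \<Sum>\<^sub>n\<^sub>\<in>\<^sub>A (1[1/12 < {nx} < 5/12] - 1/3)\<close>. Each \<open>x\<close> yields a sum-free subset of \<open>A\<close> of size at least
  \<open>(|A|/3 + F(x)) / 2l\<close>, and \<open>F\<close> has mean zero, so it suffices to bound \<open>\<parallel>F\<parallel>\<^sub>1\<close> from below. The even and odd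
  parts of the arc have Fourier coefficients \<open>\<chi>(m)/m\<close> for an odd character mod 3 and an even character mod 12.
  Sieving out the primes up to \<open>y = (log |A|)\<^sup>O\<^sup>(\<^sup>1\<^sup>)\<close> costs a factor \<open>O(log y)\<close> (Mertens) and leaves, after adding both
  parts, the frequencies \<open>n \<in> 2A \<union> 4A\<close> together with multiples \<open>mn\<close> for \<open>y\<close>-rough \<open>m\<close> of either sign; the frequencies
  \<open>-n\<close> cancel because the two characters have opposite parity. The noise at \<open>mn\<close> is small in \<open>l\<^sup>2\<close>, on every block of
  frequencies, by a GCD-sum estimate. The test function of McGehee, Pigno and Smith, built from blocks of increasing size
  and damping factors with negative spectrum, pairs with the rest to give \<open>c log |A|\<close>. The damping factors can be
  smoothed to degree comparable with that of their block, so the noise at \<open>mn\<close> with \<open>m < -y\<close> lies outside the spectrum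
  of the test function built from the lower blocks.
\<close>

section \<open>Mertens' upper bound\<close>

text \<open>The ratio 5 makes the relevant arcs, for every \<open>l\<close>, the preimage of one arc
  under multiplication by \<open>2 * l\<close> modulo 1, so a single function \<open>F\<close>
  serves all \<open>l\<close>. The obstacle is that \<open>F\<close> is real and has frequencies of
  both signs, while a block must be invisible to the part of the test function built before it.
  Analytic damping factors push that part towards negative frequencies without bound, into the
  negative multiples of later blocks. What makes room is the gap between -yn and n that the sieve
  and the parity cancellation leave; since it is finite, the degree of the damping has to be finite
  too. Two demands then fix the level: \<open>y\<close> is at least \<open>24 * J * J\<close> for
  the gap, and at least \<open>r\<^sup>2\<close> with \<open>4 ^ r\<close> exceeding
  \<open>2 * card A\<close> for the gcd-sum estimate. Both \<open>J\<close> and \<open>r\<close>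
  have the order of the logarithm of \<open>card A\<close>, so Mertens' factor \<open>ln y\<close>
  has the order of log log N, which is the denominator of the gain.\<close>

lemma prod_primes_dvd:
  fixes P :: "nat set"
  assumes "finite P" "\<And>p. p \<in> P \<Longrightarrow> prime p" "\<And>p. p \<in> P \<Longrightarrow> p dvd n"
  shows "\<Prod>P dvd n"
  using assms
proof (induction P rule: finite_induct)
  case (insert p P)
  have "coprime p (\<Prod>P)"
    using insert by (intro prod_coprime_right) (metis insertCI primes_coprime)
  then show ?case using insert by (simp add: divides_mult)
qed simp

text \<open>Erdos's induction: an even \<open>n > 2\<close> is not prime, and for
  \<open>n = 2 * m + 1\<close> the primes in \<open>(m + 1, n]\<close> all divide
  \<open>n choose m\<close>. That coefficient occurs twice in the row sum \<open>2 ^ n\<close>,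
  hence is at most \<open>4 ^ m\<close>.\<close>

lemma prod_primes_le: "\<Prod>{p. prime p \<and> p \<le> n} \<le> (4::nat) ^ n"
proof (induction n rule: less_induct)
  case (less n)
  consider "n \<le> 1" | "n = 2" | "n > 2" "even n" | "n > 2" "odd n" by linarith
  then show ?case
  proof cases
    case 1
    then have "{p. prime p \<and> p \<le> n} = {}" by (auto dest: prime_gt_1_nat)
    then show ?thesis by (simp only: prod.empty) simp
  next
    case 2
    then have "{p. prime p \<and> p \<le> n} = {2}"
      by (auto dest: prime_gt_1_nat)
    then show ?thesis using 2 by simp
  next
    case 3
    then have "\<not> prime n" using prime_odd_nat by blast
    have "prime p \<and> p \<le> n \<longleftrightarrow> prime p \<and> p \<le> n - 1" for p
      using \<open>\<not> prime n\<close> by (cases "p = n") auto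
    then have "{p. prime p \<and> p \<le> n} = {p. prime p \<and> p \<le> n - 1}" by blast
    then have "\<Prod>{p. prime p \<and> p \<le> n} \<le> (4::nat) ^ (n - 1)" using less[of "n - 1"] 3 by simp
    also have "\<dots> \<le> 4 ^ n" by (intro power_increasing) auto
    finally show ?thesis .
  next
    case 4
    then obtain m where m: "n = 2 * m + 1" by (elim oddE)
    have m1: "m \<ge> 1" using 4 m by simp
    let ?P = "{p. prime p \<and> m + 1 < p \<and> p \<le> n}"
    have split: "{p. prime p \<and> p \<le> n} = {p. prime p \<and> p \<le> m + 1} \<union> ?P" using m m1 by auto
    have "p dvd (n choose m)" if "p \<in> ?P" for p
    proof -
      have p: "prime p" "m + 1 < p" "p \<le> n" using that by auto
      have "p dvd fact n" using p by (simp add: prime_dvd_fact_iff)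
      also have "fact n = fact m * fact (n - m) * (n choose m)"
        using binomial_fact_lemma[of m n] m by simp
      finally have "p dvd fact m * fact (n - m) * (n choose m)" .
      moreover have "\<not> p dvd fact m" using p by (simp add: prime_dvd_fact_iff)
      moreover have "\<not> p dvd fact (n - m)"
        using p m prime_dvd_fact_iff[OF p(1), of "n - m"] by linarith
      ultimately show ?thesis using p(1) by (simp add: prime_dvd_mult_iff)
    qed
    then have "\<Prod>?P dvd (n choose m)" by (intro prod_primes_dvd) auto
    then have "\<Prod>?P \<le> (n choose m)" using m by (intro dvd_imp_le) auto
    also have "\<dots> \<le> 4 ^ m"
    proof -
      have "2 * (n choose m) = (n choose m) + (n choose (m + 1))"
        using binomial_symmetric[of m n] m by simp
      also have "\<dots> = (\<Sum>i\<in>{m, m+1}. n choose i)" by simp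
      also have "\<dots> \<le> (\<Sum>i\<le>n. n choose i)" using m by (intro sum_mono2) auto
      also have "\<dots> = 2 * 4 ^ m" using m choose_row_sum[of n] by (simp add: power_mult)
      finally show ?thesis by simp
    qed
    finally have P: "\<Prod>?P \<le> 4 ^ m" .
    have "\<Prod>{p. prime p \<and> p \<le> n} = \<Prod>{p. prime p \<and> p \<le> m + 1} * \<Prod>?P"
      unfolding split by (rule prod.union_disjoint) auto
    also have "\<dots> \<le> 4 ^ (m + 1) * 4 ^ m" using less[of "m + 1"] m m1 P by (intro mult_mono) auto
    also have "\<dots> = 4 ^ n" by (simp add: m power_add mult_2)
    finally show ?thesis .
  qed
qed

lemma sum_ln_primes_le: "(\<Sum>p | prime p \<and> p \<le> n. ln (real p)) \<le> real n * ln 4"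
proof -
  have fin: "finite {p. prime p \<and> p \<le> n}" by (rule finite_subset[of _ "{..n}"]) auto
  have "(\<Sum>p | prime p \<and> p \<le> n. ln (real p)) = ln (real (\<Prod>{p. prime p \<and> p \<le> n}))"
    unfolding of_nat_prod by (rule ln_prod[symmetric]) (use fin in \<open>auto intro: prime_gt_0_nat\<close>)
  also have "\<dots> \<le> ln (real (4 ^ n))"
  proof (subst ln_le_cancel_iff)
    show "real (\<Prod>{p. prime p \<and> p \<le> n}) \<le> real (4 ^ n)" using prod_primes_le[of n] by (simp only: of_nat_le_iff)
    show "0 < real (\<Prod>{p. prime p \<and> p \<le> n})" by (auto intro!: prod_pos prime_gt_0_nat)
  qed auto
  also have "\<dots> = real n * ln 4" by (simp add: ln_realpow)
  finally show ?thesis .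
qed

text \<open>Each multiple of \<open>p\<close> up to \<open>n\<close> contributes one factor
  \<open>p\<close>. The higher powers in Legendre's formula are dropped; this loses nothing for
  upper bounds on sums over primes.\<close>

lemma prod_prime_powers_dvd_fact:
  "finite P \<Longrightarrow> (\<And>p. p \<in> P \<Longrightarrow> prime p) \<Longrightarrow> (\<Prod>p\<in>P. p ^ (n div p)) dvd (fact n :: nat)"
proof (induction P rule: finite_induct)
  case (insert p P)
  have p: "prime p" using insert by simp
  have "p ^ m dvd (fact (p * m) :: nat)" for m
  proof (induction m)
    case (Suc m)
    have "fact (p * m) * (p * Suc m) dvd (fact (p * Suc m) :: nat)"
    proof -
      obtain q where q: "p * Suc m = Suc q" using p by (metis Suc_pred mult_pos_pos prime_gt_0_nat zero_less_Suc)
      have "p * m \<le> q" using q p prime_gt_0_nat[of p] by simp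
      then have "fact (p * m) dvd (fact q :: nat)" by (rule fact_dvd)
      then have "fact (p * m) * Suc q dvd fact q * Suc q" by (rule mult_dvd_mono) simp
      then show ?thesis unfolding q by (simp add: mult.commute)
    qed
    moreover have "p ^ m * p dvd fact (p * m) * (p * Suc m)" using Suc by (intro mult_dvd_mono) auto
    ultimately show ?case by (metis dvd_trans power_Suc2)
  qed simp
  then have "p ^ (n div p) dvd (fact (p * (n div p)) :: nat)" .
  also have "\<dots> dvd fact n" by (intro fact_dvd) simp
  finally have 1: "p ^ (n div p) dvd (fact n :: nat)" .
  have "coprime (p ^ (n div p)) (\<Prod>p\<in>P. p ^ (n div p))"
    using insert by (intro prod_coprime_right) (metis insertCI primes_coprime coprime_power_left_iff coprime_power_right_iff)
  then show ?case using 1 insert by (simp add: divides_mult)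
qed simp

text \<open>The upper half of Mertens' first theorem. Logarithms of the prime powers dividing
  \<open>n!\<close>, together with \<open>n! \<le> n ^ n\<close>, bound the sum weighted with
  \<open>n div p\<close>; removing the floor costs Chebyshev's sum of \<open>ln p\<close>, hence the
  \<open>ln 4\<close>.\<close>

lemma sum_ln_over_primes_le:
  assumes n: "n \<ge> 1"
  shows "(\<Sum>p | prime p \<and> p \<le> n. ln (real p) / real p) \<le> ln (real n) + ln 4"
proof -
  let ?P = "{p. prime p \<and> p \<le> n}"
  have fin: "finite ?P" by (rule finite_subset[of _ "{..n}"]) auto
  have "(\<Prod>p\<in>?P. p ^ (n div p)) \<le> (fact n :: nat)"
    using fin by (intro dvd_imp_le prod_prime_powers_dvd_fact) auto
  also have "\<dots> \<le> n ^ n" using fact_le_power[of n, where ?'a = nat] by simp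
  finally have le: "(\<Prod>p\<in>?P. p ^ (n div p)) \<le> n ^ n" .
  have "(\<Sum>p\<in>?P. real (n div p) * ln (real p)) = ln (real (\<Prod>p\<in>?P. p ^ (n div p)))"
    unfolding of_nat_prod
    by (subst ln_prod) (use fin in \<open>auto intro!: sum.cong simp: ln_realpow prime_gt_0_nat\<close>)
  also have "\<dots> \<le> ln (real (n ^ n))"
  proof (subst ln_le_cancel_iff)
    show "real (\<Prod>p\<in>?P. p ^ (n div p)) \<le> real (n ^ n)" using le by (simp only: of_nat_le_iff)
    show "0 < real (\<Prod>p\<in>?P. p ^ (n div p))" by (auto intro!: prod_pos prime_gt_0_nat)
  qed (use n in auto)
  finally have 1: "(\<Sum>p\<in>?P. real (n div p) * ln (real p)) \<le> real n * ln (real n)"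
    using n by (simp add: ln_realpow)
  have "real n * (\<Sum>p\<in>?P. ln (real p) / real p) = (\<Sum>p\<in>?P. real n / real p * ln (real p))"
    by (simp add: sum_distrib_left)
  also have "\<dots> \<le> (\<Sum>p\<in>?P. (real (n div p) + 1) * ln (real p))"
  proof (intro sum_mono mult_right_mono)
    fix p assume p: "p \<in> ?P"
    then have p1: "p \<ge> 1" using prime_ge_1_nat by auto
    show "real n / real p \<le> real (n div p) + 1"
      using p1 dividend_less_div_times[of p n] by (simp add: divide_le_eq distrib_right flip: of_nat_mult of_nat_add)
    show "0 \<le> ln (real p)" using p1 by simp
  qed
  also have "\<dots> = (\<Sum>p\<in>?P. real (n div p) * ln (real p)) + (\<Sum>p\<in>?P. ln (real p))"
    by (simp add: algebra_simps sum.distrib)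
  also have "\<dots> \<le> real n * ln (real n) + real n * ln 4"
    using 1 sum_ln_primes_le[of n] by simp
  finally have "real n * (\<Sum>p\<in>?P. ln (real p) / real p) \<le> real n * (ln (real n) + ln 4)"
    by (simp add: algebra_simps)
  then show ?thesis using n by simp
qed

lemma sum_inverse_primes_le:
  assumes n: "n \<ge> 2"
  shows "(\<Sum>p | prime p \<and> p \<le> n. 1 / real p) \<le> ln (ln (real n)) + 5"
proof -
  define S where "S = (\<lambda>n. \<Sum>p | prime p \<and> p \<le> n. ln (real p) / real p)"
  have rec: "(\<Sum>p | prime p \<and> p \<le> Suc n. f p) = (\<Sum>p | prime p \<and> p \<le> n. f p) + (if prime (Suc n) then f (Suc n) else 0)"
    for f :: "nat \<Rightarrow> real" and n
  proof -
    have "{p. prime p \<and> p \<le> Suc n} = (if prime (Suc n) then insert (Suc n) {p. prime p \<and> p \<le> n} else {p. prime p \<and> p \<le> n})"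
      by (auto simp: le_Suc_eq)
    moreover have "finite {p. prime p \<and> p \<le> n}" by (rule finite_subset[of _ "{..n}"]) auto
    ultimately show ?thesis by simp
  qed
  have two: "{p::nat. prime p \<and> p \<le> 2} = {2}"
    by (auto dest: prime_gt_1_nat)
  text \<open>Abel summation, kept as an invariant.\<close>
  have "(\<Sum>p | prime p \<and> p \<le> n. 1 / real p)
      \<le> S n / ln (real n) + ln (ln (real n)) - ln (ln 2) + ln 4 * (1 / ln 2 - 1 / ln (real n))"
    using n
  proof (induction n rule: dec_induct)
    case base
    show ?case by (simp add: S_def two)
  next
    case (step n)
    have n2: "n \<ge> 2" using step by simp
    define a where "a = ln (real n)"
    define b where "b = ln (real (Suc n))"
    have a: "a > 0" using n2 by (simp add: a_def)
    have ab: "a < b" using n2 by (simp add: a_def b_def)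
    have b: "b > 0" using a ab by simp
    have Sn: "S n \<le> a + ln 4" unfolding S_def a_def by (rule sum_ln_over_primes_le) (use n2 in simp)
    have "S (Suc n) / b = S n / b + (if prime (Suc n) then 1 / real (Suc n) else 0)"
      using b by (simp add: S_def rec b_def add_divide_distrib)
    then have eq: "(if prime (Suc n) then 1 / real (Suc n) else 0) = S (Suc n) / b - S n / b" by simp
    have "S n / a - S n / b = S n * (1 / a - 1 / b)" by (simp add: algebra_simps)
    also have "\<dots> \<le> (a + ln 4) * (1 / a - 1 / b)"
      using Sn a ab by (intro mult_right_mono) (auto simp: frac_le)
    also have "\<dots> = (1 - a / b) + ln 4 * (1 / a - 1 / b)" using a b by (simp add: field_simps)
    \<comment> \<open>With \<open>a = ln n\<close> and \<open>b = ln (n + 1)\<close> these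
      differences telescope over \<open>n\<close>; they are the source of the double
      logarithm.\<close>
    also have "1 - a / b \<le> ln b - ln a"
      using ln_le_minus_one[of "a / b"] a b by (simp add: ln_div)
    finally have "S n / a - S n / b \<le> ln b - ln a + ln 4 * (1 / a - 1 / b)" by simp
    then show ?case using step.IH unfolding rec eq a_def[symmetric] b_def[symmetric]
      by (simp add: algebra_simps)
  qed
  also have "S n / ln (real n) \<le> 1 + ln 4 / ln (real n)"
    using sum_ln_over_primes_le[of n] n by (simp add: S_def field_simps)
  finally have "(\<Sum>p | prime p \<and> p \<le> n. 1 / real p) \<le> 1 + ln 4 / ln 2 + ln (ln (real n)) - ln (ln 2)"
    by (simp add: algebra_simps)
  moreover have "ln (4::real) / ln 2 = 2"
    using ln_realpow[of "2::real" 2] by simp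
  moreover have "- ln (ln (2::real)) \<le> 1"
  proof -
    have "ln 2 \<ge> (1/2::real)" using ln_le_minus_one[of "1/2::real"] by (simp add: ln_div)
    have "exp (1::real) \<ge> 2" using exp_ge_add_one_self[of 1] by simp
    then have "exp (-1::real) \<le> 1/2" by (simp add: exp_minus inverse_eq_divide divide_le_eq)
    then have "exp (-1) \<le> ln (2::real)" using \<open>ln 2 \<ge> 1/2\<close> by linarith
    then have "ln (exp (-1)) \<le> ln (ln (2::real))" by (subst ln_le_cancel_iff) auto
    then show ?thesis by simp
  qed
  ultimately show ?thesis by simp
qed

text \<open>The primes 2 and 3 are left out because the characters in the arc coefficients already
  vanish on their multiples; only the primes from 5 on are sieved.\<close>

lemma mertens_prod_le:
  assumes n: "n \<ge> 2"
  shows "(\<Prod>p | prime p \<and> 5 \<le> p \<and> p \<le> n. 1 + 1 / real p) \<le> exp 5 * ln (real n)"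
proof -
  have fin: "finite {p. prime p \<and> p \<le> n}" by (rule finite_subset[of _ "{..n}"]) auto
  have fin': "finite {p. prime p \<and> 5 \<le> p \<and> p \<le> n}" by (rule finite_subset[OF _ fin]) auto
  have "(\<Prod>p | prime p \<and> 5 \<le> p \<and> p \<le> n. 1 + 1 / real p) \<le> (\<Prod>p | prime p \<and> 5 \<le> p \<and> p \<le> n. exp (1 / real p))"
    by (intro prod_mono) (auto intro: exp_ge_add_one_self)
  also have "\<dots> = exp (\<Sum>p | prime p \<and> 5 \<le> p \<and> p \<le> n. 1 / real p)" using fin' by (simp add: exp_sum)
  also have "\<dots> \<le> exp (\<Sum>p | prime p \<and> p \<le> n. 1 / real p)"
    using fin by (simp, intro sum_mono2) auto
  also have "\<dots> \<le> exp (ln (ln (real n)) + 5)" using sum_inverse_primes_le[OF n] by simp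
  also have "\<dots> = exp 5 * ln (real n)" using n by (simp add: exp_add)
  finally show ?thesis .
qed

section \<open>Dilation sums over rough numbers\<close>

text \<open>A weighted dilation operator: the mass of \<open>w\<close> at \<open>i\<close> is sent
  to every \<open>m * i\<close> with weight \<open>1 / m\<close>, the size of a coefficient
  \<open>\<chi>(m) / m\<close>.\<close>

definition dilate_sum :: "nat set \<Rightarrow> (nat \<Rightarrow> real) \<Rightarrow> nat \<Rightarrow> real" where
  "dilate_sum M w j = (\<Sum>m\<in>{m\<in>M. m dvd j}. w (j div m) / real m)"

definition mult_set :: "nat set \<Rightarrow> nat set \<Rightarrow> nat set" where
  "mult_set M I = (\<lambda>(m, i). m * i) ` (M \<times> I)"

lemma finite_mult_set [simp]: "finite M \<Longrightarrow> finite I \<Longrightarrow> finite (mult_set M I)"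
  by (simp add: mult_set_def)

lemma zero_notin_mult_set: "0 \<notin> M \<Longrightarrow> 0 \<notin> I \<Longrightarrow> 0 \<notin> mult_set M I"
  by (auto simp: mult_set_def)

lemma mult_setI: "m \<in> M \<Longrightarrow> i \<in> I \<Longrightarrow> m * i \<in> mult_set M I"
  by (auto simp: mult_set_def)

lemma dilate_sum_nonneg: "(\<And>i. w i \<ge> 0) \<Longrightarrow> dilate_sum M w j \<ge> 0"
  by (auto simp: dilate_sum_def intro!: sum_nonneg)

lemma dilate_sum_altdef:
  "finite M \<Longrightarrow> dilate_sum M w j = (\<Sum>m\<in>M. if m dvd j then w (j div m) / real m else 0)"
  by (simp add: dilate_sum_def sum.inter_filter)

lemma dilate_sum_support:
  assumes "\<And>i. i \<notin> I \<Longrightarrow> w i = 0" "j \<notin> mult_set M I"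
  shows "dilate_sum M w j = 0"
  unfolding dilate_sum_def
proof (intro sum.neutral ballI)
  fix m assume "m \<in> {m \<in> M. m dvd j}"
  then have "j div m \<notin> I" using assms(2) mult_setI[of m M "j div m" I] by auto
  then show "w (j div m) / real m = 0" using assms(1) by simp
qed

lemma dilate_sum_adjoint:
  assumes M: "finite M" "0 \<notin> M" and I: "finite I"
    and w: "\<And>i. i \<notin> I \<Longrightarrow> w i = 0"
  shows "(\<Sum>j\<in>mult_set M I. dilate_sum M w j * z j) = (\<Sum>i\<in>I. w i * (\<Sum>m\<in>M. z (m * i) / real m))"
proof -
  let ?J = "mult_set M I"
  have "(\<Sum>j\<in>?J. dilate_sum M w j * z j) = (\<Sum>m\<in>M. \<Sum>j\<in>?J. (if m dvd j then w (j div m) / real m else 0) * z j)"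
    by (subst sum.swap) (simp add: dilate_sum_altdef M sum_distrib_right)
  also have "\<dots> = (\<Sum>m\<in>M. \<Sum>i\<in>I. w i * (z (m * i) / real m))"
  proof (rule sum.cong[OF refl])
    fix m assume m: "m \<in> M"
    then have m0: "m > 0" using M by (metis gr0I)
    have "(\<Sum>j\<in>?J. (if m dvd j then w (j div m) / real m else 0) * z j)
        = (\<Sum>j\<in>(*) m ` I. (if m dvd j then w (j div m) / real m else 0) * z j)"
    proof (rule sum.mono_neutral_right)
      show "(*) m ` I \<subseteq> ?J" using m by (auto intro: mult_setI)
      show "\<forall>j\<in>?J - (*) m ` I. (if m dvd j then w (j div m) / real m else 0) * z j = 0"
      proof
        fix j assume j: "j \<in> ?J - (*) m ` I"
        show "(if m dvd j then w (j div m) / real m else 0) * z j = 0"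
        proof (cases "m dvd j")
          case True
          then have "j = m * (j div m)" by simp
          then have "j div m \<notin> I" using j by blast
          then show ?thesis using w by simp
        qed simp
      qed
    qed (use M I in auto)
    also have "\<dots> = (\<Sum>i\<in>I. w i * (z (m * i) / real m))"
      by (subst sum.reindex) (use m0 in \<open>auto simp: inj_on_def\<close>)
    finally show "(\<Sum>j\<in>?J. (if m dvd j then w (j div m) / real m else 0) * z j)
        = (\<Sum>i\<in>I. w i * (z (m * i) / real m))" .
  qed
  also have "\<dots> = (\<Sum>i\<in>I. w i * (\<Sum>m\<in>M. z (m * i) / real m))"
    by (subst sum.swap) (simp add: sum_distrib_left)
  finally show ?thesis .
qed

text \<open>The adjoint of \<open>R = dilate_sum M\<close> is dominated by \<open>R\<close> itself.
  Expanding both squares over pairs \<open>m\<close>, \<open>m'\<close>, the substitution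
  \<open>j = m * m' * i\<close> carries the terms on the left injectively to terms on the right, and
  what remains on the right is nonnegative because \<open>z\<close> is.\<close>

lemma dilate_sum_hyponormal:
  assumes M: "finite M" "0 \<notin> M" and K: "finite K" and I: "finite I"
    and z: "\<And>i. i \<notin> K \<Longrightarrow> z i = 0" "\<And>i. z i \<ge> 0"
  shows "(\<Sum>i\<in>I. (\<Sum>m\<in>M. z (m * i) / real m)\<^sup>2) \<le> (\<Sum>j\<in>mult_set M K. (dilate_sum M z j)\<^sup>2)"
proof -
  let ?J = "mult_set M K"
  let ?t = "\<lambda>m j. if m dvd j then z (j div m) / real m else 0"
  have t0: "?t m j \<ge> 0" for m j using z(2) by simp
  have "(\<Sum>i\<in>I. (\<Sum>m\<in>M. z (m * i) / real m)\<^sup>2)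
      = (\<Sum>i\<in>I. \<Sum>m\<in>M. \<Sum>m'\<in>M. z (m * i) / real m * (z (m' * i) / real m'))"
    by (simp add: power2_eq_square sum_product)
  also have "\<dots> = (\<Sum>m\<in>M. \<Sum>m'\<in>M. \<Sum>i\<in>I. z (m * i) / real m * (z (m' * i) / real m'))"
    by (subst sum.swap) (intro sum.cong refl sum.swap)
  also have "\<dots> \<le> (\<Sum>m\<in>M. \<Sum>m'\<in>M. \<Sum>j\<in>?J. ?t m j * ?t m' j)"
  proof (intro sum_mono)
    fix m m' assume m: "m \<in> M" "m' \<in> M"
    then have m0: "m > 0" "m' > 0" using M by (metis gr0I)+
    let ?I = "{i\<in>I. z (m * i) \<noteq> 0}"
    have "(\<Sum>i\<in>I. z (m * i) / real m * (z (m' * i) / real m'))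
        = (\<Sum>i\<in>?I. z (m * i) / real m * (z (m' * i) / real m'))"
      using I by (intro sum.mono_neutral_right) auto
    \<comment> \<open>At \<open>m * m' * i\<close> the quotient by \<open>m\<close> is
      \<open>m' * i\<close> and conversely, so the two values of \<open>z\<close> trade places while
      the product is unchanged.\<close>
    also have "\<dots> = (\<Sum>i\<in>?I. ?t m (m * m' * i) * ?t m' (m * m' * i))"
      using m0 by (intro sum.cong refl) (auto simp: mult.assoc mult.left_commute[of m m'])
    also have "\<dots> = (\<Sum>j\<in>(*) (m * m') ` ?I. ?t m j * ?t m' j)"
      by (subst sum.reindex) (use m0 in \<open>auto simp: inj_on_def\<close>)
    also have "\<dots> \<le> (\<Sum>j\<in>?J. ?t m j * ?t m' j)"
    proof (rule sum_mono2)
      show "(*) (m * m') ` ?I \<subseteq> ?J"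
      proof safe
        fix i assume "i \<in> I" "z (m * i) \<noteq> 0"
        then have "m * i \<in> K" using z by blast
        then have "m' * (m * i) \<in> ?J" using m by (intro mult_setI)
        then show "m * m' * i \<in> ?J" by (simp add: ac_simps)
      qed
    qed (use M K t0 in \<open>auto intro!: mult_nonneg_nonneg\<close>)
    finally show "(\<Sum>i\<in>I. z (m * i) / real m * (z (m' * i) / real m')) \<le> (\<Sum>j\<in>?J. ?t m j * ?t m' j)" .
  qed
  also have "\<dots> = (\<Sum>j\<in>?J. (\<Sum>m\<in>M. ?t m j) * (\<Sum>m'\<in>M. ?t m' j))"
    unfolding sum_product
    by (subst (3) sum.swap) (intro sum.cong refl sum.swap)
  also have "\<dots> = (\<Sum>j\<in>?J. (dilate_sum M z j)\<^sup>2)"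
    by (simp add: dilate_sum_altdef M power2_eq_square)
  finally show ?thesis .
qed

text \<open>Write the squared norm of \<open>R w\<close> as the inner product of \<open>w\<close>
  with \<open>R* R w\<close>, apply Cauchy-Schwarz, and replace \<open>R* R w\<close> by
  \<open>R R w\<close> using hyponormality.\<close>

lemma dilate_sum_log_convex:
  assumes M: "finite M" "0 \<notin> M" and I: "finite I"
    and w: "\<And>i. i \<notin> I \<Longrightarrow> w i = 0" "\<And>i. w i \<ge> 0"
  shows "(\<Sum>j\<in>mult_set M I. (dilate_sum M w j)\<^sup>2)\<^sup>2
    \<le> (\<Sum>i\<in>I. (w i)\<^sup>2) * (\<Sum>j\<in>mult_set M (mult_set M I). (dilate_sum M (dilate_sum M w) j)\<^sup>2)"
proof -
  let ?z = "dilate_sum M w"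
  let ?g = "\<lambda>i. \<Sum>m\<in>M. ?z (m * i) / real m"
  have "(\<Sum>j\<in>mult_set M I. (?z j)\<^sup>2) = (\<Sum>i\<in>I. w i * ?g i)"
    using dilate_sum_adjoint[of M I w ?z] assms by (simp add: power2_eq_square)
  then have "(\<Sum>j\<in>mult_set M I. (?z j)\<^sup>2)\<^sup>2 \<le> (\<Sum>i\<in>I. (w i)\<^sup>2) * (\<Sum>i\<in>I. (?g i)\<^sup>2)"
    by (simp only: Cauchy_Schwarz_ineq_sum)
  also have "\<dots> \<le> (\<Sum>i\<in>I. (w i)\<^sup>2) * (\<Sum>j\<in>mult_set M (mult_set M I). (dilate_sum M ?z j)\<^sup>2)"
    by (intro mult_left_mono dilate_sum_hyponormal sum_nonneg)
       (use assms in \<open>auto intro: dilate_sum_support dilate_sum_nonneg\<close>)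
  finally show ?thesis .
qed

fun iter_dilate :: "nat set \<Rightarrow> nat \<Rightarrow> (nat \<Rightarrow> real) \<Rightarrow> nat \<Rightarrow> real" where
  "iter_dilate M 0 w = w"
| "iter_dilate M (Suc r) w = dilate_sum M (iter_dilate M r w)"

fun iter_mult_set :: "nat set \<Rightarrow> nat \<Rightarrow> nat set \<Rightarrow> nat set" where
  "iter_mult_set M 0 I = I"
| "iter_mult_set M (Suc r) I = mult_set M (iter_mult_set M r I)"

lemma iter_mult_set_props:
  "finite M \<Longrightarrow> finite I \<Longrightarrow> finite (iter_mult_set M r I)"
  "0 \<notin> M \<Longrightarrow> 0 \<notin> I \<Longrightarrow> 0 \<notin> iter_mult_set M r I"
  by (induction r) (auto simp: zero_notin_mult_set)

lemma iter_dilate_nonneg: "(\<And>i. w i \<ge> 0) \<Longrightarrow> iter_dilate M r w j \<ge> 0"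
  by (induction r arbitrary: j) (auto intro: dilate_sum_nonneg)

lemma iter_dilate_support:
  "(\<And>i. i \<notin> I \<Longrightarrow> w i = 0) \<Longrightarrow> j \<notin> iter_mult_set M r I \<Longrightarrow> iter_dilate M r w j = 0"
proof (induction r arbitrary: j)
  case (Suc r)
  then show ?case using dilate_sum_support[of "iter_mult_set M r I" "iter_dilate M r w" j M] by simp
qed simp

text \<open>The ratios of successive terms are nondecreasing, so each is at least the first. A zero
  term forces its successor to vanish, which covers the case where the ratio is undefined.\<close>

lemma log_convex_power_bound:
  fixes a :: "nat \<Rightarrow> real"
  assumes nn: "\<And>r. a r \<ge> 0" and pos: "a 0 > 0" and lc: "\<And>r. (a (Suc r))\<^sup>2 \<le> a r * a (Suc (Suc r))"
  shows "(a 1 / a 0) ^ r * a 0 \<le> a r"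
proof -
  let ?q = "a 1 / a 0"
  have q0: "?q \<ge> 0" using nn by simp
  have step: "?q * a r \<le> a (Suc r)" for r
  proof (induction r)
    case 0 then show ?case using pos by simp
  next
    case (Suc r)
    show ?case
    proof (cases "a r = 0")
      case True
      then have "a (Suc r) = 0" using lc[of r] by simp
      then show ?thesis using nn by simp
    next
      case False
      then have ar: "a r > 0" using nn[of r] by simp
      have "a r * (?q * a (Suc r)) = (?q * a r) * a (Suc r)" by simp
      also have "\<dots> \<le> a (Suc r) * a (Suc r)" using Suc nn by (intro mult_right_mono)
      also have "\<dots> \<le> a r * a (Suc (Suc r))" using lc[of r] by (simp add: power2_eq_square)
      finally show ?thesis using ar mult_le_cancel_left_pos by blast
    qed
  qed
  show ?thesis
  proof (induction r)
    case (Suc r)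
    have "?q ^ Suc r * a 0 = ?q * (?q ^ r * a 0)" by simp
    also have "\<dots> \<le> ?q * a r" using Suc q0 by (intro mult_left_mono)
    also have "\<dots> \<le> a (Suc r)" by (rule step)
    finally show ?case .
  qed simp
qed


text \<open>Dilation sums commute with dilations, so an iterate applied to the indicator of
  \<open>V\<close> is a superposition, over \<open>v\<close> in \<open>V\<close>, of dilates of the
  same iterate applied to the unit mass at 1.\<close>

lemma iter_dilate_of_set:
  assumes M: "finite M" "0 \<notin> M" and V: "finite V" "0 \<notin> V"
  shows "iter_dilate M r (\<lambda>i. if i \<in> V then 1 else 0) k
    = (\<Sum>v\<in>{v\<in>V. v dvd k}. iter_dilate M r (\<lambda>i. if i = 1 then 1 else 0) (k div v))"
proof (induction r arbitrary: k)
  case 0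
  have "{v \<in> V. v dvd k} \<inter> {v. k div v = 1} = (if k \<in> V then {k} else {})"
  proof -
    have "v dvd k \<and> k div v = 1 \<longleftrightarrow> v = k" if "v \<in> V" for v
    proof -
      have "v > 0" using that V by (metis gr0I)
      then show ?thesis by (metis div_self dvd_mult_div_cancel dvd_refl less_numeral_extra(3) mult.right_neutral)
    qed
    then show ?thesis by auto
  qed
  then show ?case using V by (simp add: sum.If_cases)
next
  case (Suc r)
  let ?c = "iter_dilate M r (\<lambda>i. if i = 1 then 1 else 0)"
  have dv: "m dvd k \<and> v dvd k div m \<longleftrightarrow> v dvd k \<and> m dvd k div v" if "m \<in> M" "v \<in> V" for m v
  proof -
    have "m > 0" "v > 0" using that M V by (metis gr0I)+
    then have "m dvd k \<and> v dvd k div m \<longleftrightarrow> m * v dvd k" "v dvd k \<and> m dvd k div v \<longleftrightarrow> v * m dvd k"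
      by (auto simp: dvd_def ac_simps)
    then show ?thesis by (simp add: mult.commute)
  qed
  have "iter_dilate M (Suc r) (\<lambda>i. if i \<in> V then 1 else 0) k
      = (\<Sum>m\<in>{m\<in>M. m dvd k}. \<Sum>v\<in>{v\<in>V. v dvd k div m}. ?c (k div m div v) / real m)"
    by (simp add: dilate_sum_def Suc sum_divide_distrib)
  also have "\<dots> = (\<Sum>m\<in>M. \<Sum>v\<in>V. if m dvd k \<and> v dvd k div m then ?c (k div m div v) / real m else 0)"
    using M V by (simp add: sum.inter_filter[symmetric] flip: if_bool_eq_conj)
       (intro sum.mono_neutral_cong_left, auto simp: sum.inter_filter)
  also have "\<dots> = (\<Sum>v\<in>V. \<Sum>m\<in>M. if v dvd k \<and> m dvd k div v then ?c (k div v div m) / real m else 0)"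
    by (subst sum.swap) (intro sum.cong refl, auto simp: dv div_mult2_eq[symmetric] mult.commute)
  also have "\<dots> = (\<Sum>v\<in>{v\<in>V. v dvd k}. \<Sum>m\<in>{m\<in>M. m dvd k div v}. ?c (k div v div m) / real m)"
    using M V by (intro sum.mono_neutral_cong_right) (auto simp: sum.inter_filter)
  finally show ?case by (simp add: dilate_sum_def)
qed

section \<open>Factorisations of rough numbers and the resulting norm bound\<close>

lemma prime_cofactor_induct [consumes 1, case_names one mult]:
  fixes n :: nat
  assumes "n > 0" "P 1" "\<And>p j. prime p \<Longrightarrow> j > 0 \<Longrightarrow> P j \<Longrightarrow> P (p * j)"
  shows "P n"
  using assms(1)
proof (induction n rule: less_induct)
  case (less n)
  show ?case
  proof (cases "n = 1")
    case False
    then obtain p where p: "prime p" "p dvd n" using prime_factor_nat by blast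
    then obtain j where j: "n = p * j" by blast
    then have "j > 0" using less by simp
    moreover have "j < n" using j \<open>j > 0\<close> prime_gt_1_nat[OF p(1)] by simp
    ultimately show ?thesis using less assms(3)[OF p(1)] j by simp
  qed (use assms in simp)
qed

text \<open>Split off a prime \<open>p\<close>: a divisor of \<open>p * j\<close> divides
  \<open>j\<close> or is \<open>p\<close> times a divisor of \<open>j\<close>. Equality holds for
  squarefree \<open>n\<close>; a repeated prime makes the two families overlap, and counting the
  overlap twice only enlarges the bound.\<close>

lemma sum_divisors_power_bigomega_le:
  fixes a :: real
  assumes a: "a \<ge> 0" and n: "n > (0::nat)"
  shows "(\<Sum>d | d dvd n. a ^ size (prime_factorization d)) \<le> (1 + a) ^ size (prime_factorization n)"
  using n
proof (induction n rule: prime_cofactor_induct)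
  case one
  then show ?case by simp
next
  case (mult p j)
  let ?O = "\<lambda>d::nat. size (prime_factorization d)"
  have O: "?O (p * d) = Suc (?O d)" if "d > 0" for d
    using that mult prime_gt_0_nat[of p] by (simp add: prime_factorization_mult prime_factorization_prime)
  have fin: "finite {d. d dvd j}" using mult by simp
  have sub: "{d. d dvd p * j} \<subseteq> {d. d dvd j} \<union> (*) p ` {d. d dvd j}"
  proof
    fix d assume d: "d \<in> {d. d dvd p * j}"
    show "d \<in> {d. d dvd j} \<union> (*) p ` {d. d dvd j}"
    proof (cases "p dvd d")
      case True
      then obtain d' where d': "d = p * d'" by blast
      then have "d' dvd j" using d prime_gt_0_nat[OF mult(1)] by simp
      then show ?thesis using d' by blast
    next
      case False
      then have "coprime d p" using mult(1) by (metis coprime_commute prime_imp_coprime_nat)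
      then show ?thesis using d coprime_dvd_mult_right_iff by blast
    qed
  qed
  have "(\<Sum>d | d dvd p * j. a ^ ?O d) \<le> (\<Sum>d\<in>{d. d dvd j} \<union> (*) p ` {d. d dvd j}. a ^ ?O d)"
    using sub fin a by (intro sum_mono2) auto
  also have "\<dots> \<le> (\<Sum>d | d dvd j. a ^ ?O d) + (\<Sum>d\<in>(*) p ` {d. d dvd j}. a ^ ?O d)"
    using fin a by (subst sum.union_inter[symmetric]) (auto intro!: sum_nonneg)
  also have "(\<Sum>d\<in>(*) p ` {d. d dvd j}. a ^ ?O d) = (\<Sum>d | d dvd j. a * a ^ ?O d)"
  proof (subst sum.reindex)
    show "inj_on ((*) p) {d. d dvd j}" using prime_gt_0_nat[OF mult(1)] by (auto simp: inj_on_def)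
    show "sum ((\<lambda>d. a ^ ?O d) \<circ> (*) p) {d. d dvd j} = (\<Sum>d | d dvd j. a * a ^ ?O d)"
    proof (intro sum.cong refl)
      fix d assume "d \<in> {d. d dvd j}"
      then have "d > 0" using mult by (metis dvd_pos_nat mem_Collect_eq)
      then show "((\<lambda>d. a ^ ?O d) \<circ> (*) p) d = a * a ^ ?O d" using O by simp
    qed
  qed
  also have "(\<Sum>d | d dvd j. a ^ ?O d) + (\<Sum>d | d dvd j. a * a ^ ?O d) = (1 + a) * (\<Sum>d | d dvd j. a ^ ?O d)"
    by (simp add: algebra_simps sum_distrib_left sum.distrib)
  also have "\<dots> \<le> (1 + a) * (1 + a) ^ ?O j" using mult a by (intro mult_left_mono) auto
  also have "\<dots> = (1 + a) ^ ?O (p * j)" using O mult by simp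
  finally show ?case .
qed

text \<open>Every prime factor is at least \<open>r\<^sup>2\<close>, so it pays for the two factors
  \<open>r\<close> that it contributes to the square. This is how roughness beats the growth of
  \<open>r\<close>-fold divisor functions.\<close>

lemma power_bigomega_le:
  fixes r n :: nat
  assumes "n > 0" "\<And>p. prime p \<Longrightarrow> p dvd n \<Longrightarrow> r\<^sup>2 \<le> p"
  shows "(r ^ size (prime_factorization n))\<^sup>2 \<le> n"
  using assms
proof (induction n rule: prime_cofactor_induct)
  case (mult p j)
  have "size (prime_factorization (p * j)) = Suc (size (prime_factorization j))"
    using mult prime_gt_0_nat[of p] by (simp add: prime_factorization_mult prime_factorization_prime)
  then have "(r ^ size (prime_factorization (p * j)))\<^sup>2 = r\<^sup>2 * (r ^ size (prime_factorization j))\<^sup>2"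
    by (simp add: power_mult_distrib)
  also have "\<dots> \<le> p * j" using mult by (intro mult_mono) auto
  finally show ?case .
qed simp

text \<open>The weights \<open>1 / m\<close> multiply to \<open>1 / i\<close>, so the left side
  counts ordered factorisations of \<open>i\<close> into \<open>r\<close> elements of
  \<open>M\<close>. Distributing the prime factors among \<open>r\<close> places bounds their
  number.\<close>

lemma iter_dilate_unit_le:
  assumes M: "finite M" "0 \<notin> M" and i: "i > 0"
  shows "real i * iter_dilate M r (\<lambda>i. if i = 1 then 1 else 0) i \<le> real r ^ size (prime_factorization i)"
  using i
proof (induction r arbitrary: i)
  case 0
  then show ?case by simp
next
  case (Suc r)
  let ?c = "iter_dilate M r (\<lambda>i. if i = 1 then 1 else 0)"
  let ?O = "\<lambda>d::nat. size (prime_factorization d)"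
  have "real i * iter_dilate M (Suc r) (\<lambda>i. if i = 1 then 1 else 0) i
      = (\<Sum>m\<in>{m\<in>M. m dvd i}. real (i div m) * ?c (i div m))"
    by (simp add: dilate_sum_def sum_distrib_left real_of_nat_div)
  also have "\<dots> \<le> (\<Sum>m\<in>{m\<in>M. m dvd i}. real r ^ ?O (i div m))"
    using Suc.prems by (intro sum_mono Suc.IH) (auto simp: dvd_div_eq_0_iff)
  also have "\<dots> \<le> (\<Sum>m | m dvd i. real r ^ ?O (i div m))"
    using Suc.prems by (intro sum_mono2) auto
  also have "\<dots> = (\<Sum>d | d dvd i. real r ^ ?O d)"
    by (rule sum.reindex_bij_witness[of _ "\<lambda>d. i div d" "\<lambda>d. i div d"]) (use Suc.prems in auto)
  also have "\<dots> \<le> (1 + real r) ^ ?O i" by (intro sum_divisors_power_bigomega_le) (use Suc.prems in auto)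
  finally show ?case by (simp add: add.commute)
qed

lemma sum_rough_three_halves_le:
  assumes M: "finite M" "\<And>m. m \<in> M \<Longrightarrow> y < m" and y: "y \<ge> (1::nat)"
  shows "(\<Sum>m\<in>M. 1 / (real m * sqrt (real m))) \<le> 2 / sqrt (real y)"
proof -
  have telescope: "1 / (real (Suc n) * sqrt (real (Suc n))) \<le> 2 / sqrt (real n) - 2 / sqrt (real (Suc n))" if "n \<ge> 1" for n :: nat
  proof -
    define a where "a = sqrt (real n)"
    define b where "b = sqrt (real (Suc n))"
    have ab: "a > 0" "a \<le> b" "b > 0" using that by (auto simp: a_def b_def)
    have sq: "b\<^sup>2 = a\<^sup>2 + 1" by (simp add: a_def b_def)
    have "(b - a) * (2 * b) \<ge> (b - a) * (b + a)" using ab by (intro mult_left_mono) auto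
    also have "(b - a) * (b + a) = 1" using sq by (simp add: algebra_simps power2_eq_square)
    finally have d: "2 * (b - a) \<ge> 1 / b" using ab by (simp add: field_simps)
    have "1 / (b\<^sup>2 * b) = (1 / b) / (b * b)" by (simp add: power2_eq_square)
    also have "\<dots> \<le> 2 * (b - a) / (a * b)"
      using d ab by (intro frac_le mult_mono) auto
    also have "\<dots> = 2 / a - 2 / b" using ab by (simp add: field_simps)
    finally show ?thesis by (simp add: a_def b_def)
  qed
  have le: "(\<Sum>m\<in>{y<..z}. 1 / (real m * sqrt (real m))) \<le> 2 / sqrt (real y) - 2 / sqrt (real z)" if "y \<le> z" for z
    using that
  proof (induction z rule: dec_induct)
    case (step n)
    have "{y<..Suc n} = insert (Suc n) {y<..n}" using step by auto
    then show ?case using step telescope[of n] y by simp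
  qed simp
  define z where "z = Max (insert y M)"
  have z: "y \<le> z" "M \<subseteq> {y<..z}" using M by (auto simp: z_def)
  have "(\<Sum>m\<in>M. 1 / (real m * sqrt (real m))) \<le> (\<Sum>m\<in>{y<..z}. 1 / (real m * sqrt (real m)))"
    using z by (intro sum_mono2) auto
  also have "\<dots> \<le> 2 / sqrt (real y) - 2 / sqrt (real z)" using le z by simp
  also have "\<dots> \<le> 2 / sqrt (real y)" by simp
  finally show ?thesis .
qed

text \<open>The operator \<open>R = dilate_sum M\<close> is hyponormal on nonnegative functions, so the numbers
  \<open>\<parallel>R\<^sup>r 1\<^sub>V\<parallel>\<^sup>2\<close> are log-convex in \<open>r\<close>. Hence \<open>\<parallel>R 1\<^sub>V\<parallel>\<^sup>2\<close> is controlled by the \<open>r\<close>-th root of the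
  trivial bound \<open>|V|\<^sup>2 \<parallel>R\<^sup>r \<delta>\<^sub>1\<parallel>\<^sup>2\<close>, in which \<open>|V|\<close> costs only a constant factor.\<close>

lemma rough_dilate_norm_le:
  assumes M: "finite M" "\<And>m. m \<in> M \<Longrightarrow> y < m" "\<And>m p. m \<in> M \<Longrightarrow> prime p \<Longrightarrow> p dvd m \<Longrightarrow> y < p"
    and V: "finite V" "0 \<notin> V" "card V \<le> 4 ^ r"
    and r: "r \<ge> 1" and y: "r\<^sup>2 \<le> y"
  shows "(\<Sum>k\<in>mult_set M V. (dilate_sum M (\<lambda>i. if i \<in> V then 1 else 0) k)\<^sup>2) \<le> 8 / sqrt (real y) * real (card V)"
proof (cases "V = {}")
  case True
  then show ?thesis by (simp add: mult_set_def)
next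
  case False
  have y1: "y \<ge> 1" using r y by (metis le_trans one_le_power)
  have M0: "0 \<notin> M" using M(2) by blast
  let ?w = "\<lambda>i. if i \<in> V then 1 else 0 :: real"
  let ?u = "\<lambda>i. if i = 1 then 1 else 0 :: real"
  let ?I = "\<lambda>r. iter_mult_set M r V"
  let ?U = "\<lambda>r. iter_mult_set M r {1}"
  let ?c = "\<lambda>r. iter_dilate M r ?u"
  define \<sigma> where "\<sigma> = (\<Sum>m\<in>M. 1 / (real m * sqrt (real m)))"
  define a where "a = (\<lambda>r. \<Sum>j\<in>?I r. (iter_dilate M r ?w j)\<^sup>2)"
  have \<sigma>0: "\<sigma> \<ge> 0" by (auto simp: \<sigma>_def intro: sum_nonneg)
  have \<sigma>: "\<sigma> \<le> 2 / sqrt (real y)" unfolding \<sigma>_def by (rule sum_rough_three_halves_le) (use M y1 in auto)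
  have finI: "finite (?I r)" for r using M V by (simp add: iter_mult_set_props)
  have finU: "finite (?U r)" for r using M by (simp add: iter_mult_set_props)
  have a0: "a 0 = real (card V)" by (simp add: a_def)
  have V0: "real (card V) > 0" using V False by (simp add: card_gt_0_iff)
  have lc: "(a (Suc n))\<^sup>2 \<le> a n * a (Suc (Suc n))" for n
    using dilate_sum_log_convex[of M "?I n" "iter_dilate M n ?w"] M M0 finI[of n]
      iter_dilate_support[of V ?w _ M n] iter_dilate_nonneg[of ?w M n]
    by (simp add: a_def)
  have pw: "(a 1 / a 0) ^ r * a 0 \<le> a r"
    by (rule log_convex_power_bound) (use lc a0 V0 in \<open>auto simp: a_def intro!: sum_nonneg\<close>)
  have U0: "i > 0" if "i \<in> ?U n" for i n
    using iter_mult_set_props(2)[of M "{1}" n] M0 that by (metis gr0I singletonD zero_neq_one)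
  have Urough: "y < p" if "i \<in> ?U n" "prime p" "p dvd i" for i n p
    using that
  proof (induction n arbitrary: i)
    case 0
    then show ?case by simp
  next
    case (Suc n)
    then show ?case using M(3) by (auto simp: mult_set_def prime_dvd_mult_iff)
  qed
  \<comment> \<open>Roughness and \<open>r\<^sup>2 \<le> y\<close> leave at most
    \<open>sqrt i\<close> factorisations against the weight \<open>1 / i\<close>.\<close>
  have c_le: "?c r i \<le> 1 / sqrt (real i)" if "i \<in> ?U r" for i
  proof -
    have i: "i > 0" using U0 that by blast
    have "(r ^ size (prime_factorization i))\<^sup>2 \<le> i"
      using power_bigomega_le[of i r] i Urough[OF that] y by (meson le_less_trans less_imp_le)
    then have "real ((r ^ size (prime_factorization i))\<^sup>2) \<le> real i" by (simp only: of_nat_le_iff)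
    then have "real r ^ size (prime_factorization i) \<le> sqrt (real i)"
      by (intro real_le_rsqrt) simp
    with iter_dilate_unit_le[OF M(1) M0 i, of r] have "real i * ?c r i \<le> sqrt (real i)" by simp
    then have "?c r i \<le> sqrt (real i) / real i" using i by (simp add: field_simps)
    also have "\<dots> = 1 / sqrt (real i)" using i by (simp add: field_simps)
    finally show ?thesis .
  qed
  \<comment> \<open>Against the completely multiplicative function \<open>1 / sqrt i\<close>, each
    application of the operator contributes exactly one factor \<open>\<sigma>\<close>.\<close>
  have c_sum: "(\<Sum>i\<in>?U n. ?c n i * (1 / sqrt (real i))) = \<sigma> ^ n" for n
  proof (induction n)
    case (Suc n)
    have "(\<Sum>i\<in>?U (Suc n). ?c (Suc n) i * (1 / sqrt (real i)))
        = (\<Sum>i\<in>?U n. ?c n i * (\<Sum>m\<in>M. 1 / sqrt (real (m * i)) / real m))"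
      using dilate_sum_adjoint[of M "?U n" "?c n" "\<lambda>i. 1 / sqrt (real i)"] M M0 finU[of n]
        iter_dilate_support[of "{1}" ?u _ M n] by simp
    also have "\<dots> = (\<Sum>i\<in>?U n. \<sigma> * (?c n i * (1 / sqrt (real i))))"
      by (intro sum.cong refl) (simp add: \<sigma>_def sum_distrib_right sum_distrib_left sum_divide_distrib real_sqrt_mult ac_simps)
    also have "\<dots> = \<sigma> ^ Suc n" by (simp only: sum_distrib_left[symmetric] Suc power_Suc)
    finally show ?case .
  qed simp
  have c2: "(\<Sum>i\<in>?U r. (?c r i)\<^sup>2) \<le> \<sigma> ^ r"
    unfolding c_sum[symmetric] power2_eq_square
    by (intro sum_mono mult_left_mono c_le iter_dilate_nonneg) auto
  \<comment> \<open>Cauchy-Schwarz over \<open>v\<close> costs a factor \<open>card V\<close>, and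
    the outer sum over \<open>v\<close> a second one. One of them cancels against
    \<open>a 0\<close>; the other is at most \<open>4 ^ r\<close> and becomes the constant 4 after
    the \<open>r\<close>-th root.\<close>
  have "a r \<le> (\<Sum>k\<in>?I r. real (card V) * (\<Sum>v\<in>V. if v dvd k then (?c r (k div v))\<^sup>2 else 0))"
    unfolding a_def
  proof (rule sum_mono)
    fix k
    have "iter_dilate M r ?w k = (\<Sum>v\<in>V. 1 * (if v dvd k then ?c r (k div v) else 0))"
      using M M0 V by (subst iter_dilate_of_set) (simp_all add: sum.inter_filter del: One_nat_def)
    then have "(iter_dilate M r ?w k)\<^sup>2 \<le> (\<Sum>v\<in>V. 1\<^sup>2) * (\<Sum>v\<in>V. (if v dvd k then ?c r (k div v) else 0)\<^sup>2)"
      by (simp only: Cauchy_Schwarz_ineq_sum)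
    also have "(\<Sum>v\<in>V. (if v dvd k then ?c r (k div v) else 0)\<^sup>2) = (\<Sum>v\<in>V. if v dvd k then (?c r (k div v))\<^sup>2 else 0)"
      by (intro sum.cong) auto
    finally show "(iter_dilate M r ?w k)\<^sup>2 \<le> real (card V) * (\<Sum>v\<in>V. if v dvd k then (?c r (k div v))\<^sup>2 else 0)"
      by simp
  qed
  also have "\<dots> = real (card V) * (\<Sum>v\<in>V. \<Sum>k\<in>?I r. if v dvd k then (?c r (k div v))\<^sup>2 else 0)"
    by (simp add: sum_distrib_left[symmetric] sum.swap[of _ "?I r"])
  also have "\<dots> \<le> real (card V) * (\<Sum>v\<in>V. \<sigma> ^ r)"
  proof (intro mult_left_mono sum_mono)
    fix v assume v: "v \<in> V"
    then have v0: "v > 0" using V by (metis gr0I)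
    have "(\<Sum>k\<in>?I r. if v dvd k then (?c r (k div v))\<^sup>2 else 0)
        = (\<Sum>k\<in>{k\<in>?I r. v dvd k \<and> k div v \<in> ?U r}. (?c r (k div v))\<^sup>2)"
      using finI iter_dilate_support[of "{1}" ?u _ M r]
      by (intro sum.mono_neutral_cong_right) auto
    also have "\<dots> = (\<Sum>i\<in>(\<lambda>k. k div v) ` {k\<in>?I r. v dvd k \<and> k div v \<in> ?U r}. (?c r i)\<^sup>2)"
    proof -
      have "inj_on (\<lambda>k. k div v) {k\<in>?I r. v dvd k \<and> k div v \<in> ?U r}"
        by (rule inj_onI) (metis (no_types, lifting) dvd_mult_div_cancel mem_Collect_eq)
      then show ?thesis by (simp add: sum.reindex)
    qed
    also have "\<dots> \<le> (\<Sum>i\<in>?U r. (?c r i)\<^sup>2)" using finU by (intro sum_mono2) auto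
    also have "\<dots> \<le> \<sigma> ^ r" by (rule c2)
    finally show "(\<Sum>k\<in>?I r. if v dvd k then (?c r (k div v))\<^sup>2 else 0) \<le> \<sigma> ^ r" .
  qed simp
  finally have "a r \<le> real (card V) * (real (card V) * \<sigma> ^ r)" by simp
  with pw have "real (card V) * (a 1 / a 0) ^ r \<le> real (card V) * (real (card V) * \<sigma> ^ r)"
    by (simp add: a0 mult.commute)
  then have "(a 1 / a 0) ^ r \<le> real (card V) * \<sigma> ^ r" using V0 by simp
  also have "\<dots> \<le> 4 ^ r * \<sigma> ^ r"
  proof (rule mult_right_mono)
    have "real (card V) \<le> real (4 ^ r)" using V(3) by (simp only: of_nat_le_iff)
    then show "real (card V) \<le> 4 ^ r" by simp
  qed (use \<sigma>0 in simp)
  also have "\<dots> = (4 * \<sigma>) ^ r" by (simp add: power_mult_distrib)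
  finally have "a 1 / a 0 \<le> 4 * \<sigma>"
    using power_le_imp_le_base[of "a 1 / a 0" "r - 1" "4 * \<sigma>"] r \<sigma>0 by simp
  then have "a 1 / a 0 \<le> 8 / sqrt (real y)" using \<sigma> by simp
  then have "a 1 \<le> 8 / sqrt (real y) * real (card V)" using V0 a0 by (simp add: field_simps)
  then show ?thesis by (simp add: a_def)
qed

section \<open>Trigonometric polynomials\<close>

definition ec :: "int \<Rightarrow> real \<Rightarrow> complex" where
  "ec k x = cis (2 * pi * of_int k * x)"

definition circle :: "real measure" where
  "circle = restrict_space lborel {0..1}"

definition fc :: "(real \<Rightarrow> complex) \<Rightarrow> int \<Rightarrow> complex" where
  "fc f k = (\<integral>x. f x * ec (- k) x \<partial>circle)"

text \<open>The two ends of the spectrum are separate parameters because the argument rests on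
  one-sidedness: damping factors have spectrum in \<open>{- n..0}\<close>, block averages have
  positive frequencies.\<close>

definition trigpoly :: "int \<Rightarrow> int \<Rightarrow> (real \<Rightarrow> complex) \<Rightarrow> bool" where
  "trigpoly a b f \<longleftrightarrow> (\<exists>c. f = (\<lambda>x. \<Sum>k\<in>{a..b}. c k * ec k x))"

lemma ec_0 [simp]: "ec 0 x = 1"
  by (simp add: ec_def)

lemma ec_at_0 [simp]: "ec k 0 = 1"
  by (simp add: ec_def)

lemma ec_at_1 [simp]: "ec k 1 = 1"
  unfolding ec_def mult_1_right by (rule cis_multiple_2pi) simp

lemma ec_add: "ec (j + k) x = ec j x * ec k x"
  by (simp add: ec_def cis_mult algebra_simps)

lemma ec_add_arg: "ec k (x + y) = ec k x * ec k y"
  by (simp add: ec_def cis_mult algebra_simps)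

lemma ec_uminus_arg: "ec k (- x) = ec (- k) x"
  by (simp add: ec_def)

lemma ec_diff_arg: "ec k (x - y) = ec k x * ec (- k) y"
  using ec_add_arg[of k x "- y"] by (simp add: ec_uminus_arg)

lemma cnj_ec [simp]: "cnj (ec k x) = ec (- k) x"
  by (simp add: ec_def cis_cnj)

lemma norm_ec [simp]: "cmod (ec k x) = 1"
  by (simp add: ec_def)

lemma ec_of_nat_mult: "ec (int n * k) x = ec k x ^ n"
proof -
  have "real_of_int (int n * k) = real n * real_of_int k" by simp
  then show ?thesis by (simp only: ec_def Complex.DeMoivre mult.assoc mult.left_commute[of "real n"])
qed

lemma continuous_ec [continuous_intros]: "continuous_on S g \<Longrightarrow> continuous_on S (\<lambda>x. ec k (g x))"
  unfolding ec_def cis_conv_exp by (intro continuous_intros)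

lemma ec_measurable [measurable]: "ec k \<in> borel_measurable borel"
  by (intro borel_measurable_continuous_onI continuous_intros)

lemma space_circle [simp]: "space circle = {0..1}"
  by (simp add: circle_def space_restrict_space)

lemma measure_circle [simp]: "measure circle {0..1} = 1"
  by (simp add: circle_def measure_restrict_space)

lemma finite_measure_circle: "finite_measure circle"
  by (rule finite_measureI) (simp add: circle_def emeasure_restrict_space)

lemma measurable_circle: "f \<in> borel_measurable borel \<Longrightarrow> f \<in> borel_measurable circle"
  unfolding circle_def by (rule measurable_restrict_space1) simp

lemma integrable_circle_bounded:
  fixes f :: "real \<Rightarrow> 'a::{banach, second_countable_topology}"
  assumes "f \<in> borel_measurable borel" "\<And>x. norm (f x) \<le> B"
  shows "integrable circle f"
  using finite_measure.integrable_const_bound[OF finite_measure_circle, of f B]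
    measurable_circle assms by blast

lemma integrable_circle_continuous:
  fixes f :: "real \<Rightarrow> 'a::{banach, second_countable_topology}"
  assumes "continuous_on UNIV f"
  shows "integrable circle f"
proof -
  have "set_integrable lborel {0..1} f"
    by (intro borel_integrable_atLeastAtMost' continuous_on_subset[OF assms]) simp
  then show ?thesis
    by (simp add: circle_def integrable_restrict_space set_integrable_def)
qed

lemma integral_circle_const [simp]: "(\<integral>x. c \<partial>circle) = (c :: 'a::{banach, second_countable_topology})"
  by simp

lemma has_vector_derivative_ec:
  assumes "k \<noteq> 0"
  shows "((\<lambda>x. ec k x / (2 * pi * \<i> * of_int k)) has_vector_derivative ec k x) (at x within S)"
proof -
  have "((\<lambda>z. exp (2 * pi * \<i> * of_int k * z) / (2 * pi * \<i> * of_int k)) has_field_derivative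
      exp (2 * pi * \<i> * of_int k * of_real x)) (at (of_real x))"
    using assms by (auto intro!: derivative_eq_intros simp: field_simps)
  from has_vector_derivative_real_field[OF this, of S] show ?thesis
    by (simp add: ec_def cis_conv_exp ac_simps o_def)
qed

lemma integral_ec: "(\<integral>x. ec k x \<partial>circle) = (if k = 0 then 1 else 0)"
proof (cases "k = 0")
  case False
  let ?F = "\<lambda>x. ec k x / (2 * pi * \<i> * of_int k)"
  have "(\<integral>x. ec k x \<partial>circle) = (LBINT x. indicator {0..1} x *\<^sub>R ec k x)"
    by (simp add: circle_def integral_restrict_space)
  also have "\<dots> = ?F 1 - ?F 0"
  proof (rule integral_FTC_Icc)
    fix x :: real
    show "(?F has_vector_derivative ec k x) (at x within {0..1})"
      using False by (rule has_vector_derivative_ec)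
  qed (auto intro: continuous_intros)
  also have "\<dots> = 0" by simp
  finally show ?thesis using False by simp
qed simp

lemma continuous_on_trigpoly: "trigpoly a b f \<Longrightarrow> continuous_on S f"
  by (auto simp: trigpoly_def intro!: continuous_intros)

lemma fc_sum_ec:
  assumes "finite K"
  shows "fc (\<lambda>x. \<Sum>k\<in>K. c k * ec k x) j = (if j \<in> K then c j else 0)"
proof -
  have "fc (\<lambda>x. \<Sum>k\<in>K. c k * ec k x) j = (\<integral>x. (\<Sum>k\<in>K. c k * ec (k - j) x) \<partial>circle)"
    by (simp add: fc_def sum_distrib_right mult.assoc flip: ec_add)
  also have "\<dots> = (\<Sum>k\<in>K. \<integral>x. c k * ec (k - j) x \<partial>circle)"
    by (intro Bochner_Integration.integral_sum integrable_circle_continuous continuous_intros)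
  also have "\<dots> = (\<Sum>k\<in>K. if k = j then c k else 0)"
    by (intro sum.cong refl) (simp add: integral_ec)
  also have "\<dots> = (if j \<in> K then c j else 0)" using assms by (simp add: sum.delta)
  finally show ?thesis .
qed

lemma fc_trigpoly_eq_0: "trigpoly a b f \<Longrightarrow> j \<notin> {a..b} \<Longrightarrow> fc f j = 0"
  by (auto simp: trigpoly_def fc_sum_ec)

lemma trigpoly_expand:
  assumes "trigpoly a b f" "finite K" "{a..b} \<subseteq> K"
  shows "f x = (\<Sum>k\<in>K. fc f k * ec k x)"
proof -
  obtain c where c: "f = (\<lambda>x. \<Sum>k\<in>{a..b}. c k * ec k x)" using assms by (auto simp: trigpoly_def)
  have "(\<Sum>k\<in>K. fc f k * ec k x) = (\<Sum>k\<in>{a..b}. fc f k * ec k x)"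
    using assms fc_trigpoly_eq_0[OF assms(1)] by (intro sum.mono_neutral_right) auto
  also have "\<dots> = f x" unfolding c by (intro sum.cong refl) (simp add: fc_sum_ec)
  finally show ?thesis by simp
qed

lemma trigpolyI:
  assumes "finite K" "K \<subseteq> {a..b}" "\<And>x. f x = (\<Sum>k\<in>K. c k * ec k x)"
  shows "trigpoly a b f"
  unfolding trigpoly_def
proof (intro exI ext)
  fix x
  have "f x = (\<Sum>k\<in>K. (if k \<in> K then c k else 0) * ec k x)" using assms(3) by simp
  also have "\<dots> = (\<Sum>k\<in>{a..b}. (if k \<in> K then c k else 0) * ec k x)"
    using assms by (intro sum.mono_neutral_left) auto
  finally show "f x = (\<Sum>k\<in>{a..b}. (if k \<in> K then c k else 0) * ec k x)" .
qed

lemma trigpoly_mono: "trigpoly a b f \<Longrightarrow> a' \<le> a \<Longrightarrow> b \<le> b' \<Longrightarrow> trigpoly a' b' f"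
  by (rule trigpolyI[of "{a..b}"]) (auto intro: trigpoly_expand)

lemma trigpoly_const: "a \<le> 0 \<Longrightarrow> 0 \<le> b \<Longrightarrow> trigpoly a b (\<lambda>x. c)"
  by (rule trigpolyI[of "{0}" _ _ _ "\<lambda>_. c"]) auto

lemma trigpoly_ec: "a \<le> k \<Longrightarrow> k \<le> b \<Longrightarrow> trigpoly a b (ec k)"
  by (rule trigpolyI[of "{k}" _ _ _ "\<lambda>_. 1"]) auto

lemma trigpoly_add: "trigpoly a b f \<Longrightarrow> trigpoly a b g \<Longrightarrow> trigpoly a b (\<lambda>x. f x + g x)"
  by (auto simp: trigpoly_def sum.distrib[symmetric] distrib_right[symmetric])

lemma trigpoly_cmult: "trigpoly a b f \<Longrightarrow> trigpoly a b (\<lambda>x. c * f x)"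
  by (auto simp: trigpoly_def sum_distrib_left mult.assoc[symmetric])

lemma trigpoly_diff: "trigpoly a b f \<Longrightarrow> trigpoly a b g \<Longrightarrow> trigpoly a b (\<lambda>x. f x - g x)"
  by (auto simp: trigpoly_def sum_subtractf[symmetric] left_diff_distrib[symmetric])

lemma trigpoly_sum: "(\<And>i. i \<in> I \<Longrightarrow> trigpoly a b (f i)) \<Longrightarrow> a \<le> 0 \<Longrightarrow> 0 \<le> b \<Longrightarrow> trigpoly a b (\<lambda>x. \<Sum>i\<in>I. f i x)"
  by (induction I rule: infinite_finite_induct) (auto intro: trigpoly_const trigpoly_add)

lemma trigpoly_ec_mult: "trigpoly a b f \<Longrightarrow> trigpoly (a + k) (b + k) (\<lambda>x. f x * ec k x)"
proof -
  assume f: "trigpoly a b f"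
  show ?thesis
  proof (rule trigpolyI[of "(\<lambda>j. j + k) ` {a..b}" _ _ _ "\<lambda>j. fc f (j - k)"])
    fix x
    have "f x * ec k x = (\<Sum>j\<in>{a..b}. fc f j * ec (j + k) x)"
      using trigpoly_expand[OF f, of "{a..b}" x] by (simp add: sum_distrib_right ec_add mult.assoc)
    also have "\<dots> = (\<Sum>j\<in>(\<lambda>j. j + k) ` {a..b}. fc f (j - k) * ec j x)"
      by (subst sum.reindex) (auto simp: inj_on_def)
    finally show "f x * ec k x = (\<Sum>j\<in>(\<lambda>j. j + k) ` {a..b}. fc f (j - k) * ec j x)" .
  qed auto
qed

lemma trigpoly_mult:
  assumes f: "trigpoly a b f" and g: "trigpoly a' b' g"
  shows "trigpoly (a + a') (b + b') (\<lambda>x. f x * g x)"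
proof -
  have *: "trigpoly (a + a') (b + b') (\<lambda>x. \<Sum>k\<in>K. c k * (f x * ec k x))" if "finite K" "K \<subseteq> {a'..b'}" for K c
    using that
  proof (induction K rule: finite_induct)
    case empty
    show ?case by (rule trigpolyI[of "{}"]) auto
  next
    case (insert k K)
    have "trigpoly (a + a') (b + b') (\<lambda>x. c k * (f x * ec k x))"
      by (intro trigpoly_cmult trigpoly_mono[OF trigpoly_ec_mult[OF f, of k]]) (use insert in auto)
    then show ?case using insert by (simp add: trigpoly_add)
  qed
  have "(\<lambda>x. f x * g x) = (\<lambda>x. \<Sum>k\<in>{a'..b'}. fc g k * (f x * ec k x))"
    by (rule ext, subst trigpoly_expand[OF g, of "{a'..b'}"]) (simp_all add: sum_distrib_left ac_simps)
  then show ?thesis using *[of "{a'..b'}" "fc g"] by simp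
qed

lemma trigpoly_power:
  "trigpoly a 0 f \<Longrightarrow> trigpoly (int n * a) 0 (\<lambda>x. f x ^ n)"
proof (induction n)
  case 0
  then show ?case by (simp add: trigpoly_const)
next
  case (Suc n)
  from trigpoly_mult[OF Suc.prems Suc.IH[OF Suc.prems]] show ?case by (simp add: algebra_simps)
qed

lemma trigpoly_cnj: "trigpoly a b f \<Longrightarrow> trigpoly (- b) (- a) (\<lambda>x. cnj (f x))"
proof -
  assume f: "trigpoly a b f"
  show ?thesis
  proof (rule trigpolyI[of "uminus ` {a..b}" _ _ _ "\<lambda>k. cnj (fc f (- k))"])
    fix x
    show "cnj (f x) = (\<Sum>k\<in>uminus ` {a..b}. cnj (fc f (- k)) * ec k x)"
      by (subst trigpoly_expand[OF f, of "{a..b}"], simp, simp, subst sum.reindex) (auto simp: inj_on_def)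
  qed auto
qed

lemma fc_add: "continuous_on UNIV f \<Longrightarrow> continuous_on UNIV g \<Longrightarrow> fc (\<lambda>x. f x + g x) k = fc f k + fc g k"
  unfolding fc_def distrib_right
  by (intro Bochner_Integration.integral_add integrable_circle_continuous continuous_intros) auto

lemma fc_diff: "continuous_on UNIV f \<Longrightarrow> continuous_on UNIV g \<Longrightarrow> fc (\<lambda>x. f x - g x) k = fc f k - fc g k"
  unfolding fc_def left_diff_distrib
  by (intro Bochner_Integration.integral_diff integrable_circle_continuous continuous_intros) auto

lemma fc_const: "fc (\<lambda>x. c) k = (if k = 0 then c else 0)"
  by (simp add: fc_def integral_ec)

lemma trigpoly_parseval:
  assumes f: "trigpoly a b f" and K: "finite K" "{a..b} \<subseteq> K"
  shows "(\<integral>x. (cmod (f x))\<^sup>2 \<partial>circle) = (\<Sum>k\<in>K. (cmod (fc f k))\<^sup>2)"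
proof -
  have cf: "continuous_on UNIV f" using f by (rule continuous_on_trigpoly)
  have "complex_of_real (\<integral>x. (cmod (f x))\<^sup>2 \<partial>circle) = (\<integral>x. complex_of_real ((cmod (f x))\<^sup>2) \<partial>circle)"
    by (rule integral_complex_of_real[symmetric])
  also have "\<dots> = (\<integral>x. (\<Sum>k\<in>K. cnj (fc f k) * (f x * ec (- k) x)) \<partial>circle)"
  proof (rule arg_cong[where f = "lebesgue_integral circle"], rule ext)
    fix x
    have "complex_of_real ((cmod (f x))\<^sup>2) = f x * cnj (f x)" by (rule complex_norm_square)
    also have "cnj (f x) = (\<Sum>k\<in>K. cnj (fc f k) * ec (- k) x)"
      by (subst trigpoly_expand[OF f K]) simp
    finally show "complex_of_real ((cmod (f x))\<^sup>2) = (\<Sum>k\<in>K. cnj (fc f k) * (f x * ec (- k) x))"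
      by (simp add: sum_distrib_left ac_simps)
  qed
  also have "\<dots> = (\<Sum>k\<in>K. cnj (fc f k) * fc f k)"
    unfolding fc_def
    by (subst Bochner_Integration.integral_sum)
       (auto intro!: integrable_circle_continuous continuous_intros cf sum.cong)
  also have "\<dots> = complex_of_real (\<Sum>k\<in>K. (cmod (fc f k))\<^sup>2)"
    by (simp add: complex_norm_square mult.commute del: of_real_power)
  finally show ?thesis by (simp only: of_real_eq_iff)
qed

lemma trigpoly_bessel:
  assumes f: "trigpoly a b f" and K: "finite K"
  shows "(\<Sum>k\<in>K. (cmod (fc f k))\<^sup>2) \<le> (\<integral>x. (cmod (f x))\<^sup>2 \<partial>circle)"
proof -
  have "(\<Sum>k\<in>K. (cmod (fc f k))\<^sup>2) \<le> (\<Sum>k\<in>K \<union> {a..b}. (cmod (fc f k))\<^sup>2)"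
    using K by (intro sum_mono2) auto
  then show ?thesis using trigpoly_parseval[OF f, of "K \<union> {a..b}"] K by simp
qed

text \<open>\<open>circle\<close> is an interval and has no translations of its own, so the
  invariance is read off the spectrum: every nonconstant character integrates to 0 on both
  sides.\<close>

lemma integral_trigpoly_reflect:
  assumes f: "trigpoly a b f"
  shows "(\<integral>s. f (x - s) \<partial>circle) = (\<integral>s. f s \<partial>circle)"
proof -
  let ?K = "{a..b} \<union> {0}"
  have exp: "f y = (\<Sum>k\<in>?K. fc f k * ec k y)" for y by (rule trigpoly_expand[OF f]) auto
  have "(\<integral>s. f (x - s) \<partial>circle) = (\<integral>s. (\<Sum>k\<in>?K. fc f k * ec k x * ec (- k) s) \<partial>circle)"
    by (subst exp) (simp add: ec_diff_arg mult.assoc)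
  also have "\<dots> = (\<Sum>k\<in>?K. \<integral>s. fc f k * ec k x * ec (- k) s \<partial>circle)"
    by (intro Bochner_Integration.integral_sum integrable_circle_continuous continuous_intros)
  also have "\<dots> = (\<Sum>k\<in>?K. if k = 0 then fc f k else 0)"
    by (intro sum.cong refl) (simp add: integral_ec)
  also have "\<dots> = fc f 0" by (subst sum.delta) auto
  also have "\<dots> = (\<integral>s. f s \<partial>circle)" by (simp add: fc_def)
  finally show ?thesis .
qed

lemma integral_circle_mono:
  fixes f g :: "real \<Rightarrow> real"
  assumes "continuous_on UNIV f" "continuous_on UNIV g" "\<And>x. f x \<le> g x"
  shows "(\<integral>x. f x \<partial>circle) \<le> (\<integral>x. g x \<partial>circle)"
  by (rule integral_mono) (use assms integrable_circle_continuous in auto)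

section \<open>A smoothing kernel of Jackson type\<close>

locale smoothing_kernel =
  fixes m :: nat and K :: "real \<Rightarrow> real"
  assumes m: "m \<ge> 1"
    and trigpoly_K: "trigpoly (- int (2 * m)) (int (2 * m)) (\<lambda>x. of_real (K x))"
    and K_nonneg: "K x \<ge> 0"
    and integral_K: "(\<integral>x. K x \<partial>circle) = 1"
    and moment_K: "(\<integral>x. K x * (cmod (1 - ec 1 x))\<^sup>2 \<partial>circle) \<le> 6 / real m ^ 2"

lemma sum_squares_ge: "(\<Sum>k\<in>{0..int m}. (real_of_int k)\<^sup>2) \<ge> real m ^ 3 / 3"
proof (induction m)
  case (Suc m)
  have "{0..int (Suc m)} = insert (int (Suc m)) {0..int m}" by auto
  then have "(\<Sum>k\<in>{0..int (Suc m)}. (real_of_int k)\<^sup>2) = (real m + 1)\<^sup>2 + (\<Sum>k\<in>{0..int m}. (real_of_int k)\<^sup>2)"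
    by (simp add: add.commute)
  also have "\<dots> \<ge> (real m + 1)\<^sup>2 + real m ^ 3 / 3" using Suc by simp
  also have "(real m + 1)\<^sup>2 + real m ^ 3 / 3 \<ge> real (Suc m) ^ 3 / 3"
    by (simp add: power2_eq_square power3_eq_cube algebra_simps)
  finally show ?case by simp
qed simp

text \<open>The kernel is the squared modulus of the trigonometric polynomial with tent-shaped coefficients;
  multiplying that polynomial by \<open>1 - ec 1\<close> differences the tent, which makes the second moment small.\<close>

lemma smoothing_kernel_exists:
  assumes m: "m \<ge> 1"
  shows "\<exists>K. smoothing_kernel m K"
proof -
  define t :: "int \<Rightarrow> real" where "t = (\<lambda>k. of_int (max 0 (min k (2 * int m - k))))"
  define p where "p = (\<lambda>x. \<Sum>k\<in>{0..2 * int m}. of_real (t k) * ec k x)"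
  define S where "S = (\<Sum>k\<in>{0..2 * int m}. (t k)\<^sup>2)"
  define K where "K = (\<lambda>x. (cmod (p x))\<^sup>2 / S)"
  have S: "S \<ge> real m ^ 3 / 3"
  proof -
    have "real m ^ 3 / 3 \<le> (\<Sum>k\<in>{0..int m}. (real_of_int k)\<^sup>2)" by (rule sum_squares_ge)
    also have "\<dots> = (\<Sum>k\<in>{0..int m}. (t k)\<^sup>2)" by (intro sum.cong refl) (auto simp: t_def)
    also have "\<dots> \<le> S" unfolding S_def by (intro sum_mono2) auto
    finally show ?thesis .
  qed
  then have S0: "S > 0" using m by (smt (verit) of_nat_0_less_iff zero_less_power divide_pos_pos zero_less_one less_le_trans of_nat_1 of_nat_le_iff)
  have p: "trigpoly 0 (2 * int m) p"
    by (rule trigpolyI[of "{0..2 * int m}" _ _ _ "\<lambda>k. of_real (t k)"]) (auto simp: p_def)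
  have fcp: "fc p k = of_real (t k)" for k
    unfolding p_def by (subst fc_sum_ec) (auto simp: t_def)
  have "smoothing_kernel m K"
  proof
    have K_eq: "(\<lambda>x. complex_of_real (K x)) = (\<lambda>x. of_real (1 / S) * (p x * cnj (p x)))"
      by (simp add: K_def complex_norm_square del: of_real_power)
    have "trigpoly (0 + - (2 * int m)) (2 * int m + - 0) (\<lambda>x. p x * cnj (p x))"
      by (rule trigpoly_mult[OF p trigpoly_cnj[OF p]])
    then have "trigpoly (- int (2 * m)) (int (2 * m)) (\<lambda>x. p x * cnj (p x))" by simp
    from trigpoly_cmult[OF this, of "of_real (1 / S)"]
    show "trigpoly (- int (2 * m)) (int (2 * m)) (\<lambda>x. of_real (K x))"
      by (simp only: K_eq)
    show "K x \<ge> 0" for x using S0 by (simp add: K_def)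
    have "(\<integral>x. (cmod (p x))\<^sup>2 \<partial>circle) = S"
      by (subst trigpoly_parseval[OF p, of "{0..2 * int m}"]) (simp_all add: fcp S_def)
    then show "(\<integral>x. K x \<partial>circle) = 1" using S0 by (simp add: K_def)
    let ?q = "\<lambda>x. p x * (1 - ec 1 x)"
    have q: "?q x = (\<Sum>k\<in>{0..2 * int m + 1}. of_real (t k - t (k - 1)) * ec k x)" for x
    proof -
      have "p x = (\<Sum>k\<in>{0..2 * int m + 1}. of_real (t k) * ec k x)"
        unfolding p_def by (intro sum.mono_neutral_left) (auto simp: t_def)
      moreover have "p x * ec 1 x = (\<Sum>k\<in>{0..2 * int m}. of_real (t k) * ec (k + 1) x)"
        by (simp add: p_def sum_distrib_right ec_add mult.assoc)
      moreover have "\<dots> = (\<Sum>k\<in>{1..2 * int m + 1}. of_real (t (k - 1)) * ec k x)"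
        by (rule sum.reindex_bij_witness[of _ "\<lambda>k. k - 1" "\<lambda>k. k + 1"]) auto
      moreover have "\<dots> = (\<Sum>k\<in>{0..2 * int m + 1}. of_real (t (k - 1)) * ec k x)"
        by (intro sum.mono_neutral_left) (auto simp: t_def)
      ultimately show ?thesis by (simp add: algebra_simps sum_subtractf)
    qed
    have tq: "trigpoly 0 (2 * int m + 1) ?q"
      by (rule trigpolyI[of "{0..2 * int m + 1}"]) (auto simp: q)
    have fq: "fc ?q k = (if k \<in> {0..2 * int m + 1} then of_real (t k - t (k - 1)) else 0)" for k
      unfolding q by (subst fc_sum_ec) auto
    have "(\<integral>x. K x * (cmod (1 - ec 1 x))\<^sup>2 \<partial>circle) = (\<integral>x. (cmod (?q x))\<^sup>2 / S \<partial>circle)"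
      by (simp add: K_def norm_mult power_mult_distrib)
    also have "\<dots> = (\<integral>x. (cmod (?q x))\<^sup>2 \<partial>circle) / S" by simp
    also have "(\<integral>x. (cmod (?q x))\<^sup>2 \<partial>circle) = (\<Sum>k\<in>{0..2 * int m + 1}. (t k - t (k - 1))\<^sup>2)"
      by (subst trigpoly_parseval[OF tq, of "{0..2 * int m + 1}"])
         (auto simp: fq intro!: sum.cong simp flip: of_real_diff)
    also have "\<dots> = (\<Sum>k\<in>{1..2 * int m}. (t k - t (k - 1))\<^sup>2)"
      by (intro sum.mono_neutral_right) (auto simp: t_def)
    also have "\<dots> \<le> (\<Sum>k\<in>{1..2 * int m}. 1)"
    proof (rule sum_mono)
      fix k assume "k \<in> {1..2 * int m}"
      have "\<bar>t k - t (k - 1)\<bar> \<le> 1" by (auto simp: t_def)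
      then show "(t k - t (k - 1))\<^sup>2 \<le> 1" by (simp add: abs_square_le_1)
    qed
    also have "\<dots> = 2 * real m" by simp
    also have "2 * real m / S \<le> 2 * real m / (real m ^ 3 / 3)"
      using S S0 m by (intro divide_left_mono) auto
    also have "\<dots> = 6 / real m ^ 2" using m by (simp add: field_simps power2_eq_square power3_eq_cube)
    finally show "(\<integral>x. K x * (cmod (1 - ec 1 x))\<^sup>2 \<partial>circle) \<le> 6 / real m ^ 2"
      using S0 by (simp add: divide_right_mono)
  qed (use m in simp)
  then show ?thesis by blast
qed

context smoothing_kernel
begin

abbreviation Kc :: "int \<Rightarrow> complex" where "Kc \<equiv> fc (\<lambda>x. of_real (K x))"

definition smooth :: "(real \<Rightarrow> complex) \<Rightarrow> real \<Rightarrow> complex" where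
  "smooth u x = (\<integral>s. u s * of_real (K (x - s)) \<partial>circle)"

lemma continuous_K: "continuous_on UNIV K"
proof -
  have "continuous_on UNIV (\<lambda>x. Re (of_real (K x)))"
    by (intro continuous_on_Re continuous_on_trigpoly[OF trigpoly_K])
  then show ?thesis by simp
qed

lemma continuous_K' [continuous_intros]: "continuous_on UNIV g \<Longrightarrow> continuous_on UNIV (\<lambda>x. K (g x))"
  using continuous_on_compose2[OF continuous_K] by auto

lemma smooth_expand:
  assumes u: "continuous_on UNIV u"
  shows "smooth u x = (\<Sum>k\<in>{- int (2 * m)..int (2 * m)}. Kc k * fc u k * ec k x)"
proof -
  let ?I = "{- int (2 * m)..int (2 * m)}"
  have "smooth u x = (\<integral>s. (\<Sum>k\<in>?I. Kc k * ec k x * (u s * ec (- k) s)) \<partial>circle)"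
    unfolding smooth_def
    by (subst trigpoly_expand[OF trigpoly_K, of ?I]) (simp_all add: ec_diff_arg sum_distrib_left ac_simps)
  also have "\<dots> = (\<Sum>k\<in>?I. \<integral>s. Kc k * ec k x * (u s * ec (- k) s) \<partial>circle)"
    by (intro Bochner_Integration.integral_sum integrable_circle_continuous continuous_intros u)
  also have "\<dots> = (\<Sum>k\<in>?I. Kc k * fc u k * ec k x)"
    by (intro sum.cong refl, subst integral_mult_right_zero) (simp add: fc_def[of u] mult_ac)
  finally show ?thesis .
qed

lemma fc_smooth:
  assumes u: "continuous_on UNIV u"
  shows "fc (smooth u) k = Kc k * fc u k"
proof -
  have "smooth u = (\<lambda>x. \<Sum>k\<in>{- int (2 * m)..int (2 * m)}. (Kc k * fc u k) * ec k x)"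
    using smooth_expand[OF u] by blast
  then show ?thesis using fc_trigpoly_eq_0[OF trigpoly_K, of k] by (simp add: fc_sum_ec)
qed

lemma Kc_0: "Kc 0 = 1"
  by (simp add: fc_def integral_K)

lemma norm_Kc_le: "cmod (Kc k) \<le> 1"
proof -
  have "cmod (Kc k) \<le> (\<integral>x. cmod (of_real (K x) * ec (- k) x) \<partial>circle)"
    unfolding fc_def by (rule integral_norm_bound)
  also have "\<dots> = 1" using K_nonneg by (simp add: norm_mult integral_K)
  finally show ?thesis .
qed

lemma integral_K_reflect: "(\<integral>s. K (x - s) \<partial>circle) = 1"
proof -
  have "complex_of_real (\<integral>s. K (x - s) \<partial>circle) = (\<integral>s. complex_of_real (K (x - s)) \<partial>circle)"
    by (rule integral_complex_of_real[symmetric])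
  also have "\<dots> = (\<integral>s. complex_of_real (K s) \<partial>circle)"
    by (rule integral_trigpoly_reflect[OF trigpoly_K])
  also have "\<dots> = 1" by (simp add: integral_K)
  finally show ?thesis by (simp only: of_real_eq_1_iff)
qed

lemma moment_K_reflect: "(\<integral>s. K (x - s) * (cmod (ec 1 x - ec 1 s))\<^sup>2 \<partial>circle) \<le> 6 / real m ^ 2"
proof -
  let ?g = "\<lambda>s. complex_of_real (K s) * ((1 - ec 1 s) * (1 - ec (- 1) s))"
  have g: "?g s = complex_of_real (K s * (cmod (1 - ec 1 s))\<^sup>2)" for s
    using complex_norm_square[of "1 - ec 1 s"] by simp
  have tp: "trigpoly (- int (2 * m) + (0 + - 1)) (int (2 * m) + (1 + 0)) ?g"
    by (intro trigpoly_mult trigpoly_K trigpoly_diff trigpoly_const trigpoly_ec) auto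
  have shift: "cmod (1 - ec 1 (x - s)) = cmod (ec 1 x - ec 1 s)" for s
  proof -
    have "ec 1 s * (1 - ec 1 (x - s)) = ec 1 s - ec 1 x"
      by (simp add: ec_diff_arg right_diff_distrib mult.left_commute[of "ec 1 s"] flip: ec_add)
    then have "cmod (ec 1 s * (1 - ec 1 (x - s))) = cmod (ec 1 x - ec 1 s)"
      by (simp only: norm_minus_commute)
    then show ?thesis by (simp add: norm_mult)
  qed
  have "complex_of_real (\<integral>s. K (x - s) * (cmod (ec 1 x - ec 1 s))\<^sup>2 \<partial>circle) = (\<integral>s. ?g (x - s) \<partial>circle)"
    unfolding g shift by (rule integral_complex_of_real[symmetric])
  also have "\<dots> = (\<integral>s. ?g s \<partial>circle)" by (rule integral_trigpoly_reflect[OF tp])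
  also have "\<dots> = complex_of_real (\<integral>s. K s * (cmod (1 - ec 1 s))\<^sup>2 \<partial>circle)"
    unfolding g by (rule integral_complex_of_real)
  finally show ?thesis using moment_K by (simp only: of_real_eq_iff)
qed

text \<open>The second moment controls the first through
  \<open>d \<le> 1 / (2 * m) + m * d\<^sup>2 / 2\<close>, and the constant is
  \<open>1 / 2 + 6 / 2\<close>. A moment of order \<open>1 / m ^ 2\<close> is what makes the error
  \<open>X / m\<close>; with Fejer's kernel, whose second moment has order \<open>1 / m\<close>,
  this argument would give only \<open>X / sqrt m\<close>.\<close>

lemma smooth_real_close:
  fixes u :: "real \<Rightarrow> real"
  assumes u: "continuous_on UNIV u" and lip: "\<And>x y. \<bar>u x - u y\<bar> \<le> X * cmod (ec 1 x - ec 1 y)" and X: "X \<ge> 0"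
  shows "\<bar>(\<integral>s. u s * K (x - s) \<partial>circle) - u x\<bar> \<le> 7 * X / (2 * real m)"
proof -
  let ?d = "\<lambda>s. cmod (ec 1 x - ec 1 s)"
  have m0: "real m > 0" using m by simp
  have "(\<integral>s. u s * K (x - s) \<partial>circle) - u x = (\<integral>s. u s * K (x - s) \<partial>circle) - (\<integral>s. u x * K (x - s) \<partial>circle)"
    by (simp add: integral_K_reflect)
  also have "\<dots> = (\<integral>s. u s * K (x - s) - u x * K (x - s) \<partial>circle)"
    by (intro Bochner_Integration.integral_diff[symmetric] integrable_circle_continuous continuous_intros u)
  finally have "\<bar>(\<integral>s. u s * K (x - s) \<partial>circle) - u x\<bar> \<le> (\<integral>s. \<bar>u s * K (x - s) - u x * K (x - s)\<bar> \<partial>circle)"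
    using integral_norm_bound[of circle "\<lambda>s. u s * K (x - s) - u x * K (x - s)"] by simp
  also have "\<dots> \<le> (\<integral>s. X * (K (x - s) * (1 / (2 * real m)) + real m / 2 * (K (x - s) * (?d s)\<^sup>2)) \<partial>circle)"
  proof (intro integral_circle_mono continuous_intros u)
    fix s
    have am: "?d s \<le> 1 / (2 * real m) + real m / 2 * (?d s)\<^sup>2"
    proof -
      have "0 \<le> (real m * ?d s - 1)\<^sup>2 / (2 * real m)" using m0 by simp
      also have "\<dots> = 1 / (2 * real m) + real m / 2 * (?d s)\<^sup>2 - ?d s"
        using m0 by (simp add: field_simps power2_eq_square)
      finally show ?thesis by simp
    qed
    have "\<bar>u s * K (x - s) - u x * K (x - s)\<bar> = \<bar>u x - u s\<bar> * K (x - s)"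
      using K_nonneg[of "x - s"] by (simp add: left_diff_distrib[symmetric] abs_mult abs_minus_commute)
    also have "\<dots> \<le> (X * ?d s) * K (x - s)" using lip K_nonneg by (intro mult_right_mono)
    also have "\<dots> \<le> (X * (1 / (2 * real m) + real m / 2 * (?d s)\<^sup>2)) * K (x - s)"
      using am X K_nonneg by (intro mult_right_mono mult_left_mono)
    also have "\<dots> = X * (K (x - s) * (1 / (2 * real m)) + real m / 2 * (K (x - s) * (?d s)\<^sup>2))"
      by (simp add: algebra_simps)
    finally show "\<bar>u s * K (x - s) - u x * K (x - s)\<bar> \<le> X * (K (x - s) * (1 / (2 * real m)) + real m / 2 * (K (x - s) * (?d s)\<^sup>2))" .
  qed
  also have "\<dots> = X * (\<integral>s. K (x - s) * (1 / (2 * real m)) + real m / 2 * (K (x - s) * (?d s)\<^sup>2) \<partial>circle)"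
    by simp
  also have "(\<integral>s. K (x - s) * (1 / (2 * real m)) + real m / 2 * (K (x - s) * (?d s)\<^sup>2) \<partial>circle)
      = (\<integral>s. K (x - s) * (1 / (2 * real m)) \<partial>circle) + (\<integral>s. real m / 2 * (K (x - s) * (?d s)\<^sup>2) \<partial>circle)"
    by (intro Bochner_Integration.integral_add integrable_circle_continuous continuous_intros)
  also have "\<dots> = 1 / (2 * real m) + real m / 2 * (\<integral>s. K (x - s) * (?d s)\<^sup>2 \<partial>circle)"
    by (simp add: integral_K_reflect)
  also have "X * \<dots> \<le> X * (1 / (2 * real m) + real m / 2 * (6 / real m ^ 2))"
    using X moment_K_reflect[of x] by (intro mult_left_mono add_left_mono) auto
  also have "\<dots> = 7 * X / (2 * real m)" using m0 by (simp add: field_simps power2_eq_square)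
  finally show ?thesis .
qed

end

section \<open>Damping factors with nonpositive spectrum\<close>

lemma norm_exp_minus_1_le:
  fixes z :: complex
  assumes "Re z \<le> 0"
  shows "cmod (exp z - 1) \<le> cmod z"
proof -
  have "cmod (exp z - exp 0) \<le> 1 * cmod (z - 0)"
  proof (rule field_differentiable_bound)
    show "convex {z. Re z \<le> 0}" by (rule convex_halfspace_Re_le)
    show "(exp has_field_derivative exp w) (at w within {z. Re z \<le> 0})" for w
      by (rule DERIV_subset[OF DERIV_exp]) simp
  qed (use assms in auto)
  then show ?thesis by simp
qed

text \<open>The shape suits the recursion \<open>T * E + f\<close>: if
  \<open>|E| \<le> 1 - u / 2\<close> and \<open>|f| = u\<close>, then the bound 2 reproduces itself,
  as \<open>2 * (1 - u / 2) + u = 2\<close>.\<close>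

lemma exp_minus_le_half:
  fixes u :: real
  assumes "0 \<le> u" "u \<le> 1"
  shows "exp (- u) \<le> 1 - u / 2"
proof -
  have "1 \<le> (1 - u / 2) * (1 + u + u\<^sup>2 / 2)"
  proof -
    have "(1 - u / 2) * (1 + u + u\<^sup>2 / 2) = 1 + u * (1/2 - u\<^sup>2 / 4)"
      by (simp add: field_simps power2_eq_square)
    moreover have "u\<^sup>2 \<le> 1" using assms by (simp add: abs_square_le_1)
    ultimately show ?thesis using assms by simp
  qed
  also have "\<dots> \<le> (1 - u / 2) * exp u"
    using assms exp_lower_Taylor_quadratic[of u] by (intro mult_left_mono) auto
  finally show ?thesis by (simp add: exp_minus field_simps)
qed

lemma exp_minus_lipschitz:
  fixes a b :: real
  assumes "a \<ge> 0" "b \<ge> 0"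
  shows "\<bar>exp (- a) - exp (- b)\<bar> \<le> \<bar>a - b\<bar>"
proof -
  have *: "exp (- a) - exp (- b) \<le> b - a" if "a \<le> b" "a \<ge> 0" for a b :: real
  proof -
    have "exp (- a) - exp (- b) = exp (- a) * (1 - exp (- (b - a)))" by (simp add: algebra_simps flip: exp_add)
    also have "\<dots> \<le> 1 * (b - a)"
    proof (rule mult_mono)
      show "1 - exp (- (b - a)) \<le> b - a" using exp_ge_add_one_self[of "- (b - a)"] by linarith
    qed (use that in auto)
    finally show ?thesis by simp
  qed
  show ?thesis using *[of a b] *[of b a] assms by (cases "a \<le> b") (auto simp: abs_if)
qed

text \<open>Keep the constant term, double the negative frequencies and drop the positive ones. The
  coefficients of the real function \<open>q\<close> at \<open>k\<close> and \<open>- k\<close> are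
  conjugate, so the real part is unchanged; doubling costs 4 in the squared norm.\<close>

lemma trigpoly_analytic_completion:
  fixes q :: "real \<Rightarrow> real"
  assumes Q: "trigpoly (- int N) (int N) (\<lambda>x. of_real (q x))"
  shows "\<exists>h. trigpoly (- int N) 0 h \<and> (\<forall>x. Re (h x) = q x) \<and>
    (\<integral>x. (cmod (h x))\<^sup>2 \<partial>circle) \<le> 4 * (\<integral>x. (q x)\<^sup>2 \<partial>circle)"
proof -
  define c where "c = fc (\<lambda>x. complex_of_real (q x))"
  define h where "h = (\<lambda>x. \<Sum>k\<in>{- int N..0}. (if k = 0 then c 0 else 2 * c k) * ec k x)"
  have cnj_c: "cnj (c k) = c (- k)" for k
    unfolding c_def fc_def by (subst Bochner_Integration.integral_cnj[symmetric]) simp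
  have h: "trigpoly (- int N) 0 h"
    by (rule trigpolyI[of "{- int N..0}"]) (auto simp: h_def)
  have re: "Re (h x) = q x" for x
  proof -
    define s where "s = (\<Sum>k\<in>{- int N..-1}. c k * ec k x)"
    have I: "{- int N..int N} = {- int N..-1} \<union> ({0} \<union> {1..int N})" "{- int N..0} = {- int N..-1} \<union> {0}" by auto
    have "(\<Sum>k\<in>{1..int N}. c k * ec k x) = cnj s"
      unfolding s_def cnj_sum
      by (rule sum.reindex_bij_witness[of _ uminus uminus]) (auto simp: cnj_c)
    moreover have "complex_of_real (q x) = (\<Sum>k\<in>{- int N..int N}. c k * ec k x)"
      unfolding c_def by (rule trigpoly_expand[OF Q]) auto
    moreover have "\<dots> = s + (\<Sum>k\<in>{0} \<union> {1..int N}. c k * ec k x)"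
      unfolding I s_def by (rule sum.union_disjoint) auto
    moreover have "(\<Sum>k\<in>{0} \<union> {1..int N}. c k * ec k x) = c 0 + (\<Sum>k\<in>{1..int N}. c k * ec k x)"
      by (subst sum.union_disjoint) auto
    ultimately have "complex_of_real (q x) = s + (c 0 + cnj s)" by simp
    then have "q x = Re (s + (c 0 + cnj s))" by (metis Re_complex_of_real)
    have "h x = (\<Sum>k\<in>{- int N..-1}. 2 * (c k * ec k x)) + c 0"
      unfolding h_def I by (subst sum.union_disjoint) (auto simp: mult.assoc)
    then have "h x = 2 * s + c 0" by (simp only: s_def sum_distrib_left)
    with \<open>q x = Re (s + (c 0 + cnj s))\<close> show ?thesis by simp
  qed
  have fch: "fc h k = (if k \<in> {- int N..0} then (if k = 0 then c 0 else 2 * c k) else 0)" for k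
    unfolding h_def by (subst fc_sum_ec) auto
  have "(\<integral>x. (cmod (h x))\<^sup>2 \<partial>circle) = (\<Sum>k\<in>{- int N..0}. (cmod (fc h k))\<^sup>2)"
    by (rule trigpoly_parseval[OF h]) auto
  also have "\<dots> \<le> (\<Sum>k\<in>{- int N..0}. 4 * (cmod (c k))\<^sup>2)"
    by (intro sum_mono) (auto simp: fch norm_mult power_mult_distrib)
  also have "\<dots> = 4 * (\<Sum>k\<in>{- int N..0}. (cmod (c k))\<^sup>2)" by (simp add: sum_distrib_left)
  also have "\<dots> \<le> 4 * (\<integral>x. (cmod (complex_of_real (q x)))\<^sup>2 \<partial>circle)"
    unfolding c_def using trigpoly_bessel[OF Q, of "{- int N..0}"] by simp
  finally show ?thesis using h re by auto
qed

text \<open>Taylor sections of the exponential, whose powers of \<open>h\<close> keep the spectrum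
  nonpositive. The degree \<open>N'\<close> is left uncontrolled; a later smoothing repairs
  this.\<close>

lemma trigpoly_exp_approx:
  assumes h: "trigpoly (- int N) 0 h" and \<delta>: "\<delta> > 0"
  shows "\<exists>E N'. trigpoly (- int N') 0 E \<and> (\<forall>x. cmod (E x - exp (- h x)) \<le> \<delta>)"
proof -
  define H where "H = (\<Sum>k\<in>{- int N..0}. cmod (fc h k))"
  have H: "cmod (h x) \<le> H" for x
  proof -
    have "cmod (h x) \<le> (\<Sum>k\<in>{- int N..0}. cmod (fc h k * ec k x))"
      by (subst trigpoly_expand[OF h, of "{- int N..0}"]) (auto intro: norm_sum)
    then show ?thesis by (simp add: norm_mult H_def)
  qed
  have H0: "H \<ge> 0" by (simp add: H_def sum_nonneg)
  have "(\<lambda>n. exp H * H * (inverse (fact n) * H ^ n)) \<longlonglongrightarrow> exp H * H * 0"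
    by (intro tendsto_intros summable_LIMSEQ_zero summable_exp)
  then have "eventually (\<lambda>n. exp H * H * (inverse (fact n) * H ^ n) < \<delta>) sequentially"
    using \<delta> by (intro order_tendstoD(2)[of _ 0]) simp_all
  then obtain n where n: "exp H * H * (inverse (fact n) * H ^ n) < \<delta>"
    using eventually_happens'[OF sequentially_bot] by blast
  define E where "E = (\<lambda>x. \<Sum>i\<in>{..n}. (1 / fact i) * (- h x) ^ i)"
  have "trigpoly (- int (n * N)) 0 E"
    unfolding E_def
  proof (intro trigpoly_sum trigpoly_cmult)
    fix i assume i: "i \<in> {..n}"
    have "trigpoly (- int N) 0 (\<lambda>x. - h x)" using trigpoly_cmult[OF h, of "- 1"] by simp
    from trigpoly_power[OF this, of i] show "trigpoly (- int (n * N)) 0 (\<lambda>x. (- h x) ^ i)"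
      by (rule trigpoly_mono) (use i in \<open>auto intro: mult_right_mono\<close>)
  qed auto
  moreover have "cmod (E x - exp (- h x)) \<le> \<delta>" for x
  proof -
    have "cmod (E x - exp (- h x)) = cmod (exp (- h x) - (\<Sum>i\<le>n. (- h x) ^ i / fact i))"
      by (simp add: E_def norm_minus_commute)
    also have "\<dots> \<le> exp (norm (- h x)) * norm (- h x) ^ Suc n / fact n" by (rule Taylor_exp_field)
    also have "\<dots> \<le> exp H * H ^ Suc n / fact n"
      using H H0 by (intro divide_right_mono mult_mono power_mono) auto
    also have "\<dots> \<le> \<delta>" using n by (simp add: field_simps)
    finally show ?thesis .
  qed
  ultimately show ?thesis by blast
qed

text \<open>Distances are chordal, \<open>|ec 1 x - ec 1 y|\<close>: this is periodic, and its
  square is a trigonometric polynomial to which the kernel moments apply.\<close>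

lemma norm_ec_diff_le: "cmod (ec (int v) x - ec (int v) y) \<le> real v * cmod (ec 1 x - ec 1 y)"
  using norm_power_diff[of "ec 1 x" "ec 1 y" v] ec_of_nat_mult[of v 1 x] ec_of_nat_mult[of v 1 y] by simp

definition block_avg :: "nat set \<Rightarrow> real \<Rightarrow> complex" where
  "block_avg B x = (\<Sum>v\<in>B. ec (int v) x) / of_nat (card B)"

lemma fc_block_avg:
  assumes "finite B"
  shows "fc (block_avg B) k = (if k \<in> int ` B then 1 / of_nat (card B) else 0)"
proof -
  have "block_avg B = (\<lambda>x. \<Sum>k\<in>int ` B. 1 / of_nat (card B) * ec k x)"
    by (rule ext) (simp add: block_avg_def sum.reindex sum_divide_distrib)
  then show ?thesis
    using fc_sum_ec[OF finite_imageI[OF assms, of int], where c = "\<lambda>_. 1 / of_nat (card B)" and j = k] by (simp only:)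
qed

lemma trigpoly_block_avg:
  assumes "finite B" "B \<subseteq> {a..b}"
  shows "trigpoly (int a) (int b) (block_avg B)"
  by (rule trigpolyI[of "int ` B" _ _ _ "\<lambda>_. 1 / of_nat (card B)"])
     (use assms in \<open>auto simp: block_avg_def sum.reindex sum_divide_distrib\<close>)

lemma norm_block_avg_le: "cmod (block_avg B x) \<le> 1"
proof (cases "card B = 0")
  case False
  have "cmod (\<Sum>v\<in>B. ec (int v) x) \<le> (\<Sum>v\<in>B. 1)" by (rule sum_norm_le) simp
  then show ?thesis using False by (simp add: block_avg_def norm_divide field_simps)
qed (simp add: block_avg_def)

lemma integral_block_avg_sq:
  assumes B: "finite B" "B \<noteq> {}"
  shows "(\<integral>x. (cmod (block_avg B x))\<^sup>2 \<partial>circle) = 1 / real (card B)"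
proof -
  have c: "real (card B) > 0" using B by (simp add: card_gt_0_iff)
  have "B \<subseteq> {0..Max B}" using B by auto
  from trigpoly_block_avg[OF B(1) this] have tp: "trigpoly 0 (int (Max B)) (block_avg B)" by simp
  have "(\<integral>x. (cmod (block_avg B x))\<^sup>2 \<partial>circle) = (\<Sum>k\<in>{0..int (Max B)}. (cmod (fc (block_avg B) k))\<^sup>2)"
    by (rule trigpoly_parseval[OF tp]) auto
  also have "\<dots> = (\<Sum>k\<in>int ` B. (1 / real (card B))\<^sup>2)"
    by (rule sum.mono_neutral_cong_right) (use B in \<open>auto simp: fc_block_avg norm_divide\<close>)
  also have "\<dots> = 1 / real (card B)" using c by (simp add: card_image power2_eq_square)
  finally show ?thesis .
qed

lemma block_avg_lipschitz:
  assumes B: "finite B" "B \<subseteq> {..X}"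
  shows "cmod (block_avg B x - block_avg B y) \<le> real X * cmod (ec 1 x - ec 1 y)"
proof (cases "card B = 0")
  case False
  then have c: "real (card B) > 0" by simp
  have "cmod (\<Sum>v\<in>B. ec (int v) x - ec (int v) y) \<le> (\<Sum>v\<in>B. real X * cmod (ec 1 x - ec 1 y))"
  proof (rule sum_norm_le)
    fix v assume "v \<in> B"
    then have "real v \<le> real X" using B by auto
    then show "cmod (ec (int v) x - ec (int v) y) \<le> real X * cmod (ec 1 x - ec 1 y)"
      using norm_ec_diff_le[of v x y] by (meson mult_right_mono norm_ge_zero order_trans)
  qed
  then have "cmod (\<Sum>v\<in>B. ec (int v) x - ec (int v) y) / real (card B) \<le> real X * cmod (ec 1 x - ec 1 y)"
    using c by (simp add: field_simps)
  then show ?thesis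
    by (simp add: block_avg_def sum_subtractf norm_divide flip: diff_divide_distrib)
qed (simp add: block_avg_def)

text \<open>The damping factor is \<open>exp (- h)\<close> for an analytic completion \<open>h\<close> of (slightly more than) \<open>|f|\<close>,
  truncated to a polynomial and then smoothed so that its degree is comparable with that of \<open>f\<close>.\<close>

lemma damping_polynomial:
  assumes B: "finite B" "B \<noteq> {}" "B \<subseteq> {..X}" and X: "X \<ge> 1" and m: "m \<ge> 1"
  shows "\<exists>E. trigpoly (- int (2 * m)) 0 E \<and>
    (\<forall>x. cmod (E x) \<le> 1 - cmod (block_avg B x) / 2 + 4 * real X / real m) \<and>
    (\<integral>x. (cmod (E x - 1))\<^sup>2 \<partial>circle) \<le> 25 / real (card B)"
proof -
  define M where "M = real (card B)"
  have "card B \<ge> 1" using B by (simp add: Suc_leI card_gt_0_iff)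
  then have M: "M \<ge> 1" by (simp add: M_def)
  define u where "u = (\<lambda>x. cmod (block_avg B x))"
  have X0: "real X \<ge> 1" using X by simp
  have u0: "u x \<ge> 0" and u1: "u x \<le> 1" for x by (simp_all add: u_def norm_block_avg_le)
  have cf: "continuous_on UNIV (block_avg B)"
    unfolding block_avg_def by (intro continuous_intros) (use B in auto)
  have cu: "continuous_on UNIV u" unfolding u_def by (intro continuous_intros cf)
  have ulip: "\<bar>u x - u y\<bar> \<le> real X * cmod (ec 1 x - ec 1 y)" for x y
    using norm_triangle_ineq3[of "block_avg B x" "block_avg B y"] block_avg_lipschitz[OF B(1,3), of x y]
    by (simp add: u_def)
  \<comment> \<open>Raising \<open>u\<close> by \<open>\<delta>\<close> keeps the smoothed function
    above \<open>u\<close> when smoothing errs by at most \<open>\<delta>\<close>. The bound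
    \<open>1 / (8 * M)\<close> makes it negligible in squared norms; \<open>1 / (2 * m)\<close>
    brings the final error \<open>7 * X / (2 * m) + \<delta>\<close> to at most
    \<open>4 * X / m\<close>.\<close>
  define \<delta> where "\<delta> = min (1 / (8 * M)) (1 / (2 * real m))"
  have m0: "real m \<ge> 1" using m by simp
  have \<delta>: "\<delta> > 0" "\<delta> \<le> 1 / (8 * M)" "\<delta> \<le> 1 / (2 * real m)" using M m0 by (auto simp: \<delta>_def)
  have \<delta>1: "\<delta> \<le> 1" using \<delta>(2) M by (smt (verit) divide_le_eq_1)
  \<comment> \<open>\<open>|f|\<close> is not a trigonometric polynomial, so it is first
    approximated by one in order to have an analytic completion. The kernel is very fine; the large
    degree that results is cut down at the end.\<close>
  obtain m' :: nat where m': "m' > 7 * real X / (2 * \<delta>)" using reals_Archimedean2 by blast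
  have m'1: "m' \<ge> 1" using m' X0 \<delta> by (smt (verit) One_nat_def Suc_leI divide_pos_pos gr0I of_nat_0 zero_less_mult_iff)
  then obtain K' where "smoothing_kernel m' K'" using smoothing_kernel_exists by blast
  then interpret S': smoothing_kernel m' K' .
  define q where "q = (\<lambda>x. \<integral>s. (u s + \<delta>) * K' (x - s) \<partial>circle)"
  have qu: "\<bar>q x - (u x + \<delta>)\<bar> \<le> \<delta>" for x
  proof -
    have "\<bar>q x - (u x + \<delta>)\<bar> \<le> 7 * real X / (2 * real m')"
      unfolding q_def by (rule S'.smooth_real_close) (use ulip cu in \<open>auto intro!: continuous_intros\<close>)
    also have "\<dots> \<le> \<delta>" using m' m'1 \<delta> by (simp add: field_simps)
    finally show ?thesis .
  qed
  have q_eq: "complex_of_real (q x) = S'.smooth (\<lambda>s. of_real (u s + \<delta>)) x" for x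
    unfolding q_def S'.smooth_def by (subst integral_complex_of_real[symmetric]) simp
  have cu': "continuous_on UNIV (\<lambda>s. complex_of_real (u s + \<delta>))" by (intro continuous_intros cu)
  have "trigpoly (- int (2 * m')) (int (2 * m')) (\<lambda>x. of_real (q x))"
    by (rule trigpolyI[of "{- int (2 * m')..int (2 * m')}"]) (auto simp only: q_eq S'.smooth_expand[OF cu'])
  then obtain h where h: "trigpoly (- int (2 * m')) 0 h" and re: "\<And>x. Re (h x) = q x"
    and hq: "(\<integral>x. (cmod (h x))\<^sup>2 \<partial>circle) \<le> 4 * (\<integral>x. (q x)\<^sup>2 \<partial>circle)"
    using trigpoly_analytic_completion by blast
  have ch: "continuous_on UNIV h" by (rule continuous_on_trigpoly[OF h])
  have cq: "continuous_on UNIV q" unfolding re[symmetric] by (intro continuous_intros ch)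
  have q_ge: "u x \<le> q x" and q_le: "q x \<le> u x + 2 * \<delta>" for x using qu[of x] by (auto simp: abs_le_iff)
  have uint: "(\<integral>x. (u x)\<^sup>2 \<partial>circle) = 1 / M"
    unfolding u_def M_def by (rule integral_block_avg_sq) (use B in auto)
  have dsq: "\<delta>\<^sup>2 \<le> 1 / (64 * M)"
  proof -
    have "\<delta>\<^sup>2 \<le> (1 / (8 * M))\<^sup>2" using \<delta> by (intro power_mono) auto
    also have "\<dots> \<le> 1 / (64 * M)" using M by (simp add: field_simps power2_eq_square)
    finally show ?thesis .
  qed
  have scale: "1 / (64 * M) = (1 / M) / 64" "2 / M = 2 * (1 / M)" "9 / M = 9 * (1 / M)" "25 / M = 25 * (1 / M)" "1 / M > 0"
    using M by auto
  have "(\<integral>x. (q x)\<^sup>2 \<partial>circle) \<le> (\<integral>x. 2 * (u x)\<^sup>2 + 8 * \<delta>\<^sup>2 \<partial>circle)"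
  proof (intro integral_circle_mono continuous_intros cq cu)
    fix x
    have "(q x)\<^sup>2 \<le> (u x + 2 * \<delta>)\<^sup>2" using q_le[of x] q_ge[of x] u0[of x] by (intro power_mono) auto
    also have "\<dots> \<le> 2 * (u x)\<^sup>2 + 8 * \<delta>\<^sup>2"
      using zero_le_power2[of "u x - 2 * \<delta>"] by (simp add: power2_eq_square algebra_simps)
    finally show "(q x)\<^sup>2 \<le> 2 * (u x)\<^sup>2 + 8 * \<delta>\<^sup>2" .
  qed
  also have "\<dots> = (\<integral>x. 2 * (u x)\<^sup>2 \<partial>circle) + (\<integral>x. 8 * \<delta>\<^sup>2 \<partial>circle)"
    by (intro Bochner_Integration.integral_add integrable_circle_continuous continuous_intros cu)
  also have "\<dots> = 2 / M + 8 * \<delta>\<^sup>2" using uint by simp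
  finally have hM: "(\<integral>x. (cmod (h x))\<^sup>2 \<partial>circle) \<le> 9 / M"
    using hq dsq scale by linarith
  obtain E0 N' where E0: "trigpoly (- int N') 0 E0" and E0_exp: "\<And>x. cmod (E0 x - exp (- h x)) \<le> \<delta>"
    using trigpoly_exp_approx[OF h \<delta>(1)] by blast
  have cE0: "continuous_on UNIV E0" by (rule continuous_on_trigpoly[OF E0])
  have "(\<integral>x. (cmod (E0 x - 1))\<^sup>2 \<partial>circle) \<le> (\<integral>x. 2 * (cmod (h x))\<^sup>2 + 2 * \<delta>\<^sup>2 \<partial>circle)"
  proof (intro integral_circle_mono continuous_intros cE0 ch)
    fix x
    have "cmod (E0 x - 1) \<le> cmod (E0 x - exp (- h x)) + cmod (exp (- h x) - 1)"
      using norm_triangle_ineq[of "E0 x - exp (- h x)" "exp (- h x) - 1"] by simp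
    also have "cmod (exp (- h x) - 1) \<le> cmod (h x)"
      using norm_exp_minus_1_le[of "- h x"] re[of x] q_ge[of x] u0[of x] by simp
    finally have "cmod (E0 x - 1) \<le> \<delta> + cmod (h x)" using E0_exp[of x] by simp
    then have "(cmod (E0 x - 1))\<^sup>2 \<le> (\<delta> + cmod (h x))\<^sup>2" by (intro power_mono) auto
    also have "\<dots> \<le> 2 * (cmod (h x))\<^sup>2 + 2 * \<delta>\<^sup>2"
      using zero_le_power2[of "\<delta> - cmod (h x)"] by (simp add: power2_eq_square algebra_simps)
    finally show "(cmod (E0 x - 1))\<^sup>2 \<le> 2 * (cmod (h x))\<^sup>2 + 2 * \<delta>\<^sup>2" .
  qed
  also have "\<dots> = (\<integral>x. 2 * (cmod (h x))\<^sup>2 \<partial>circle) + (\<integral>x. 2 * \<delta>\<^sup>2 \<partial>circle)"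
    by (intro Bochner_Integration.integral_add integrable_circle_continuous continuous_intros ch)
  also have "\<dots> = 2 * (\<integral>x. (cmod (h x))\<^sup>2 \<partial>circle) + 2 * \<delta>\<^sup>2" by simp
  also have "\<dots> \<le> 25 / M" using hM dsq scale by linarith
  finally have E0M: "(\<integral>x. (cmod (E0 x - 1))\<^sup>2 \<partial>circle) \<le> 25 / M" .
  \<comment> \<open>The second smoothing brings the degree to \<open>2 * m\<close>. It multiplies
    coefficients by numbers of modulus at most 1, and the constant one by 1, so the spectrum stays
    nonpositive and the L2 distance to 1 does not grow; the pointwise bound \<open>exp (- u)\<close>
    moves only by the Lipschitz error.\<close>
  obtain K where "smoothing_kernel m K" using smoothing_kernel_exists m by blast
  then interpret S: smoothing_kernel m K .
  define E where "E = S.smooth E0"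
  have E: "trigpoly (- int (2 * m)) 0 E"
  proof (rule trigpolyI[of "{- int (2 * m)..0}"])
    fix x
    show "E x = (\<Sum>k\<in>{- int (2 * m)..0}. S.Kc k * fc E0 k * ec k x)"
      unfolding E_def S.smooth_expand[OF cE0]
      using fc_trigpoly_eq_0[OF E0] by (intro sum.mono_neutral_right) auto
  qed auto
  have cE: "continuous_on UNIV E" by (rule continuous_on_trigpoly[OF E])
  have "cmod (E x) \<le> 1 - u x / 2 + 4 * real X / real m" for x
  proof -
    have "cmod (E x) \<le> (\<integral>s. cmod (E0 s * of_real (K (x - s))) \<partial>circle)"
      unfolding E_def S.smooth_def by (rule integral_norm_bound)
    also have "\<dots> \<le> (\<integral>s. exp (- u s) * K (x - s) + \<delta> * K (x - s) \<partial>circle)"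
    proof (intro integral_circle_mono continuous_intros cE0 cu S.continuous_K')
      fix s
      have "cmod (E0 s) \<le> cmod (E0 s - exp (- h s)) + cmod (exp (- h s))"
        using norm_triangle_ineq[of "E0 s - exp (- h s)" "exp (- h s)"] by simp
      also have "cmod (exp (- h s)) \<le> exp (- u s)" using re[of s] q_ge[of s] by simp
      finally have "cmod (E0 s) \<le> exp (- u s) + \<delta>" using E0_exp[of s] by simp
      then show "cmod (E0 s * of_real (K (x - s))) \<le> exp (- u s) * K (x - s) + \<delta> * K (x - s)"
        using mult_right_mono[of "cmod (E0 s)" "exp (- u s) + \<delta>" "K (x - s)"] S.K_nonneg[of "x - s"]
        by (simp add: norm_mult algebra_simps)
    qed
    also have "\<dots> = (\<integral>s. exp (- u s) * K (x - s) \<partial>circle) + (\<integral>s. \<delta> * K (x - s) \<partial>circle)"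
      by (intro Bochner_Integration.integral_add integrable_circle_continuous continuous_intros cu S.continuous_K')
    also have "\<dots> = (\<integral>s. exp (- u s) * K (x - s) \<partial>circle) + \<delta>"
      by (simp add: S.integral_K_reflect)
    also have "(\<integral>s. exp (- u s) * K (x - s) \<partial>circle) \<le> exp (- u x) + 7 * real X / (2 * real m)"
    proof -
      have "\<bar>(\<integral>s. exp (- u s) * K (x - s) \<partial>circle) - exp (- u x)\<bar> \<le> 7 * real X / (2 * real m)"
      proof (rule S.smooth_real_close)
        fix x y
        show "\<bar>exp (- u x) - exp (- u y)\<bar> \<le> real X * cmod (ec 1 x - ec 1 y)"
          using exp_minus_lipschitz[OF u0 u0, of x y] ulip[of x y] by linarith
      qed (auto intro!: continuous_intros cu)
      then show ?thesis by linarith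
    qed
    also have "exp (- u x) \<le> 1 - u x / 2" by (rule exp_minus_le_half) (use u0 u1 in auto)
    also have "\<delta> \<le> real X / (2 * real m)"
      using \<delta>(3) X0 m0 by (smt (verit) divide_right_mono)
    finally show ?thesis using m0 by (simp add: field_simps)
  qed
  moreover have "(\<integral>x. (cmod (E x - 1))\<^sup>2 \<partial>circle) \<le> 25 / M"
  proof -
    let ?I = "{- int (2 * m)..0} \<union> {- int N'..0}"
    have tE: "trigpoly (- int (2 * m)) 0 (\<lambda>x. E x - 1)" by (intro trigpoly_diff E trigpoly_const) auto
    have tE0: "trigpoly (- int N') 0 (\<lambda>x. E0 x - 1)" by (intro trigpoly_diff E0 trigpoly_const) auto
    have "fc (\<lambda>x. E x - 1) k = S.Kc k * fc (\<lambda>x. E0 x - 1) k" for k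
      using S.fc_smooth[OF cE0, of k] S.Kc_0
      by (subst (1 2) fc_diff) (auto intro: cE cE0 simp: fc_const E_def[symmetric] right_diff_distrib)
    then have "cmod (fc (\<lambda>x. E x - 1) k) \<le> cmod (fc (\<lambda>x. E0 x - 1) k)" for k
      using mult_right_mono[OF S.norm_Kc_le[of k], of "cmod (fc (\<lambda>x. E0 x - 1) k)"] by (simp add: norm_mult)
    then have "(\<Sum>k\<in>?I. (cmod (fc (\<lambda>x. E x - 1) k))\<^sup>2) \<le> (\<Sum>k\<in>?I. (cmod (fc (\<lambda>x. E0 x - 1) k))\<^sup>2)"
      by (intro sum_mono power_mono) auto
    also have "\<dots> \<le> (\<integral>x. (cmod (E0 x - 1))\<^sup>2 \<partial>circle)" by (rule trigpoly_bessel[OF tE0]) auto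
    also have "\<dots> \<le> 25 / M" by (rule E0M)
    finally show ?thesis using trigpoly_parseval[OF tE, of ?I] by simp
  qed
  ultimately show ?thesis using E unfolding u_def M_def by blast
qed

section \<open>A test function in the manner of McGehee, Pigno and Smith\<close>

text \<open>The pairing is taken on the coefficient side, so \<open>g\<close> can be any array of
  coefficients, such as the noise of one block, with no function attached to it.\<close>

lemma pairing_bound:
  assumes F: "trigpoly a b F" and I: "finite I"
    and s: "(\<integral>x. (cmod (F x))\<^sup>2 \<partial>circle) \<le> s\<^sup>2" "s \<ge> 0"
    and t: "(\<Sum>k\<in>I. (cmod (g k))\<^sup>2) \<le> t\<^sup>2" "t \<ge> 0"
  shows "cmod (\<Sum>k\<in>I. cnj (fc F k) * g k) \<le> s * t"
proof -
  have "cmod (\<Sum>k\<in>I. cnj (fc F k) * g k) \<le> (\<Sum>k\<in>I. \<bar>cmod (fc F k)\<bar> * \<bar>cmod (g k)\<bar>)"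
    by (rule sum_norm_le) (simp add: norm_mult)
  also have "\<dots> \<le> L2_set (\<lambda>k. cmod (fc F k)) I * L2_set (\<lambda>k. cmod (g k)) I" by (rule L2_set_mult_ineq)
  also have "\<dots> \<le> s * t"
  proof (rule mult_mono)
    have "(\<Sum>k\<in>I. (cmod (fc F k))\<^sup>2) \<le> s\<^sup>2" using trigpoly_bessel[OF F I] s by simp
    then show "L2_set (\<lambda>k. cmod (fc F k)) I \<le> s" unfolding L2_set_def using s(2) real_le_lsqrt by blast
    show "L2_set (\<lambda>k. cmod (g k)) I \<le> t" unfolding L2_set_def using t real_le_lsqrt by blast
  qed (use s in \<open>auto simp: L2_set_def intro: sum_nonneg\<close>)
  finally show ?thesis .
qed

text \<open>Each new block damps the sum of the earlier ones where its own average is large; this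
  keeps the total bounded although \<open>J\<close> terms are added.\<close>

fun damped_sum :: "(nat \<Rightarrow> real \<Rightarrow> complex) \<Rightarrow> (nat \<Rightarrow> real \<Rightarrow> complex) \<Rightarrow> nat \<Rightarrow> real \<Rightarrow> complex" where
  "damped_sum E f 0 = (\<lambda>x. 0)"
| "damped_sum E f (Suc i) = (\<lambda>x. damped_sum E f i x * E (Suc i) x + f (Suc i) x)"

text \<open>The coefficient at frequency \<open>k\<close> of the formal series with terms
  \<open>\<kappa>(m) e(m v x)\<close>.\<close>

definition dilated_coeff :: "(int \<Rightarrow> complex) \<Rightarrow> nat \<Rightarrow> int \<Rightarrow> complex" where
  "dilated_coeff \<kappa> v k = (if int v dvd k then \<kappa> (k div int v) else 0)"

text \<open>Every block contributes at least 1. The final function is \<open>T (i - 1)\<close> plus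
  the increments \<open>D k + f k\<close> for \<open>k \<ge> i\<close>. The first part does not see
  block \<open>i\<close>; \<open>f i\<close> against the frequencies \<open>v\<close> themselves
  gives at least 2; all other pairings are bounded by L2 norms, of order \<open>128 ^ i\<close> for
  the block against \<open>1 / 128 ^ k\<close> for the increments, so they form a geometric series.
  The block sizes \<open>16384 ^ i = (128 ^ i)\<^sup>2\<close> are chosen to make its ratio
  \<open>1 / 128\<close>.\<close>

lemma weak_littlewood:
  fixes B :: "nat \<Rightarrow> nat set" and \<kappa> :: "int \<Rightarrow> complex" and \<omega> :: "nat \<Rightarrow> real"
  assumes J: "J \<ge> 1"
    and B_card: "\<And>i. i \<in> {1..J} \<Longrightarrow> card (B i) = 16384 ^ i"
    and B_pos: "\<And>i. i \<in> {1..J} \<Longrightarrow> 0 \<notin> B i"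
    and B_less: "\<And>i j v w. i \<in> {1..J} \<Longrightarrow> j \<in> {1..J} \<Longrightarrow> i < j \<Longrightarrow> v \<in> B i \<Longrightarrow> w \<in> B j \<Longrightarrow> v < w"
    and R: "finite R" "\<And>i v w. i \<in> {1..J} \<Longrightarrow> v \<in> B i \<Longrightarrow> w \<in> R \<Longrightarrow> v < w"
    and \<omega>: "\<And>v. 1 \<le> \<omega> v" "\<And>v. \<omega> v \<le> 2"
    and \<kappa>1: "\<kappa> 1 = 2" and y: "24 * int J * int J \<le> y"
    and \<kappa>: "\<And>m. m \<noteq> 1 \<Longrightarrow> \<bar>m\<bar> \<le> y \<Longrightarrow> \<kappa> m = 0"
    and noise: "\<And>i K. i \<in> {1..J} \<Longrightarrow> finite K \<Longrightarrow>
      (\<Sum>k\<in>K. (cmod (\<Sum>v\<in>B i. of_real (\<omega> v) * (if k = int v then 0 else dilated_coeff \<kappa> v k)))\<^sup>2)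
        \<le> real (card (B i)) / 1200"
  shows "\<exists>T a b. trigpoly a b T \<and> (\<forall>x. cmod (T x) \<le> 3) \<and>
    Re (\<Sum>k\<in>{a..b}. cnj (fc T k) * (\<Sum>v\<in>(\<Union>i\<in>{1..J}. B i) \<union> R. of_real (\<omega> v) * dilated_coeff \<kappa> v k)) \<ge> real J"
proof -
  have B_ne: "B i \<noteq> {}" and B_fin: "finite (B i)" if "i \<in> {1..J}" for i
    using B_card[OF that] by (auto intro!: card_ge_0_finite)
  \<comment> \<open>\<open>X 0 = 0\<close> is the top frequency of the empty sum \<open>T 0\<close>,
    so the spectral bounds below cover the first block as well.\<close>
  define X where "X = (\<lambda>i. if i = 0 then 0 else Max (B i))"
  have X_ge: "v \<le> X i" if "i \<in> {1..J}" "v \<in> B i" for i v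
    using that B_fin[OF that(1)] by (auto simp: X_def)
  have X_in: "X i \<in> B i" if "i \<in> {1..J}" for i
    using that B_fin[OF that(1)] B_ne[OF that(1)] by (auto simp: X_def)
  have X_pos: "X i \<ge> 1" if "i \<in> {1..J}" for i
    using X_in[OF that] B_pos[OF that] by (metis One_nat_def Suc_leI gr0I)
  have X_less: "X (i - 1) < v" if "i \<in> {1..J}" "v \<in> B i" for i v
  proof (cases "i = 1")
    case True
    then show ?thesis using that B_pos by (auto simp: X_def intro: gr0I)
  next
    case False
    then have "i - 1 \<in> {1..J}" using that by auto
    then show ?thesis using X_in[of "i - 1"] B_less[of "i - 1" i] that by auto
  qed
  have X_mono: "X i \<le> X (Suc i)" if "Suc i \<in> {1..J}" for i
    using X_less[OF that X_in[OF that]] by simp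
  have cardB: "real (card (B i)) = (128 ^ i)\<^sup>2" if "i \<in> {1..J}" for i
    using B_card[OF that] by (simp add: power_mult[symmetric] power2_eq_square mult.commute)
      (simp add: power_mult_distrib[symmetric])
  \<comment> \<open>With the smoothing parameter \<open>12 * J * X i\<close> the error is
    \<open>1 / (3 * J)\<close>, small enough to survive \<open>J\<close> steps, while each step
    extends the spectrum downwards by only \<open>24 * J * X i\<close>.\<close>
  have "\<forall>i\<in>{1..J}. \<exists>E. trigpoly (- int (2 * (12 * J * X i))) 0 E \<and>
      (\<forall>x. cmod (E x) \<le> 1 - cmod (block_avg (B i) x) / 2 + 4 * real (X i) / real (12 * J * X i)) \<and>
      (\<integral>x. (cmod (E x - 1))\<^sup>2 \<partial>circle) \<le> 25 / real (card (B i))"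
    using B_fin B_ne X_ge X_pos J by (intro ballI damping_polynomial) (auto simp: Suc_le_eq)
  then obtain E where E: "\<And>i. i \<in> {1..J} \<Longrightarrow> trigpoly (- int (2 * (12 * J * X i))) 0 (E i)"
    and E_le': "\<And>i x. i \<in> {1..J} \<Longrightarrow> cmod (E i x) \<le> 1 - cmod (block_avg (B i) x) / 2 + 4 * real (X i) / real (12 * J * X i)"
    and E_int: "\<And>i. i \<in> {1..J} \<Longrightarrow> (\<integral>x. (cmod (E i x - 1))\<^sup>2 \<partial>circle) \<le> 25 / real (card (B i))"
    by metis
  have E_le: "cmod (E i x) \<le> 1 - cmod (block_avg (B i) x) / 2 + 1 / (3 * real J)" if "i \<in> {1..J}" for i x
  proof -
    have "4 * real (X i) / real (12 * J * X i) = 1 / (3 * real J)" using X_pos[OF that] J by (simp add: field_simps)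
    then show ?thesis using E_le'[OF that, of x] by simp
  qed
  define f where "f = (\<lambda>i. block_avg (B i))"
  define T where "T = damped_sum E f"
  have T_Suc: "T (Suc i) x = T i x * E (Suc i) x + f (Suc i) x" for i x by (simp add: T_def)
  have f_tp: "trigpoly (int 1) (int (X i)) (f i)" if "i \<in> {1..J}" for i
    unfolding f_def using B_fin[OF that] B_pos[OF that] X_ge[OF that]
    by (intro trigpoly_block_avg) (auto simp: Suc_le_eq intro: gr0I)
  have T_tp: "i \<le> J \<Longrightarrow> trigpoly (- int (24 * J * i * X i)) (int (X i)) (T i)" for i
  proof (induction i)
    case 0
    show ?case by (simp add: T_def trigpoly_const X_def)
  next
    case (Suc i)
    then have i: "Suc i \<in> {1..J}" by auto
    have "trigpoly (- int (24 * J * i * X i) + - int (2 * (12 * J * X (Suc i)))) (int (X i) + 0) (\<lambda>x. T i x * E (Suc i) x)"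
      by (intro trigpoly_mult E i Suc.IH) (use Suc.prems in simp)
    moreover have "24 * J * i * X i + 2 * (12 * J * X (Suc i)) \<le> 24 * J * Suc i * X (Suc i)"
    proof -
      have "24 * J * i * X i \<le> 24 * J * i * X (Suc i)" using X_mono[OF i] by (intro mult_left_mono) auto
      then show ?thesis by (simp add: algebra_simps)
    qed
    then have "- int (24 * J * Suc i * X (Suc i)) \<le> - int (24 * J * i * X i) + - int (2 * (12 * J * X (Suc i)))"
      by (simp only: of_nat_add[symmetric] minus_add_distrib[symmetric] neg_le_iff_le of_nat_le_iff)
    ultimately have "trigpoly (- int (24 * J * Suc i * X (Suc i))) (int (X (Suc i))) (\<lambda>x. T i x * E (Suc i) x)"
      by (rule trigpoly_mono) (use X_mono[OF i] in simp)
    moreover have "trigpoly (- int (24 * J * Suc i * X (Suc i))) (int (X (Suc i))) (f (Suc i))"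
      by (rule trigpoly_mono[OF f_tp[OF i]]) (simp_all add: order_trans[of _ "0::int"])
    ultimately show ?case unfolding T_Suc[abs_def] by (rule trigpoly_add)
  qed
  have T_le: "i \<le> J \<Longrightarrow> cmod (T i x) \<le> 2 + real i / real J" for i x
  proof (induction i)
    case 0
    show ?case by (simp add: T_def)
  next
    case (Suc i)
    then have i: "Suc i \<in> {1..J}" by auto
    define a where "a = 2 + real i / real J"
    define u where "u = cmod (f (Suc i) x)"
    have u: "0 \<le> u" "u \<le> 1" by (auto simp: u_def f_def norm_block_avg_le)
    have J0: "real J > 0" using J by simp
    have a: "2 \<le> a" "a \<le> 3" using Suc.prems J0 by (auto simp: a_def)
    have "cmod (T (Suc i) x) \<le> cmod (T i x) * cmod (E (Suc i) x) + u"
      unfolding T_Suc u_def by (metis norm_mult norm_triangle_ineq)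
    also have "\<dots> \<le> a * (1 - u / 2 + 1 / (3 * real J)) + u"
      using Suc E_le[OF i, of x] a by (intro add_right_mono mult_mono) (auto simp: a_def u_def f_def)
    also have "\<dots> = a + (1 - a / 2) * u + a / 3 * (1 / real J)" by (simp add: algebra_simps)
    \<comment> \<open>Since \<open>a \<ge> 2\<close> the damping outweighs the new term
      \<open>u\<close>, and since \<open>a \<le> 3\<close> the smoothing error adds at most
      \<open>1 / J\<close>. The total drift over \<open>J\<close> steps is 1, whence the bound
      3.\<close>
    also have "\<dots> \<le> a + 0 + 1 * (1 / real J)"
      using a u J0 by (intro add_mono mult_right_mono mult_nonpos_nonneg) auto
    also have "\<dots> = 2 + real (Suc i) / real J" by (simp add: a_def add_divide_distrib)
    finally show ?case .
  qed
  have T_le3: "cmod (T i x) \<le> 3" if "i \<le> J" for i x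
  proof -
    have "real i / real J \<le> 1" using that J by simp
    then show ?thesis using T_le[OF that, of x] by linarith
  qed
  have T_cont: "continuous_on UNIV (T i)" if "i \<le> J" for i by (rule continuous_on_trigpoly[OF T_tp[OF that]])
  define Z where "Z = 24 * J * J * X J"
  define I where "I = {- int Z..int (X J)}"
  have finI: "finite I" by (simp add: I_def)
  define L where "L = (\<lambda>F g. \<Sum>k\<in>I. cnj (fc F k) * g k)"
  \<comment> \<open>The change that the damping of step \<open>k\<close> makes to the earlier sum.
    It is small in L2 because \<open>E k\<close> is close to 1 there and \<open>T (k - 1)\<close> is
    bounded.\<close>
  define D where "D = (\<lambda>k x. T (k - 1) x * (E k x - 1))"
  have L_add: "L (\<lambda>x. F x + G x) g = L F g + L G g" if "continuous_on UNIV F" "continuous_on UNIV G" for F G g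
    using that by (simp add: L_def fc_add sum.distrib algebra_simps)
  have L_add_g: "L F (\<lambda>k. g k + h k) = L F g + L F h" for F g h
    by (simp add: L_def sum.distrib algebra_simps)
  have f_cont: "continuous_on UNIV (f i)" if "i \<in> {1..J}" for i by (rule continuous_on_trigpoly[OF f_tp[OF that]])
  have D_tp: "trigpoly (- int (24 * J * (i - 1) * X (i - 1)) + - int (2 * (12 * J * X i))) (int (X (i - 1)) + 0) (D i)"
    if "i \<in> {1..J}" for i
    unfolding D_def using that by (intro trigpoly_mult T_tp trigpoly_diff E trigpoly_const) auto
  have D_cont: "continuous_on UNIV (D i)" if "i \<in> {1..J}" for i by (rule continuous_on_trigpoly[OF D_tp[OF that]])
  have T_step: "L (T i) g = L (T (i - 1)) g + (L (D i) g + L (f i) g)" if i: "i \<in> {1..J}" for i g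
  proof -
    have "T i = (\<lambda>x. T (i - 1) x + (D i x + f i x))"
      using T_Suc[of "i - 1"] i by (auto simp: D_def algebra_simps)
    moreover have "continuous_on UNIV (T (i - 1))" using i by (intro T_cont) auto
    ultimately show ?thesis
      using L_add[OF _ continuous_on_add[OF D_cont[OF i] f_cont[OF i]], of "T (i - 1)" g]
        L_add[OF D_cont[OF i] f_cont[OF i], of g] by simp
  qed
  have D_int: "(\<integral>x. (cmod (D i x))\<^sup>2 \<partial>circle) \<le> (15 / 128 ^ i)\<^sup>2" if i: "i \<in> {1..J}" for i
  proof -
    have cE: "continuous_on UNIV (E i)" by (rule continuous_on_trigpoly[OF E[OF i]])
    have "(\<integral>x. (cmod (D i x))\<^sup>2 \<partial>circle) \<le> (\<integral>x. 9 * (cmod (E i x - 1))\<^sup>2 \<partial>circle)"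
    proof (intro integral_circle_mono continuous_intros D_cont i cE)
      fix x
      have "(cmod (T (i - 1) x))\<^sup>2 \<le> 3\<^sup>2" using T_le3[of "i - 1" x] i by (intro power_mono) auto
      then show "(cmod (D i x))\<^sup>2 \<le> 9 * (cmod (E i x - 1))\<^sup>2"
        by (simp add: D_def norm_mult power_mult_distrib mult_right_mono)
    qed
    also have "\<dots> = 9 * (\<integral>x. (cmod (E i x - 1))\<^sup>2 \<partial>circle)" by simp
    also have "\<dots> \<le> 9 * (25 / (128 ^ i)\<^sup>2)" using E_int[OF i] cardB[OF i] by simp
    also have "\<dots> = (15 / 128 ^ i)\<^sup>2" by (simp add: power_divide)
    finally show ?thesis .
  qed
  have f_int: "(\<integral>x. (cmod (f i x))\<^sup>2 \<partial>circle) \<le> (1 / 128 ^ i)\<^sup>2" if i: "i \<in> {1..J}" for i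
    unfolding f_def using integral_block_avg_sq[OF B_fin[OF i] B_ne[OF i]] cardB[OF i] by (simp add: power_divide)
  \<comment> \<open>The frequency \<open>v\<close> itself, with coefficient
    \<open>\<kappa> 1 = 2\<close>, is separated from all its other multiples.\<close>
  define main where "main = (\<lambda>i k. \<Sum>v\<in>B i. of_real (\<omega> v) * (if k = int v then 2 else 0) :: complex)"
  define nois where "nois = (\<lambda>i k. \<Sum>v\<in>B i. of_real (\<omega> v) * (if k = int v then 0 else dilated_coeff \<kappa> v k))"
  define tot where "tot = (\<lambda>S k. \<Sum>v\<in>S. of_real (\<omega> v) * dilated_coeff \<kappa> v k)"
  have tot_eq: "tot (B i) = (\<lambda>k. main i k + nois i k)" if i: "i \<in> {1..J}" for i
  proof
    fix k
    have "dilated_coeff \<kappa> v k = (if k = int v then 2 else 0) + (if k = int v then 0 else dilated_coeff \<kappa> v k)"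
      if "v \<in> B i" for v
      using \<kappa>1 that B_pos[OF i] by (cases "v = 0") (auto simp: dilated_coeff_def)
    then show "tot (B i) k = main i k + nois i k"
      unfolding tot_def main_def nois_def sum.distrib[symmetric] distrib_left[symmetric] by (intro sum.cong refl) metis
  qed
  have main_eq: "main i k = (if k \<in> int ` B i then 2 * of_real (\<omega> (nat k)) else 0)" if i: "i \<in> {1..J}" for i k
  proof -
    have "main i k = (\<Sum>v\<in>B i. if v = nat k \<and> k \<ge> 0 then 2 * of_real (\<omega> v) else 0)"
      unfolding main_def by (intro sum.cong refl) auto
    also have "\<dots> = (if k \<in> int ` B i then 2 * of_real (\<omega> (nat k)) else 0)"
      using B_fin[OF i] by (cases "k \<ge> 0") (auto simp: sum.delta image_iff)
    finally show ?thesis .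
  qed
  \<comment> \<open>A multiple \<open>m * v\<close> in the spectrum of \<open>F\<close> cannot have
    \<open>m \<ge> 1\<close>, as \<open>x < v\<close>. If \<open>m \<le> 0\<close>, the lower end of
    the spectrum forces \<open>- m \<le> 24 * J * J \<le> y\<close>, and there
    \<open>\<kappa>\<close> vanishes.\<close>
  have zero_low: "L F (tot S) = 0"
    if F: "trigpoly (- int (24 * J * J * x)) (int x) F" and S: "\<And>v. v \<in> S \<Longrightarrow> x < v" for F S x
    unfolding L_def
  proof (intro sum.neutral ballI)
    fix k
    show "cnj (fc F k) * tot S k = 0"
    proof (cases "k \<in> {- int (24 * J * J * x)..int x}")
      case True
      have "dilated_coeff \<kappa> v k = 0" if v: "v \<in> S" for v
      proof (cases "int v dvd k")
        case dv: True
        then obtain m where m: "k = int v * m" by blast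
        have v0: "int v > int x" using S[OF v] by simp
        have v1: "int v > 0" using v0 by linarith
        have "m \<noteq> 1" using True m v0 by auto
        moreover have "\<bar>m\<bar> \<le> y"
        proof (cases "m > 0")
          case True
          have "int v * 1 \<le> int v * m" using True v1 by (intro mult_left_mono) auto
          then have "int x < k" using v0 m by linarith
          then show ?thesis using \<open>k \<in> {- int (24 * J * J * x)..int x}\<close> by simp
        next
          case False
          have "int v * (- m) = - k" by (simp add: m)
          also have "\<dots> \<le> int (24 * J * J * x)" using \<open>k \<in> _\<close> by simp
          also have "\<dots> = (24 * int J * int J) * int x" by simp
          also have "\<dots> \<le> (24 * int J * int J) * int v" using v0 by (intro mult_left_mono) auto
          also have "\<dots> \<le> y * int v" using y by (intro mult_right_mono) auto
          finally have "int v * (- m) \<le> int v * y" by (simp add: mult.commute)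
          then have "- m \<le> y" using v1 mult_le_cancel_left_pos by blast
          then show ?thesis using False by simp
        qed
        ultimately show ?thesis using \<kappa>[of m] v1 by (simp add: dilated_coeff_def m)
      qed (simp add: dilated_coeff_def)
      then show ?thesis by (simp add: tot_def)
    next
      case False
      then show ?thesis using fc_trigpoly_eq_0[OF F] by simp
    qed
  qed
  have block: "Re (L (T J) (tot (B i))) \<ge> 1" if i: "i \<in> {1..J}" for i
  proof -
    let ?g = "tot (B i)"
    have start: "L (T (i - 1)) ?g = 0"
    proof (rule zero_low)
      have "24 * J * (i - 1) * X (i - 1) \<le> 24 * J * J * X (i - 1)" using i by (intro mult_mono) auto
      then have le: "- int (24 * J * J * X (i - 1)) \<le> - int (24 * J * (i - 1) * X (i - 1))"
        by (simp only: neg_le_iff_le of_nat_le_iff)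
      have "i - 1 \<le> J" using i by auto
      from trigpoly_mono[OF T_tp[OF this] le order_refl]
      show "trigpoly (- int (24 * J * J * X (i - 1))) (int (X (i - 1))) (T (i - 1))" .
    qed (use X_less[OF i] in blast)
    have tele: "L (T J) ?g = (\<Sum>k\<in>{i..J}. L (D k) ?g + L (f k) ?g)"
    proof -
      have "L (T n) ?g = (\<Sum>k\<in>{i..n}. L (D k) ?g + L (f k) ?g)" if "i \<le> n" "n \<le> J" for n
        using that
      proof (induction n rule: dec_induct)
        case base
        then show ?case using T_step[OF i, of ?g] start by simp
      next
        case (step n)
        have "{i..Suc n} = insert (Suc n) {i..n}" using step by auto
        then show ?case using step T_step[of "Suc n" ?g] by simp
      qed
      then show ?thesis using i by simp
    qed
    have nois_sq: "(\<Sum>k\<in>I. (cmod (nois i k))\<^sup>2) \<le> (128 ^ i / sqrt 1200)\<^sup>2"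
      using noise[OF i finI] cardB[OF i] by (simp add: nois_def power_divide)
    have main_sq: "(\<Sum>k\<in>I. (cmod (main i k))\<^sup>2) \<le> (4 * 128 ^ i)\<^sup>2"
    proof -
      have "(\<Sum>k\<in>I. (cmod (main i k))\<^sup>2) \<le> (\<Sum>k\<in>int ` B i. 16)"
      proof -
        have "(\<Sum>k\<in>I. (cmod (main i k))\<^sup>2) = (\<Sum>k\<in>I \<inter> int ` B i. (cmod (main i k))\<^sup>2)"
          using finI by (intro sum.mono_neutral_right) (auto simp: main_eq[OF i])
        also have "\<dots> \<le> (\<Sum>k\<in>I \<inter> int ` B i. 16)"
        proof (rule sum_mono)
          fix k assume "k \<in> I \<inter> int ` B i"
          then have "cmod (main i k) = 2 * \<omega> (nat k)"
            using \<omega>(1)[of "nat k"] by (simp add: main_eq[OF i] norm_mult)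
          then have "cmod (main i k) \<le> 4" using \<omega>(2)[of "nat k"] by simp
          then have "(cmod (main i k))\<^sup>2 \<le> 4\<^sup>2" by (intro power_mono) auto
          then show "(cmod (main i k))\<^sup>2 \<le> 16" by simp
        qed
        also have "\<dots> \<le> (\<Sum>k\<in>int ` B i. 16)" using B_fin[OF i] by (intro sum_mono2) auto
        finally show ?thesis .
      qed
      also have "\<dots> = 16 * real (card (B i))" by (simp add: card_image)
      also have "\<dots> = (4 * 128 ^ i)\<^sup>2" using cardB[OF i] by (simp add: power_mult_distrib)
      finally show ?thesis .
    qed
    \<comment> \<open>The constants 15 for \<open>D k\<close> and 1 for \<open>f k\<close> add up to
      16. The noise bound with 1200 makes \<open>e \<le> 37 / 80\<close>, and
      \<open>37 / 80 + 61 / 127 < 1\<close> leaves at least 1 of the main term 2.\<close>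
    define e where "e = 16 / sqrt (1200::real)"
    have e: "e \<le> 37 / 80"
    proof -
      have "16 / (37 / 80) \<le> sqrt (1200::real)" by (rule real_le_rsqrt) (simp add: power2_eq_square)
      then show ?thesis by (simp add: e_def field_simps)
    qed
    have nk: "cmod (L (D k) (nois i)) + cmod (L (f k) (nois i)) \<le> e * (1 / 128) ^ (k - i)" if k: "k \<in> {i..J}" for k
    proof -
      have kJ: "k \<in> {1..J}" using k i by auto
      have "cmod (L (D k) (nois i)) \<le> 15 / 128 ^ k * (128 ^ i / sqrt 1200)"
        unfolding L_def by (rule pairing_bound[OF D_tp[OF kJ] finI D_int[OF kJ] _ nois_sq]) auto
      moreover have "cmod (L (f k) (nois i)) \<le> 1 / 128 ^ k * (128 ^ i / sqrt 1200)"
        unfolding L_def by (rule pairing_bound[OF f_tp[OF kJ] finI f_int[OF kJ] _ nois_sq]) auto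
      moreover have "(128::real) ^ k = 128 ^ i * 128 ^ (k - i)" using k by (simp flip: power_add)
      ultimately show ?thesis by (simp add: e_def power_divide field_simps)
    qed
    have mk_D: "cmod (L (D k) (main i)) \<le> 60 * (1 / 128) ^ (k - i)" if k: "k \<in> {i<..J}" for k
    proof -
      have kJ: "k \<in> {1..J}" using k i by auto
      have "cmod (L (D k) (main i)) \<le> 15 / 128 ^ k * (4 * 128 ^ i)"
        unfolding L_def by (rule pairing_bound[OF D_tp[OF kJ] finI D_int[OF kJ] _ main_sq]) auto
      moreover have "(128::real) ^ k = 128 ^ i * 128 ^ (k - i)" using k by (simp flip: power_add)
      ultimately show ?thesis by (simp add: power_divide field_simps)
    qed
    \<comment> \<open>This is where analyticity pays: \<open>E i - 1\<close> has no positive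
      frequencies, so \<open>D i\<close> stays at or below \<open>X (i - 1)\<close>, strictly under
      block \<open>i\<close>. The L2 bound alone would give 60 here.\<close>
    have mi_D: "L (D i) (main i) = 0"
      unfolding L_def
    proof (intro sum.neutral ballI)
      fix k
      show "cnj (fc (D i) k) * main i k = 0"
      proof (cases "k \<in> int ` B i")
        case True
        then have "k > int (X (i - 1))" using X_less[OF i] by auto
        then have "fc (D i) k = 0" by (intro fc_trigpoly_eq_0[OF D_tp[OF i]]) auto
        then show ?thesis by simp
      qed (simp add: main_eq[OF i])
    qed
    have mk_f: "L (f k) (main i) = 0" if k: "k \<in> {i<..J}" for k
      unfolding L_def
    proof (intro sum.neutral ballI)
      fix j
      have kJ: "k \<in> {1..J}" using k i by auto
      show "cnj (fc (f k) j) * main i j = 0"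
      proof (cases "j \<in> int ` B i \<and> j \<in> int ` B k")
        case True
        then obtain v where "v \<in> B i" "v \<in> B k" by auto
        then have "v < v" using B_less[OF i kJ] k by auto
        then show ?thesis by simp
      qed (auto simp: main_eq[OF i] f_def fc_block_avg[OF B_fin[OF kJ]])
    qed
    have mi_f: "Re (L (f i) (main i)) \<ge> 2"
    proof -
      have sub: "int ` B i \<subseteq> I"
      proof
        fix k assume "k \<in> int ` B i"
        then obtain v where v: "k = int v" "v \<in> B i" by blast
        have "v \<le> X J"
        proof (cases "i = J")
          case True then show ?thesis using X_ge[OF i v(2)] by simp
        next
          case False
          then have "v < X J" using B_less[OF i _ _ v(2) X_in[of J]] i J by auto
          then show ?thesis by simp
        qed
        then show "k \<in> I" using v by (simp add: I_def)
      qed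
      have c0: "real (card (B i)) > 0" using B_fin[OF i] B_ne[OF i] by (simp add: card_gt_0_iff)
      have "L (f i) (main i) = (\<Sum>k\<in>int ` B i. cnj (fc (f i) k) * main i k)"
        unfolding L_def using sub finI by (intro sum.mono_neutral_right) (auto simp: main_eq[OF i])
      also have "\<dots> = (\<Sum>v\<in>B i. of_real (2 * \<omega> v / real (card (B i))))"
        by (subst sum.reindex) (auto intro!: sum.cong simp: main_eq[OF i] f_def fc_block_avg[OF B_fin[OF i]])
      finally have "Re (L (f i) (main i)) = (\<Sum>v\<in>B i. 2 * \<omega> v / real (card (B i)))" by simp
      also have "\<dots> \<ge> (\<Sum>v\<in>B i. 2 / real (card (B i)))"
        using \<omega>(1) c0 by (intro sum_mono divide_right_mono) auto
      also have "(\<Sum>v\<in>B i. 2 / real (card (B i))) = 2" using c0 by simp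
      finally show ?thesis .
    qed
    have split: "L F ?g = L F (main i) + L F (nois i)" for F unfolding tot_eq[OF i] by (rule L_add_g)
    have re_ge: "Re z \<ge> - cmod z" for z using abs_Re_le_cmod[of z] by linarith
    have "Re (L (D i) ?g + L (f i) ?g) \<ge> 2 - e"
      using mi_f mi_D nk[of i] i re_ge[of "L (D i) (nois i)"] re_ge[of "L (f i) (nois i)"] by (simp add: split)
    moreover have "Re (\<Sum>k\<in>{i<..J}. L (D k) ?g + L (f k) ?g) \<ge> - (61 / 127)"
    proof -
      \<comment> \<open>60 comes from the main part and at most \<open>e \<le> 1\<close> from the
        noise.\<close>
      have "Re (L (D k) ?g + L (f k) ?g) \<ge> - (61 * (1 / 128) ^ (k - i))" if k: "k \<in> {i<..J}" for k
      proof -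
        have "e * (1 / 128) ^ (k - i) \<le> 1 * (1 / 128) ^ (k - i)" using e by (intro mult_right_mono) auto
        moreover have "Re (L (D k) ?g + L (f k) ?g) = Re (L (D k) (main i)) + Re (L (D k) (nois i)) + Re (L (f k) (nois i))"
          using mk_f[OF k] by (simp add: split)
        moreover have "k \<in> {i..J}" using k by auto
        ultimately show ?thesis
          using mk_D[OF k] nk[of k] re_ge[of "L (D k) (main i)"] re_ge[of "L (D k) (nois i)"]
            re_ge[of "L (f k) (nois i)"] by linarith
      qed
      then have "Re (\<Sum>k\<in>{i<..J}. L (D k) ?g + L (f k) ?g) \<ge> (\<Sum>k\<in>{i<..J}. - (61 * (1 / 128) ^ (k - i)))"
        unfolding Re_sum by (intro sum_mono)
      also have "(\<Sum>k\<in>{i<..J}. - (61 * (1 / 128) ^ (k - i))) = - (61 * (\<Sum>k\<in>{i<..J}. (1 / 128 :: real) ^ (k - i)))"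
        by (simp add: sum_negf sum_distrib_left)
      also have "(\<Sum>k\<in>{i<..J}. (1 / 128 :: real) ^ (k - i)) = (\<Sum>j<J - i. (1 / 128) ^ Suc j)"
        by (rule sum.reindex_bij_witness[of _ "\<lambda>j. Suc j + i" "\<lambda>k. k - i - 1"]) (auto simp: Suc_diff_Suc simp del: power_Suc)
      finally have lower: "Re (\<Sum>k\<in>{i<..J}. L (D k) ?g + L (f k) ?g) \<ge> - (61 * (\<Sum>j<J - i. (1 / 128) ^ Suc j))" .
      have geo_le: "(\<Sum>j<J - i. (1 / 128 :: real) ^ Suc j) \<le> 1 / 127"
      proof -
        have "(\<Sum>j<n. (1 / 128 :: real) ^ Suc j) = (1 - (1 / 128) ^ n) / 127" for n
        proof (induction n)
          case (Suc n)
          have "s + 1 / 128 * p = (1 - 1 / 128 * p) / 127" if "s = (1 - p) / 127" for s p :: real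
            unfolding that by (simp add: field_simps)
          from this[OF Suc] show ?case by (simp only: sum.lessThan_Suc power_Suc)
        qed simp
        note geo = this[of "J - i"]
        have "s \<le> 1 / 127" if "s = (1 - p) / 127" "0 \<le> p" for s p :: real using that by simp
        from this[OF geo] show ?thesis by simp
      qed
      have "- (61 / 127) \<le> - (61 * s)" if "s \<le> 1 / 127" for s :: real using that by simp
      from order_trans[OF this[OF geo_le] lower] show ?thesis .
    qed
    moreover have "{i..J} = insert i {i<..J}" using i by auto
    ultimately show ?thesis using tele e by simp
  qed
  \<comment> \<open>The elements left over lie above all blocks, so the complete test function is
    blind to them and to their surviving multiples.\<close>
  have rest: "L (T J) (tot R) = 0"
  proof (rule zero_low)
    show "trigpoly (- int (24 * J * J * X J)) (int (X J)) (T J)" using T_tp[of J] by simp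
    show "X J < v" if "v \<in> R" for v using R(2)[OF _ X_in that] J by simp
  qed
  let ?V = "(\<Union>i\<in>{1..J}. B i) \<union> R"
  have "tot ?V k = (\<Sum>i\<in>{1..J}. tot (B i) k) + tot R k" for k
  proof -
    have "tot ?V k = tot (\<Union>i\<in>{1..J}. B i) k + tot R k"
      unfolding tot_def
    proof (rule sum.union_disjoint)
      show "(\<Union>i\<in>{1..J}. B i) \<inter> R = {}" using R(2) by blast
    qed (use B_fin R in auto)
    also have "tot (\<Union>i\<in>{1..J}. B i) k = (\<Sum>i\<in>{1..J}. tot (B i) k)"
      unfolding tot_def
    proof (rule sum.UNION_disjoint)
      show "\<forall>i\<in>{1..J}. \<forall>j\<in>{1..J}. i \<noteq> j \<longrightarrow> B i \<inter> B j = {}"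
        using B_less by (metis disjoint_iff less_irrefl_nat linorder_neqE_nat)
    qed (use B_fin in auto)
    finally show ?thesis .
  qed
  then have "L (T J) (tot ?V) = (\<Sum>i\<in>{1..J}. L (T J) (tot (B i))) + L (T J) (tot R)"
    by (simp add: L_def sum_distrib_left distrib_left sum.distrib sum.swap[of _ I])
  then have "Re (L (T J) (tot ?V)) = (\<Sum>i\<in>{1..J}. Re (L (T J) (tot (B i))))" using rest by simp
  also have "\<dots> \<ge> (\<Sum>i\<in>{1..J}. 1)" using block by (intro sum_mono) auto
  finally have "Re (L (T J) (tot ?V)) \<ge> real J" by simp
  moreover have "trigpoly (- int Z) (int (X J)) (T J)" using T_tp[of J] by (simp add: Z_def)
  ultimately show ?thesis using T_le3[of J] unfolding L_def I_def tot_def by blast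
qed

section \<open>Sum-free sets from arcs\<close>

definition arc_ind :: "real \<Rightarrow> real \<Rightarrow> real \<Rightarrow> real" where
  "arc_ind a b x = (if a < frac x \<and> frac x < b then 1 else 0)"

text \<open>Multiplying a supposed solution by \<open>x\<close> and taking fractional parts makes
  \<open>a - b\<close> an integer, but the arc confines it strictly between \<open>2 * s\<close> and
  \<open>2 * s + 1\<close>. In units of \<open>1 / 24\<close> the limits are
  \<open>5 * (1 + 12 * s) - (5 + 12 * s) = 48 * s\<close> and
  \<open>5 * (5 + 12 * s) - (1 + 12 * s) = 48 * s + 24\<close>.\<close>

lemma kl_sum_free_arc:
  fixes l s :: nat and x :: real
  assumes l: "l > 0"
  shows "kl_sum_free (5 * l) l {n. 1 + 12 * real s < 24 * real l * frac (real n * x) \<and> 24 * real l * frac (real n * x) < 5 + 12 * real s}"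
    (is "kl_sum_free _ _ ?S")
  unfolding kl_sum_free_def
proof (intro allI impI notI)
  fix u v :: "nat \<Rightarrow> nat"
  assume u: "\<forall>i\<in>{1..5 * l}. u i \<in> ?S" and v: "\<forall>j\<in>{1..l}. v j \<in> ?S"
    and eq: "(\<Sum>i=1..5 * l. u i) = (\<Sum>j=1..l. v j)"
  define t where "t = (\<lambda>n::nat. frac (real n * x))"
  define z where "z = (\<Sum>j=1..l. \<lfloor>real (v j) * x\<rfloor>) - (\<Sum>i=1..5 * l. \<lfloor>real (u i) * x\<rfloor>)"
  have dec: "real n * x = of_int \<lfloor>real n * x\<rfloor> + t n" for n by (simp add: t_def frac_def)
  have "(\<Sum>i=1..5 * l. real (u i) * x) = (\<Sum>j=1..l. real (v j) * x)"
    using arg_cong[OF eq, of "\<lambda>n. real n * x"] by (simp add: sum_distrib_right)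
  then have "(\<Sum>i=1..5 * l. of_int \<lfloor>real (u i) * x\<rfloor> + t (u i)) = (\<Sum>j=1..l. of_int \<lfloor>real (v j) * x\<rfloor> + t (v j))"
    unfolding dec[symmetric] .
  then have z: "(\<Sum>i=1..5 * l. t (u i)) - (\<Sum>j=1..l. t (v j)) = of_int z"
    by (simp add: sum.distrib z_def)
  have l0: "real l > 0" using l by simp
  have u1: "(\<Sum>i=1..5 * l. 1 + 12 * real s) < (\<Sum>i=1..5 * l. 24 * real l * t (u i))"
    by (rule sum_strict_mono) (use u l in \<open>auto simp: t_def\<close>)
  have u2: "(\<Sum>i=1..5 * l. 24 * real l * t (u i)) < (\<Sum>i=1..5 * l. 5 + 12 * real s)"
    by (rule sum_strict_mono) (use u l in \<open>auto simp: t_def\<close>)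
  have v1: "(\<Sum>j=1..l. 1 + 12 * real s) < (\<Sum>j=1..l. 24 * real l * t (v j))"
    by (rule sum_strict_mono) (use v l in \<open>auto simp: t_def\<close>)
  have v2: "(\<Sum>j=1..l. 24 * real l * t (v j)) < (\<Sum>j=1..l. 5 + 12 * real s)"
    by (rule sum_strict_mono) (use v l in \<open>auto simp: t_def\<close>)
  define a where "a = (\<Sum>i=1..5 * l. t (u i))"
  define b where "b = (\<Sum>j=1..l. t (v j))"
  have A: "5 * real l * (1 + 12 * real s) < 24 * real l * a" "24 * real l * a < 5 * real l * (5 + 12 * real s)"
    "real l * (1 + 12 * real s) < 24 * real l * b" "24 * real l * b < real l * (5 + 12 * real s)"
    using u1 u2 v1 v2 by (simp_all add: a_def b_def sum_distrib_left[symmetric])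
  have "24 * real l * (2 * real s) < 24 * real l * (a - b)" "24 * real l * (a - b) < 24 * real l * (2 * real s + 1)"
    using A by (simp_all add: algebra_simps)
  then have "2 * real s < a - b" "a - b < 2 * real s + 1" using l0 by simp_all
  then have "of_int (2 * int s) < real_of_int z" "real_of_int z < of_int (2 * int s + 1)"
    using z by (simp_all add: a_def b_def)
  then have "2 * int s < z" "z < 2 * int s + 1" unfolding of_int_less_iff by simp_all
  then show False by simp
qed

lemma card_le_max_kl_sum_free:
  assumes "finite A" "S \<subseteq> A" "kl_sum_free k l S"
  shows "card S \<le> max_kl_sum_free k l A"
  unfolding max_kl_sum_free_def
proof (rule Max_ge)
  have "{card S |S. S \<subseteq> A \<and> kl_sum_free k l S} \<subseteq> {..card A}" using assms(1) by (auto intro: card_mono)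
  then show "finite {card S |S. S \<subseteq> A \<and> kl_sum_free k l S}" by (rule finite_subset) simp
qed (use assms in blast)

text \<open>The \<open>2 * l\<close> small arcs together form the preimage of (1/12, 5/12) under
  multiplication by \<open>2 * l\<close> modulo 1. Passing to \<open>w = x / (2 * l)\<close>
  therefore distributes the elements counted on the left among \<open>2 * l\<close> sum-free
  sets.\<close>

lemma sum_arc_le_max_kl_sum_free:
  assumes l: "l > 0" and A: "finite A"
  shows "(\<Sum>n\<in>A. arc_ind (1/12) (5/12) (real n * x)) \<le> 2 * real l * real (max_kl_sum_free (5 * l) l A)"
proof -
  define w where "w = x / (2 * real l)"
  define S where "S = (\<lambda>s. {n\<in>A. 1 + 12 * real s < 24 * real l * frac (real n * w) \<and> 24 * real l * frac (real n * w) < 5 + 12 * real s})"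
  have l0: "real l > 0" using l by simp
  have S_free: "kl_sum_free (5 * l) l (S s)" for s
    using kl_sum_free_arc[OF l, of s w] by (auto simp: kl_sum_free_def S_def)
  have cover: "{n\<in>A. 1/12 < frac (real n * x) \<and> frac (real n * x) < 5/12} \<subseteq> (\<Union>s<2 * l. S s)"
  proof
    fix n assume n: "n \<in> {n\<in>A. 1/12 < frac (real n * x) \<and> frac (real n * x) < 5/12}"
    define t where "t = frac (real n * w)"
    have t: "0 \<le> t" "t < 1" by (auto simp: t_def frac_lt_1)
    have "real n * x = 2 * real l * (real n * w)" using l0 by (simp add: w_def)
    also have "\<dots> = of_int (2 * int l * \<lfloor>real n * w\<rfloor>) + 2 * real l * t"
      by (simp add: t_def frac_def algebra_simps)
    finally have fr: "frac (real n * x) = frac (2 * real l * t)" by (simp add: frac_def)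
    define s where "s = nat \<lfloor>2 * real l * t\<rfloor>"
    have s: "real s = of_int \<lfloor>2 * real l * t\<rfloor>" using t l0 by (simp add: s_def)
    have "2 * real l * t < 2 * real l" using t l0 by simp
    moreover have "real s \<le> 2 * real l * t" unfolding s by (rule of_int_floor_le)
    ultimately have "real s < real (2 * l)" by simp
    then have "s < 2 * l" by (simp only: of_nat_less_iff)
    moreover have "frac (real n * x) = 2 * real l * t - real s" unfolding fr s by (simp add: frac_def)
    then have "n \<in> S s" using n by (simp add: S_def t_def)
    ultimately show "n \<in> (\<Union>s<2 * l. S s)" by blast
  qed
  have "(\<Sum>n\<in>A. arc_ind (1/12) (5/12) (real n * x)) = real (card {n\<in>A. 1/12 < frac (real n * x) \<and> frac (real n * x) < 5/12})"
    using A by (simp add: arc_ind_def sum.If_cases Int_def)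
  also have "card {n\<in>A. 1/12 < frac (real n * x) \<and> frac (real n * x) < 5/12} \<le> card (\<Union>s<2 * l. S s)"
    using A by (intro card_mono cover) (auto simp: S_def)
  also have "card (\<Union>s<2 * l. S s) \<le> (\<Sum>s<2 * l. card (S s))" by (rule card_UN_le) simp
  also have "\<dots> \<le> (\<Sum>s<2 * l. max_kl_sum_free (5 * l) l A)"
    by (intro sum_mono card_le_max_kl_sum_free A S_free) (auto simp: S_def)
  finally show ?thesis by (simp add: mult.assoc)
qed

section \<open>Fourier coefficients of dilated arcs\<close>

lemma arc_measurable [measurable]: "arc_ind a b \<in> borel_measurable borel"
  unfolding arc_ind_def frac_def by measurable

lemma arc_bounds: "0 \<le> arc_ind a b x" "arc_ind a b x \<le> 1"
  by (auto simp: arc_ind_def)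

lemma integral_ec_interval:
  assumes ab: "0 \<le> a" "a \<le> b" "b \<le> 1" and k: "k \<noteq> 0"
  shows "(\<integral>x. indicator {a<..<b} x *\<^sub>R ec k x \<partial>circle) = (ec k b - ec k a) / (2 * pi * \<i> * of_int k)"
proof -
  let ?F = "\<lambda>x. ec k x / (2 * pi * \<i> * of_int k)"
  have "(\<integral>x. indicator {a<..<b} x *\<^sub>R ec k x \<partial>circle) = (LBINT x. indicator {0..1} x *\<^sub>R (indicator {a<..<b} x *\<^sub>R ec k x))"
    by (simp add: circle_def integral_restrict_space)
  also have "\<dots> = (LBINT x. indicator {a..b} x *\<^sub>R ec k x)"
  proof (rule integral_cong_AE)
    have "AE x in lborel. x \<noteq> a" "AE x in lborel. x \<noteq> b" by (simp_all add: AE_lborel_singleton)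
    then show "AE x in lborel. indicator {0..1} x *\<^sub>R (indicator {a<..<b} x *\<^sub>R ec k x) = indicator {a..b} x *\<^sub>R ec k x"
      by eventually_elim (use ab in \<open>auto simp: indicator_def\<close>)
  qed auto
  also have "\<dots> = ?F b - ?F a"
  proof (rule integral_FTC_Icc)
    fix x :: real
    show "(?F has_vector_derivative ec k x) (at x within {a..b})"
      using k by (rule has_vector_derivative_ec)
  qed (use ab in \<open>auto intro: continuous_intros\<close>)
  finally show ?thesis by (simp add: diff_divide_distrib)
qed

lemma integral_interval:
  assumes ab: "0 \<le> a" "a \<le> b" "b \<le> 1"
  shows "(\<integral>x. indicator {a<..<b} x *\<^sub>R (1::complex) \<partial>circle) = of_real (b - a)"
proof -
  have "(\<integral>x. indicator {a<..<b} x *\<^sub>R (1::complex) \<partial>circle) = (LBINT x. indicator {0..1} x *\<^sub>R (indicator {a<..<b} x *\<^sub>R (1::complex)))"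
    by (simp add: circle_def integral_restrict_space)
  also have "(\<lambda>x. indicator {0..1} x *\<^sub>R (indicator {a<..<b} x *\<^sub>R (1::complex))) = (\<lambda>x. indicator {a<..<b} x *\<^sub>R 1)"
    using ab by (auto simp: indicator_def)
  also have "(LBINT x. indicator {a<..<b} x *\<^sub>R (1::complex)) = of_real (b - a)"
    using ab by (simp add: scaleR_conv_of_real)
  finally show ?thesis .
qed

lemma sum_ec_roots:
  assumes N: "N \<ge> (1::nat)"
  shows "(\<Sum>j<N. ec k (real j / real N)) = (if int N dvd k then of_nat N else 0)"
proof -
  define z where "z = ec k (1 / real N)"
  have pw: "ec k (real j / real N) = z ^ j" for j
    unfolding z_def ec_def Complex.DeMoivre by (simp add: mult.commute)
  have "z ^ N = ec k 1" using pw[of N] N by simp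
  also have "\<dots> = 1" by simp
  finally have zN: "z ^ N = 1" .
  have z1: "z = 1 \<longleftrightarrow> int N dvd k"
  proof
    assume "z = 1"
    then have "cos (2 * pi * of_int k * (1 / real N)) = 1" by (simp add: z_def ec_def complex_eq_iff)
    then obtain n :: int where "2 * pi * of_int k * (1 / real N) = of_int n * 2 * pi"
      by (auto simp: cos_one_2pi_int)
    then have "real_of_int k = of_int n * real N" using N by (simp add: field_simps)
    then have "real_of_int k = real_of_int (n * int N)" by simp
    then have "k = n * int N" by (simp only: of_int_eq_iff)
    then show "int N dvd k" by simp
  next
    assume "int N dvd k"
    then obtain m where "k = int N * m" by blast
    then have "2 * pi * of_int k * (1 / real N) = 2 * pi * of_int m" using N by simp
    then have "z = cis (2 * pi * of_int m)" unfolding z_def ec_def by (simp only:)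
    then show "z = 1" by (metis Ints_of_int cis_multiple_2pi)
  qed
  show ?thesis
  proof (cases "z = 1")
    case True
    then show ?thesis using z1 by (simp add: pw)
  next
    case False
    then have "(\<Sum>j<N. z ^ j) = 0" using geometric_sum[OF False, of N] zN by simp
    then show ?thesis using z1 False by (simp add: pw)
  qed
qed

definition arc_coeff :: "real \<Rightarrow> real \<Rightarrow> int \<Rightarrow> complex" where
  "arc_coeff a b m = (if m = 0 then of_real (b - a) else (ec (- m) a - ec (- m) b) / (2 * pi * \<i> * of_int m))"

text \<open>On the unit interval the preimage of the arc under multiplication by \<open>N\<close>
  consists of \<open>N\<close> disjoint open intervals. The strict inequality at the end
  \<open>a \<ge> 0\<close> makes both sides vanish at \<open>x = 1\<close>, where the fractional
  part wraps around.\<close>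

lemma arc_dilate_eq_sum:
  assumes N: "N \<ge> (1::nat)" and ab: "0 \<le> a" "b \<le> 1" and x: "x \<in> {0..1}"
  shows "arc_ind a b (real N * x) = (\<Sum>j<N. indicator {(a + real j) / real N<..<(b + real j) / real N} x)"
proof -
  have N0: "real N > 0" using N by simp
  define i where "i = nat \<lfloor>real N * x\<rfloor>"
  have i: "real i = of_int \<lfloor>real N * x\<rfloor>" using x by (simp add: i_def)
  have iff: "x \<in> {(a + real j) / real N<..<(b + real j) / real N} \<longleftrightarrow> a + real j < real N * x \<and> real N * x < b + real j" for j
    using N0 by (simp add: divide_less_eq less_divide_eq mult.commute)
  have uniq: "j = i" if "a + real j < real N * x" "real N * x < b + real j" for j
  proof -
    have "\<lfloor>real N * x\<rfloor> = int j" by (rule floor_unique) (use that ab in auto)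
    then show ?thesis by (simp add: i_def)
  qed
  have fr: "frac (real N * x) = real N * x - real i" by (simp add: frac_def i)
  show ?thesis
  proof (cases "a < frac (real N * x) \<and> frac (real N * x) < b")
    case True
    have "real N * x < real N"
    proof (rule ccontr)
      assume "\<not> real N * x < real N"
      then have "x = 1" using N0 x by (simp add: antisym)
      then have "frac (real N * x) = 0" by (simp add: frac_eq_0_iff)
      with True ab show False by linarith
    qed
    then have "real i < real N" using i of_int_floor_le[of "real N * x"] by linarith
    then have "i < N" by simp
    have "(\<Sum>j<N. indicator {(a + real j) / real N<..<(b + real j) / real N} x) = (\<Sum>j\<in>{..<N}. if j = i then 1 else (0::real))"
    proof (intro sum.cong refl)
      fix j
      have "x \<in> {(a + real j) / real N<..<(b + real j) / real N} \<longleftrightarrow> j = i"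
        unfolding iff using True fr uniq[of j] by auto
      then show "indicator {(a + real j) / real N<..<(b + real j) / real N} x = (if j = i then 1 else (0::real))"
        by (simp add: indicator_def del: greaterThanLessThan_iff)
    qed
    also have "\<dots> = 1" using \<open>i < N\<close> by simp
    finally show ?thesis using True by (simp add: arc_ind_def)
  next
    case False
    have "(\<Sum>j<N. indicator {(a + real j) / real N<..<(b + real j) / real N} x) = (0::real)"
    proof (intro sum.neutral ballI)
      fix j
      have "x \<notin> {(a + real j) / real N<..<(b + real j) / real N}"
        unfolding iff using False fr uniq[of j] by auto
      then show "indicator {(a + real j) / real N<..<(b + real j) / real N} x = (0::real)"
        by (simp add: indicator_def del: greaterThanLessThan_iff)
    qed
    then show ?thesis using False by (simp add: arc_ind_def)
  qed
qed

lemma fc_arc_dilate: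
  assumes N: "N \<ge> (1::nat)" and ab: "0 \<le> a" "a \<le> b" "b \<le> 1"
  shows "fc (\<lambda>x. of_real (arc_ind a b (real N * x))) k = (if int N dvd k then arc_coeff a b (k div int N) else 0)"
proof -
  have N0: "real N > 0" using N by simp
  let ?I = "\<lambda>j. {(a + real j) / real N<..<(b + real j) / real N}"
  have bnd: "0 \<le> (a + real j) / real N" "(a + real j) / real N \<le> (b + real j) / real N" "(b + real j) / real N \<le> 1"
    if "j < N" for j
  proof -
    have "real j + 1 \<le> real N" using that by simp
    then show "(b + real j) / real N \<le> 1" using ab N0 by (simp add: divide_le_eq)
  qed (use ab N0 in \<open>auto simp: divide_right_mono\<close>)
  have int: "integrable circle (\<lambda>x. indicator (?I j) x *\<^sub>R ec (- k) x)" for j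
    by (rule integrable_circle_bounded[where B = 1]) (auto simp: indicator_def)
  have "fc (\<lambda>x. of_real (arc_ind a b (real N * x))) k = (\<integral>x. (\<Sum>j<N. indicator (?I j) x *\<^sub>R ec (- k) x) \<partial>circle)"
    unfolding fc_def
  proof (rule Bochner_Integration.integral_cong[OF refl])
    fix x assume "x \<in> space circle"
    then have "arc_ind a b (real N * x) = (\<Sum>j<N. indicator (?I j) x)" using arc_dilate_eq_sum[OF N ab(1,3)] by simp
    then show "complex_of_real (arc_ind a b (real N * x)) * ec (- k) x = (\<Sum>j<N. indicator (?I j) x *\<^sub>R ec (- k) x)"
      by (simp add: scaleR_conv_of_real sum_distrib_right)
  qed
  also have "\<dots> = (\<Sum>j<N. \<integral>x. indicator (?I j) x *\<^sub>R ec (- k) x \<partial>circle)"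
    by (rule Bochner_Integration.integral_sum[OF int])
  also have "\<dots> = (if int N dvd k then arc_coeff a b (k div int N) else 0)"
  proof (cases "k = 0")
    case True
    have "(\<Sum>j<N. \<integral>x. indicator (?I j) x *\<^sub>R ec (- k) x \<partial>circle) = (\<Sum>j<N. of_real ((b - a) / real N))"
    proof (intro sum.cong refl)
      fix j assume "j \<in> {..<N}"
      then show "(\<integral>x. indicator (?I j) x *\<^sub>R ec (- k) x \<partial>circle) = of_real ((b - a) / real N)"
        using integral_interval[OF bnd[of j]] True by (simp add: diff_divide_distrib add_divide_distrib)
    qed
    then show ?thesis using True N0 by (simp add: arc_coeff_def)
  next
    case False
    let ?c = "2 * pi * \<i> * of_int (- k) :: complex"
    have "(\<Sum>j<N. \<integral>x. indicator (?I j) x *\<^sub>R ec (- k) x \<partial>circle)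
        = (\<Sum>j<N. (ec (- k) (b / real N) - ec (- k) (a / real N)) / ?c * ec (- k) (real j / real N))"
    proof (intro sum.cong refl)
      fix j assume "j \<in> {..<N}"
      then have "(\<integral>x. indicator (?I j) x *\<^sub>R ec (- k) x \<partial>circle) = (ec (- k) ((b + real j) / real N) - ec (- k) ((a + real j) / real N)) / ?c"
        using integral_ec_interval[OF bnd[of j], of "- k"] False by simp
      then show "(\<integral>x. indicator (?I j) x *\<^sub>R ec (- k) x \<partial>circle)
          = (ec (- k) (b / real N) - ec (- k) (a / real N)) / ?c * ec (- k) (real j / real N)"
        by (simp add: add_divide_distrib ec_add_arg left_diff_distrib diff_divide_distrib)
    qed
    also have "\<dots> = (ec (- k) (b / real N) - ec (- k) (a / real N)) / ?c * (if int N dvd k then of_nat N else 0)"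
      by (subst sum_distrib_left[symmetric]) (use sum_ec_roots[OF N, of "- k"] in simp)
    also have "\<dots> = (if int N dvd k then arc_coeff a b (k div int N) else 0)"
    proof (cases "int N dvd k")
      case True
      then obtain m where m: "k = int N * m" by blast
      have m0: "m \<noteq> 0" "k div int N = m" using False m N by auto
      have e: "ec (- k) (c / real N) = ec (- m) c" for c using N0 by (simp add: ec_def m mult.assoc)
      show ?thesis using True m0 N0 by (simp add: e arc_coeff_def) (simp add: m field_simps)
    qed simp
    finally show ?thesis .
  qed
  finally show ?thesis .
qed

lemma arc_uminus: "arc_ind (1/12) (5/12) (- x) = arc_ind (7/12) (11/12) x"
proof -
  have "1/12 < frac (- x) \<and> frac (- x) < 5/12 \<longleftrightarrow> 7/12 < frac x \<and> frac x < 11/12"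
  proof (cases "x \<in> \<int>")
    case True
    then have "frac x = 0" "frac (- x) = 0" by (simp_all add: frac_eq_0_iff)
    then show ?thesis by (simp only:) simp
  qed (auto simp: frac_neg)
  then show ?thesis by (simp add: arc_ind_def)
qed

text \<open>Negative dilations are included because the even and odd parts of the arc come from the
  pair \<open>N\<close>, \<open>- N\<close>; they reduce to the reflected arc (7/12, 11/12).\<close>

lemma fc_arc_dilate_int:
  assumes N: "N \<noteq> (0::int)"
  shows "fc (\<lambda>x. of_real (arc_ind (1/12) (5/12) (of_int N * x))) k
    = (if N dvd k then arc_coeff (1/12) (5/12) (k div N) else 0)"
proof (cases "N > 0")
  case True
  then show ?thesis using fc_arc_dilate[of "nat N" "1/12" "5/12" k] by simp
next
  case False
  define M where "M = nat (- N)"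
  have M: "M \<ge> 1" "N = - int M" using False N by (auto simp: M_def)
  have "arc_ind (1/12) (5/12) (of_int N * x) = arc_ind (7/12) (11/12) (real M * x)" for x
    using arc_uminus[of "real M * x"] by (simp add: M)
  then have "fc (\<lambda>x. of_real (arc_ind (1/12) (5/12) (of_int N * x))) k
      = (if int M dvd k then arc_coeff (7/12) (11/12) (k div int M) else 0)"
    using fc_arc_dilate[OF M(1), of "7/12" "11/12" k] by simp
  also have "\<dots> = (if N dvd k then arc_coeff (1/12) (5/12) (k div N) else 0)"
  proof (cases "int M dvd k")
    case True
    then obtain m where m: "k = int M * m" by blast
    have "k = N * - m" by (simp add: m M)
    then have d: "k div int M = m" "k div N = - m"
      using M nonzero_mult_div_cancel_left[OF N, of "- m"] by (simp add: m, simp only:)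
    have one: "ec j (1 - c) = ec (- j) c" for j c
      by (simp add: ec_diff_arg)
    have "ec (- m) (7/12) = ec m (5/12)" "ec (- m) (11/12) = ec m (1/12)"
      using one[of "- m" "5/12"] one[of "- m" "1/12"] by simp_all
    then have "arc_coeff (7/12) (11/12) m = arc_coeff (1/12) (5/12) (- m)"
      by (simp add: arc_coeff_def divide_simps)
    then show ?thesis using True d M by simp
  qed (simp add: M)
  finally show ?thesis .
qed

section \<open>The centred arc sum and its pairings\<close>

definition arc_sum :: "nat set \<Rightarrow> real \<Rightarrow> real" where
  "arc_sum A x = (\<Sum>n\<in>A. arc_ind (1/12) (5/12) (real n * x) - 1/3)"

text \<open>Leaving out \<open>k = 0\<close> accounts for the subtracted mean 1/3: these are the
  coefficients of one centred arc dilated by \<open>N\<close>.\<close>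

definition arc_dil :: "int \<Rightarrow> int \<Rightarrow> complex" where
  "arc_dil N k = (if k \<noteq> 0 \<and> N dvd k then arc_coeff (1/12) (5/12) (k div N) else 0)"

lemma arc_sum_measurable [measurable]: "(\<lambda>x. arc_sum A (c * x)) \<in> borel_measurable borel"
  unfolding arc_sum_def mult.assoc[symmetric] by measurable

lemma arc_sum_bound: "\<bar>arc_sum A x\<bar> \<le> real (card A)"
proof -
  have "\<bar>arc_sum A x\<bar> \<le> (\<Sum>n\<in>A. \<bar>arc_ind (1/12) (5/12) (real n * x) - 1/3\<bar>)"
    unfolding arc_sum_def by (rule sum_abs)
  also have "\<dots> \<le> (\<Sum>n\<in>A. 1)" by (intro sum_mono) (auto simp: arc_ind_def)
  finally show ?thesis by simp
qed

lemma fc_arc_sum: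
  assumes A: "finite A" "0 \<notin> A" and d: "d \<noteq> 0"
  shows "fc (\<lambda>x. of_real (arc_sum A (of_int d * x))) k = (\<Sum>n\<in>A. arc_dil (d * int n) k)"
proof -
  let ?f = "\<lambda>n x. complex_of_real (arc_ind (1/12) (5/12) (of_int (d * int n) * x)) * ec (- k) x"
  have int: "integrable circle (?f n)" for n
    by (rule integrable_circle_bounded[where B = 1]) (auto simp: norm_mult abs_of_nonneg[OF arc_bounds(1)] arc_bounds)
  have int': "integrable circle (\<lambda>x. 1/3 * ec (- k) x)"
    by (intro integrable_circle_continuous continuous_intros)
  have "fc (\<lambda>x. of_real (arc_sum A (of_int d * x))) k = (\<integral>x. (\<Sum>n\<in>A. ?f n x - 1/3 * ec (- k) x) \<partial>circle)"
    unfolding fc_def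
  proof (rule arg_cong[where f = "lebesgue_integral circle"], rule ext)
    fix x
    have "real n * (of_int d * x) = of_int (d * int n) * x" for n by simp
    then show "complex_of_real (arc_sum A (of_int d * x)) * ec (- k) x = (\<Sum>n\<in>A. ?f n x - 1/3 * ec (- k) x)"
      by (simp only: arc_sum_def of_real_sum sum_distrib_right of_real_diff left_diff_distrib) simp
  qed
  also have "\<dots> = (\<Sum>n\<in>A. \<integral>x. ?f n x - 1/3 * ec (- k) x \<partial>circle)"
    using int int' by (intro Bochner_Integration.integral_sum Bochner_Integration.integrable_diff) auto
  also have "\<dots> = (\<Sum>n\<in>A. arc_dil (d * int n) k)"
  proof (intro sum.cong refl)
    fix n assume n: "n \<in> A"
    then have N: "d * int n \<noteq> 0" using d A(2) by (metis mult_eq_0_iff of_nat_eq_0_iff)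
    have "(\<integral>x. ?f n x - 1/3 * ec (- k) x \<partial>circle) = (\<integral>x. ?f n x \<partial>circle) - (\<integral>x. 1/3 * ec (- k) x \<partial>circle)"
      by (rule Bochner_Integration.integral_diff[OF int int'])
    also have "(\<integral>x. ?f n x \<partial>circle) = (if d * int n dvd k then arc_coeff (1/12) (5/12) (k div (d * int n)) else 0)"
      using fc_arc_dilate_int[OF N, of k] unfolding fc_def .
    also have "(\<integral>x. 1/3 * ec (- k) x \<partial>circle) = (if k = 0 then 1/3 else 0)" by (simp add: integral_ec)
    finally show "(\<integral>x. ?f n x - 1/3 * ec (- k) x \<partial>circle) = arc_dil (d * int n) k"
      by (auto simp: arc_dil_def arc_coeff_def)
  qed
  finally show ?thesis .
qed

lemma integrable_circle_const [simp]:
  fixes c :: "'a::{banach, second_countable_topology}"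
  shows "integrable circle (\<lambda>x. c)"
  by (intro integrable_circle_continuous continuous_intros)

text \<open>Mean zero turns a one-sided bound into an L1 bound: it forces \<open>Q \<ge> 0\<close>,
  and then \<open>|g| \<le> 2 * Q - g\<close> holds pointwise.\<close>

lemma integral_abs_arc_sum_le:
  assumes A: "finite A" "0 \<notin> A" and d: "d \<noteq> 0" and Q: "\<And>x. arc_sum A x \<le> Q"
  shows "(\<integral>x. \<bar>arc_sum A (of_int d * x)\<bar> \<partial>circle) \<le> 2 * Q"
proof -
  let ?g = "\<lambda>x. arc_sum A (of_int d * x)"
  have int: "integrable circle ?g"
    by (rule integrable_circle_bounded[where B = "real (card A)"]) (auto intro: arc_sum_bound)
  have "complex_of_real (\<integral>x. ?g x \<partial>circle) = (\<integral>x. complex_of_real (?g x) \<partial>circle)"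
    by (rule integral_complex_of_real[symmetric])
  also have "\<dots> = fc (\<lambda>x. of_real (?g x)) 0" by (simp add: fc_def)
  also have "\<dots> = 0" unfolding fc_arc_sum[OF A d] by (simp add: arc_dil_def)
  finally have z: "(\<integral>x. ?g x \<partial>circle) = 0" by simp
  then have "(\<integral>x. ?g x \<partial>circle) \<le> (\<integral>x. Q \<partial>circle)"
    by (intro integral_mono int) (use Q in auto)
  then have Q0: "Q \<ge> 0" using z by simp
  have "(\<integral>x. \<bar>?g x\<bar> \<partial>circle) \<le> (\<integral>x. 2 * Q - ?g x \<partial>circle)"
  proof (rule integral_mono)
    show "integrable circle (\<lambda>x. \<bar>?g x\<bar>)" using int by simp
    show "integrable circle (\<lambda>x. 2 * Q - ?g x)"
      using int by (intro Bochner_Integration.integrable_diff) auto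
    show "\<bar>?g x\<bar> \<le> 2 * Q - ?g x" for x using Q[of "of_int d * x"] Q0 by (simp add: abs_if)
  qed
  also have "\<dots> = (\<integral>x. 2 * Q \<partial>circle) - (\<integral>x. ?g x \<partial>circle)"
    using int by (intro Bochner_Integration.integral_diff) auto
  also have "\<dots> = 2 * Q" using z by simp
  finally show ?thesis .
qed

definition arc_pairing :: "int \<Rightarrow> int \<Rightarrow> (real \<Rightarrow> complex) \<Rightarrow> nat set \<Rightarrow> int \<Rightarrow> complex" where
  "arc_pairing a b T A d = (\<Sum>k\<in>{a..b}. cnj (fc T k) * (\<Sum>n\<in>A. arc_dil (d * int n) k))"

text \<open>The coefficient sum equals the integral of the dilated arc sum against the conjugate of
  \<open>T\<close>; the constant is the sup norm 3 times the 2 of the L1 bound.\<close>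

lemma norm_arc_pairing_le:
  assumes A: "finite A" "0 \<notin> A" and d: "d \<noteq> 0" and Q: "\<And>x. arc_sum A x \<le> Q"
    and T: "trigpoly a b T" "\<And>x. cmod (T x) \<le> 3"
  shows "cmod (arc_pairing a b T A d) \<le> 6 * Q"
proof -
  let ?g = "\<lambda>x. complex_of_real (arc_sum A (of_int d * x))"
  have int: "integrable circle (\<lambda>x. cnj (fc T k) * (?g x * ec (- k) x))" for k
    by (intro integrable_mult_right integrable_circle_bounded[where B = "real (card A)"])
       (auto simp: norm_mult intro: arc_sum_bound)
  have cT: "continuous_on UNIV T" by (rule continuous_on_trigpoly[OF T(1)])
  have "arc_pairing a b T A d = (\<Sum>k\<in>{a..b}. \<integral>x. cnj (fc T k) * (?g x * ec (- k) x) \<partial>circle)"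
    unfolding arc_pairing_def fc_arc_sum[OF A d, symmetric] by (simp add: fc_def)
  also have "\<dots> = (\<integral>x. (\<Sum>k\<in>{a..b}. cnj (fc T k) * (?g x * ec (- k) x)) \<partial>circle)"
    by (rule Bochner_Integration.integral_sum[OF int, symmetric])
  also have "\<dots> = (\<integral>x. ?g x * cnj (T x) \<partial>circle)"
  proof (rule arg_cong[where f = "lebesgue_integral circle"], rule ext)
    fix x
    have "cnj (T x) = (\<Sum>k\<in>{a..b}. cnj (fc T k) * ec (- k) x)"
      by (subst trigpoly_expand[OF T(1), of "{a..b}"]) auto
    then show "(\<Sum>k\<in>{a..b}. cnj (fc T k) * (?g x * ec (- k) x)) = ?g x * cnj (T x)"
      by (simp add: sum_distrib_left ac_simps)
  qed
  finally have "cmod (arc_pairing a b T A d) \<le> (\<integral>x. cmod (?g x * cnj (T x)) \<partial>circle)"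
    by (simp only: integral_norm_bound)
  also have "\<dots> \<le> (\<integral>x. 3 * \<bar>arc_sum A (of_int d * x)\<bar> \<partial>circle)"
  proof (rule integral_mono)
    have "T \<in> borel_measurable borel" using cT by (rule borel_measurable_continuous_onI)
    then show "integrable circle (\<lambda>x. cmod (?g x * cnj (T x)))"
      by (intro integrable_norm integrable_circle_bounded[where B = "real (card A) * 3"])
         (auto simp: norm_mult intro!: mult_mono arc_sum_bound T(2))
    show "integrable circle (\<lambda>x. 3 * \<bar>arc_sum A (of_int d * x)\<bar>)"
      by (rule integrable_circle_bounded[where B = "3 * real (card A)"]) (auto intro: arc_sum_bound)
    show "cmod (?g x * cnj (T x)) \<le> 3 * \<bar>arc_sum A (of_int d * x)\<bar>" for x
      using mult_left_mono[OF T(2)[of x], of "\<bar>arc_sum A (of_int d * x)\<bar>"] by (simp add: norm_mult mult.commute)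
  qed
  also have "\<dots> = 3 * (\<integral>x. \<bar>arc_sum A (of_int d * x)\<bar> \<partial>circle)" by simp
  also have "\<dots> \<le> 6 * Q" using integral_abs_arc_sum_le[OF A d Q] by simp
  finally show ?thesis .
qed

section \<open>Characters in the arc coefficients\<close>

definition chi3 :: "int \<Rightarrow> real" where
  "chi3 m = (if m mod 3 = 1 then 1 else if m mod 3 = 2 then - 1 else 0)"

definition chi4 :: "int \<Rightarrow> real" where
  "chi4 m = (if m mod 4 = 1 then 1 else if m mod 4 = 3 then - 1 else 0)"

text \<open>The values of \<open>sin (pi * m / 3)\<close> divided by \<open>sqrt 3 / 2\<close>. This
  function is not multiplicative at 2, which is why the even part of the arc must be combined with
  its dilate by 2.\<close>

definition sin_sixth :: "int \<Rightarrow> real" where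
  "sin_sixth m = (if m mod 6 \<in> {1, 2} then 1 else if m mod 6 \<in> {4, 5} then - 1 else 0)"

definition cos_fourth :: "int \<Rightarrow> real" where
  "cos_fourth m = (if m mod 4 = 0 then 1 else if m mod 4 = 2 then - 1 else 0)"

lemma chi3_mult: "chi3 (a * b) = chi3 a * chi3 b"
proof -
  define r s where "r = a mod 3" and "s = b mod 3"
  have "a * b mod 3 = r * s mod 3" by (simp add: r_def s_def mod_mult_eq)
  moreover have "r = 0 \<or> r = 1 \<or> r = 2" "s = 0 \<or> s = 1 \<or> s = 2"
    unfolding r_def s_def by presburger+
  ultimately show ?thesis
    unfolding chi3_def r_def[symmetric] s_def[symmetric] by (elim disjE) simp_all
qed

lemma chi4_mult: "chi4 (a * b) = chi4 a * chi4 b"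
proof -
  define r s where "r = a mod 4" and "s = b mod 4"
  have "a * b mod 4 = r * s mod 4" by (simp add: r_def s_def mod_mult_eq)
  moreover have "r = 0 \<or> r = 1 \<or> r = 2 \<or> r = 3" "s = 0 \<or> s = 1 \<or> s = 2 \<or> s = 3"
    unfolding r_def s_def by presburger+
  ultimately show ?thesis
    unfolding chi4_def r_def[symmetric] s_def[symmetric] by (elim disjE) simp_all
qed

lemma abs_chi_le: "\<bar>chi3 m\<bar> \<le> 1" "\<bar>chi3 m * chi4 m\<bar> \<le> 1"
  by (auto simp: chi3_def chi4_def)

lemma sin_pi_third: "sin (pi * of_int m / 3) = sqrt 3 / 2 * sin_sixth m"
proof -
  define q r where "q = m div 6" and "r = m mod 6"
  have m: "m = 6 * q + r" by (simp add: q_def r_def)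
  have "pi * of_int m / 3 = pi * of_int r / 3 + 2 * pi * of_int q" by (simp add: m field_simps)
  then have "sin (pi * of_int m / 3) = sin (pi * of_int r / 3)"
    by (simp only: sin_add sin_integer_2pi cos_integer_2pi Ints_of_int mult_zero_right mult_1_right add_0_right diff_zero)
  moreover have "r = 0 \<or> r = 1 \<or> r = 2 \<or> r = 3 \<or> r = 4 \<or> r = 5" unfolding r_def by presburger
  moreover have "pi * 2 / 3 = pi - pi / 3" "pi * 4 / 3 = pi + pi / 3" "pi * 5 / 3 = 2 * pi - pi / 3" by simp_all
  then have "sin (pi * 2 / 3) = sqrt 3 / 2" "sin (pi * 4 / 3) = - (sqrt 3 / 2)" "sin (pi * 5 / 3) = - (sqrt 3 / 2)"
    by (simp_all only: sin_diff sin_add sin_pi cos_pi sin_two_pi cos_two_pi sin_60 cos_60)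
  ultimately show ?thesis by (auto simp: sin_sixth_def r_def[symmetric] sin_60)
qed

lemma cos_sin_pi_half: "cos (pi * of_int m / 2) = cos_fourth m" "sin (pi * of_int m / 2) = chi4 m"
proof -
  define q r where "q = m div 4" and "r = m mod 4"
  have m: "m = 4 * q + r" by (simp add: q_def r_def)
  have eq: "pi * of_int m / 2 = pi * of_int r / 2 + 2 * pi * of_int q" by (simp add: m field_simps)
  have "sin (pi * of_int m / 2) = sin (pi * of_int r / 2)"
    unfolding eq by (simp only: sin_add sin_integer_2pi cos_integer_2pi Ints_of_int mult_zero_right mult_1_right add_0_right diff_zero)
  moreover have "cos (pi * of_int m / 2) = cos (pi * of_int r / 2)"
    unfolding eq by (simp only: cos_add sin_integer_2pi cos_integer_2pi Ints_of_int mult_zero_right mult_1_right add_0_right diff_zero)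
  moreover have "r = 0 \<or> r = 1 \<or> r = 2 \<or> r = 3" unfolding r_def by presburger
  moreover have "sin (pi * 3 / 2) = - 1" "cos (pi * 3 / 2) = 0"
    using sin_3over2_pi cos_3over2_pi by (simp_all add: mult.commute)
  ultimately show "cos (pi * of_int m / 2) = cos_fourth m" "sin (pi * of_int m / 2) = chi4 m"
    by (auto simp: cos_fourth_def chi4_def r_def[symmetric])
qed

text \<open>The arc has midpoint 1/4 and half-length 1/6, so its coefficient is
  \<open>e(- m / 4) sin (pi m / 3) / (pi m)\<close>. Passing to \<open>- m\<close> conjugates it,
  and sum and difference isolate \<open>cos (pi m / 2)\<close> and
  \<open>sin (pi m / 2)\<close>.\<close>

lemma arc_coeff_even_odd:
  assumes m: "m \<noteq> 0"
  shows "arc_coeff (1/12) (5/12) m + arc_coeff (1/12) (5/12) (- m)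
      = of_real (sqrt 3 / pi * (cos_fourth m * sin_sixth m / of_int m))"
    and "arc_coeff (1/12) (5/12) m - arc_coeff (1/12) (5/12) (- m)
      = - \<i> * of_real (sqrt 3 / pi * (chi4 m * sin_sixth m / of_int m))"
proof -
  define a where "a = pi * of_int m / 6"
  have e: "ec (- m) (1/12) = cis (- a)" "ec m (1/12) = cis a" "ec (- m) (5/12) = cis (- (5 * a))" "ec m (5/12) = cis (5 * a)"
    by (simp_all add: ec_def a_def field_simps)
  have ang: "2 * a = pi * of_int m / 3" "3 * a = pi * of_int m / 2" by (simp_all add: a_def)
  have s: "sin (5 * a) - sin a = sqrt 3 * (cos_fourth m * sin_sixth m)"
  proof -
    have "sin (5 * a) - sin a = 2 * sin (2 * a) * cos (3 * a)" by (subst sin_diff_sin) (simp add: field_simps)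
    then show ?thesis unfolding ang sin_pi_third cos_sin_pi_half by simp
  qed
  have c: "cos a - cos (5 * a) = sqrt 3 * (chi4 m * sin_sixth m)"
  proof -
    have "cos a - cos (5 * a) = 2 * sin (3 * a) * sin (2 * a)" by (subst cos_diff_cos) (simp add: field_simps)
    then show ?thesis unfolding ang sin_pi_third cos_sin_pi_half by simp
  qed
  have u: "(cis (- a) - cis (- (5 * a))) - (cis a - cis (5 * a)) = 2 * \<i> * of_real (sin (5 * a) - sin a)"
    "(cis (- a) - cis (- (5 * a))) + (cis a - cis (5 * a)) = 2 * \<i> * (- \<i> * of_real (cos a - cos (5 * a)))"
    by (simp_all add: complex_eq_iff)
  let ?D = "2 * pi * \<i> * of_int m :: complex"
  have cancel: "2 * \<i> * z / ?D = z / (of_real pi * of_int m)" for z by simp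
  have p: "arc_coeff (1/12) (5/12) m = (cis (- a) - cis (- (5 * a))) / ?D"
    and n: "arc_coeff (1/12) (5/12) (- m) = - ((cis a - cis (5 * a)) / ?D)"
    using m by (simp_all add: arc_coeff_def e)
  have "arc_coeff (1/12) (5/12) m + arc_coeff (1/12) (5/12) (- m)
      = ((cis (- a) - cis (- (5 * a))) - (cis a - cis (5 * a))) / ?D"
    unfolding p n by (simp add: diff_divide_distrib)
  also have "\<dots> = of_real (sqrt 3 * (cos_fourth m * sin_sixth m)) / (of_real pi * of_int m)"
    unfolding u s by (rule cancel)
  finally show "arc_coeff (1/12) (5/12) m + arc_coeff (1/12) (5/12) (- m)
      = of_real (sqrt 3 / pi * (cos_fourth m * sin_sixth m / of_int m))" by simp
  have "arc_coeff (1/12) (5/12) m - arc_coeff (1/12) (5/12) (- m)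
      = ((cis (- a) - cis (- (5 * a))) + (cis a - cis (5 * a))) / ?D"
    unfolding p n by (simp add: add_divide_distrib)
  also have "\<dots> = (- \<i> * of_real (sqrt 3 * (chi4 m * sin_sixth m))) / (of_real pi * of_int m)"
    unfolding u c by (rule cancel)
  finally show "arc_coeff (1/12) (5/12) m - arc_coeff (1/12) (5/12) (- m)
      = - \<i> * of_real (sqrt 3 / pi * (chi4 m * sin_sixth m / of_int m))" by simp
qed

lemma residue_mod_12:
  "chi3 m = chi3 (m mod 12)" "chi4 m = chi4 (m mod 12)" "sin_sixth m = sin_sixth (m mod 12)"
  "cos_fourth m = cos_fourth (m mod 12)" "sin_sixth (2 * m) = sin_sixth (2 * (m mod 12))"
  "cos_fourth (2 * m) = cos_fourth (2 * (m mod 12))" "sin_sixth (4 * m) = sin_sixth (4 * (m mod 12))"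
  "cos_fourth (4 * m) = cos_fourth (4 * (m mod 12))" "odd m = odd (m mod 12)"
proof -
  have lin: "a * (m mod 12) mod b = a * m mod b" if "b dvd 12 * a" for a b
  proof -
    have "b dvd 12 * a * (m div 12)" using that by (rule dvd_mult2)
    also have "12 * a * (m div 12) = a * m - a * (m mod 12)"
      by (simp add: right_diff_distrib[symmetric] minus_mod_eq_mult_div)
    finally show ?thesis by (metis mod_eq_dvd_iff)
  qed
  have c1: "m mod 12 mod 3 = m mod 3" "m mod 12 mod 4 = m mod 4" "m mod 12 mod 6 = m mod 6"
    by (rule mod_mod_cancel, simp)+
  have c2: "2 * (m mod 12) mod 6 = 2 * m mod 6" "2 * (m mod 12) mod 4 = 2 * m mod 4"
    "4 * (m mod 12) mod 6 = 4 * m mod 6" "4 * (m mod 12) mod 4 = 4 * m mod 4"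
    by (rule lin, simp)+
  show "chi3 m = chi3 (m mod 12)" "chi4 m = chi4 (m mod 12)" "sin_sixth m = sin_sixth (m mod 12)"
    "cos_fourth m = cos_fourth (m mod 12)" "sin_sixth (2 * m) = sin_sixth (2 * (m mod 12))"
    "cos_fourth (2 * m) = cos_fourth (2 * (m mod 12))" "sin_sixth (4 * m) = sin_sixth (4 * (m mod 12))"
    "cos_fourth (4 * m) = cos_fourth (4 * (m mod 12))"
    unfolding chi3_def chi4_def sin_sixth_def cos_fourth_def c1 c2 by (rule refl)+
  show "odd m = odd (m mod 12)" by (simp add: dvd_mod_iff)
qed

lemma mod_12_cases:
  fixes m :: int
  shows "m mod 12 = 0 \<or> m mod 12 = 1 \<or> m mod 12 = 2 \<or> m mod 12 = 3 \<or> m mod 12 = 4 \<or> m mod 12 = 5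
    \<or> m mod 12 = 6 \<or> m mod 12 = 7 \<or> m mod 12 = 8 \<or> m mod 12 = 9 \<or> m mod 12 = 10 \<or> m mod 12 = 11"
  by presburger

text \<open>Everything has period 12, which leaves a finite check. The first identity makes the odd
  part a genuine character; the other two evaluate the even part plus half of its dilate by 2, at
  odd and at even places.\<close>

lemma sin_sixth_identities:
  "chi4 m * sin_sixth m = chi3 m * chi4 m"
  "odd m \<Longrightarrow> - (cos_fourth (2 * m) * sin_sixth (2 * m) + cos_fourth m * sin_sixth m) = chi3 m"
  "- (cos_fourth (4 * m) * sin_sixth (4 * m) + cos_fourth (2 * m) * sin_sixth (2 * m)) = 2 * (chi3 m * of_bool (odd m))"
proof -
  define r where "r = m mod 12"
  note R = residue_mod_12[of m, folded r_def]
  note C = mod_12_cases[of m, folded r_def]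
  show "chi4 m * sin_sixth m = chi3 m * chi4 m"
    unfolding R using C by (elim disjE) (simp_all add: chi3_def chi4_def sin_sixth_def cos_fourth_def)
  show "- (cos_fourth (2 * m) * sin_sixth (2 * m) + cos_fourth m * sin_sixth m) = chi3 m" if "odd m"
    using that unfolding R using C
    by (elim disjE) (simp_all add: chi3_def chi4_def sin_sixth_def cos_fourth_def)
  show "- (cos_fourth (4 * m) * sin_sixth (4 * m) + cos_fourth (2 * m) * sin_sixth (2 * m)) = 2 * (chi3 m * of_bool (odd m))"
    unfolding R using C by (elim disjE) (simp_all add: chi3_def chi4_def sin_sixth_def cos_fourth_def)
qed

text \<open>The constants here and in \<open>odd_dil\<close> remove \<open>sqrt 3 / pi\<close> and
  make the coefficients real; sign and size are chosen so that the combined even part and the odd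
  part both have coefficient 1 at their base frequency.\<close>

definition even_dil :: "int \<Rightarrow> int \<Rightarrow> complex" where
  "even_dil N k = of_real (- 2 * pi / sqrt 3) * (arc_dil N k + arc_dil (- N) k)"

definition odd_dil :: "int \<Rightarrow> int \<Rightarrow> complex" where
  "odd_dil N k = \<i> * of_real (pi / sqrt 3) * (arc_dil N k - arc_dil (- N) k)"

lemma even_odd_dil_mult:
  assumes "N \<noteq> 0" "m \<noteq> 0"
  shows "even_dil N (N * m) = of_real (- 2 * cos_fourth m * sin_sixth m / of_int m)"
    and "odd_dil N (N * m) = of_real (chi3 m * chi4 m / of_int m)"
proof -
  have d: "N * m div - N = - m" using nonzero_mult_div_cancel_left[of "- N" "- m"] assms by simp
  have 1: "arc_dil N (N * m) = arc_coeff (1/12) (5/12) m" "arc_dil (- N) (N * m) = arc_coeff (1/12) (5/12) (- m)"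
    using assms by (simp_all add: arc_dil_def d)
  note sin_sixth_identities(1)[of m]
  then show "even_dil N (N * m) = of_real (- 2 * cos_fourth m * sin_sixth m / of_int m)"
    "odd_dil N (N * m) = of_real (chi3 m * chi4 m / of_int m)"
    unfolding even_dil_def odd_dil_def 1 arc_coeff_even_odd[OF assms(2)] of_real_mult[symmetric]
    by (simp_all add: complex_eq_iff)
qed

lemma even_odd_dil_zero: "\<not> (k \<noteq> 0 \<and> N dvd k) \<Longrightarrow> even_dil N k = 0 \<and> odd_dil N k = 0"
  by (auto simp: even_dil_def odd_dil_def arc_dil_def)


lemma even_dil_combine:
  assumes N: "N \<noteq> 0" and t: "t \<noteq> 0"
  shows "even_dil N (2 * N * t) + 1/2 * even_dil (2 * N) (2 * N * t)
    = of_real (if odd t then chi3 t / of_int t else chi3 (t div 2) * of_bool (odd (t div 2)) / of_int (t div 2))"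
proof -
  have e1: "even_dil N (2 * N * t) = of_real (- 2 * cos_fourth (2 * t) * sin_sixth (2 * t) / of_int (2 * t))"
    using even_odd_dil_mult(1)[of N "2 * t"] assms by (simp add: mult.left_commute mult.assoc)
  have e2: "even_dil (2 * N) (2 * N * t) = of_real (- 2 * cos_fourth t * sin_sixth t / of_int t)"
    using even_odd_dil_mult(1)[of "2 * N" t] assms by (simp add: mult.assoc)
  have "even_dil N (2 * N * t) + 1/2 * even_dil (2 * N) (2 * N * t)
      = of_real (- (cos_fourth (2 * t) * sin_sixth (2 * t) + cos_fourth t * sin_sixth t) / of_int t)"
    unfolding e1 e2 using t by (simp add: field_simps)
  also have "- (cos_fourth (2 * t) * sin_sixth (2 * t) + cos_fourth t * sin_sixth t) / of_int t
      = (if odd t then chi3 t / of_int t else chi3 (t div 2) * of_bool (odd (t div 2)) / of_int (t div 2))"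
  proof (cases "odd t")
    case True
    have "- (cos_fourth (2 * t) * sin_sixth (2 * t) + cos_fourth t * sin_sixth t) = chi3 t"
      using True by (rule sin_sixth_identities(2))
    then show ?thesis using True by simp
  next
    case False
    then obtain r where r: "t = 2 * r" by blast
    have "- (cos_fourth (2 * (2 * r)) * sin_sixth (2 * (2 * r)) + cos_fourth (2 * r) * sin_sixth (2 * r))
        = 2 * (chi3 r * of_bool (odd r))"
      using sin_sixth_identities(3)[of r] by simp
    then show ?thesis by (simp add: r)
  qed
  finally show ?thesis .
qed

section \<open>Sieving the Fourier coefficients\<close>

definition dil :: "(int \<Rightarrow> real) \<Rightarrow> int \<Rightarrow> int \<Rightarrow> complex" where
  "dil g N k = (if k \<noteq> 0 \<and> N dvd k then of_real (g (k div N)) else 0)"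

definition odd_chi3 :: "int \<Rightarrow> real" where
  "odd_chi3 t = of_bool (odd t) * chi3 t / of_int t"

definition chi12_inv :: "int \<Rightarrow> real" where
  "chi12_inv t = chi3 t * chi4 t / of_int t"

text \<open>The even part lives on even multiples of \<open>N\<close>. Half of its dilate by 2
  repairs the failure of multiplicativity at 2 and leaves two copies of one character sequence, at
  base frequencies \<open>2 * N\<close> and \<open>4 * N\<close>; hence the sets 2A and 4A.\<close>

lemma even_dil_combined:
  assumes N: "N \<noteq> 0"
  shows "even_dil N k + 1/2 * even_dil (2 * N) k = dil odd_chi3 (2 * N) k + dil odd_chi3 (4 * N) k"
proof (cases "k \<noteq> 0 \<and> 2 * N dvd k")
  case True
  then obtain t where k: "k = 2 * N * t" by blast
  have t: "t \<noteq> 0" using True k by auto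
  have "4 * N dvd k \<longleftrightarrow> even t" "k div (2 * N) = t"
    using N by (auto simp: k)
  moreover have "k div (4 * N) = t div 2" if "even t"
    using that N by (auto simp: k elim!: evenE)
  ultimately show ?thesis
    using even_dil_combine[OF N t] True t N
    by (auto simp: dil_def odd_chi3_def k elim!: evenE)
next
  case False
  have 4: "\<not> (k \<noteq> 0 \<and> 4 * N dvd k)"
    using False dvd_mult_right[of 2 "2 * N" k] by (auto simp: mult.assoc[symmetric])
  have "even_dil N k = 0"
  proof (cases "k \<noteq> 0 \<and> N dvd k")
    case True
    then obtain m where k: "k = N * m" by blast
    have m: "m \<noteq> 0" "odd m" using True False N by (auto simp: k)
    then have "m mod 4 \<noteq> 0" "m mod 4 \<noteq> 2" by presburger+
    then have "cos_fourth m = 0" by (simp add: cos_fourth_def)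
    then show ?thesis using even_odd_dil_mult(1)[OF N m(1)] by (simp add: k)
  qed (use even_odd_dil_zero in blast)
  then show ?thesis using even_odd_dil_zero[OF False] False 4 by (auto simp: dil_def)
qed

lemma odd_dil_eq:
  assumes N: "N \<noteq> 0"
  shows "odd_dil N k = dil chi12_inv N k"
proof (cases "k \<noteq> 0 \<and> N dvd k")
  case True
  then obtain m where k: "k = N * m" by blast
  have m: "m \<noteq> 0" using True k by auto
  show ?thesis using even_odd_dil_mult(2)[OF N m] True N by (simp add: k dil_def chi12_inv_def)
qed (use even_odd_dil_zero[of k N] in \<open>auto simp: dil_def\<close>)

text \<open>By complete multiplicativity, for odd \<open>d\<close> the twist by the character value
  at \<open>d\<close> turns the dilate by \<open>d\<close> into \<open>d\<close> times the part of
  the original sequence supported on multiples of \<open>d\<close>. Weights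
  \<open>\<mu>(d) / d\<close> then perform inclusion-exclusion.\<close>

definition sieve_term :: "int \<Rightarrow> int \<Rightarrow> int \<Rightarrow> complex" where
  "sieve_term d v k = of_real (chi3 d) * dil odd_chi3 (d * v) k + of_real (chi3 d * chi4 d) * dil chi12_inv (d * v) k"

text \<open>The odd part is taken at both \<open>2 * d * n\<close> and \<open>4 * d * n\<close> to
  match the two base frequencies of the even combination, so that the opposite parities can cancel
  at each of them.\<close>

definition sieve_dil :: "int \<Rightarrow> int \<Rightarrow> int \<Rightarrow> complex" where
  "sieve_dil d n k = of_real (chi3 d) * (even_dil (d * n) k + 1/2 * even_dil (2 * d * n) k)
    + of_real (chi3 d * chi4 d) * (odd_dil (2 * d * n) k + odd_dil (4 * d * n) k)"

lemma sieve_dil_eq: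
  assumes "d \<noteq> 0" "n \<noteq> 0"
  shows "sieve_dil d n k = sieve_term d (2 * n) k + sieve_term d (4 * n) k"
  using even_dil_combined[of "d * n" k] odd_dil_eq[of "2 * d * n" k] odd_dil_eq[of "4 * d * n" k] assms
  by (simp add: sieve_dil_def sieve_term_def algebra_simps)

definition sieved_coeff :: "nat set \<Rightarrow> int \<Rightarrow> complex" where
  "sieved_coeff P t = (if t \<noteq> 0 \<and> (\<forall>p\<in>P. \<not> int p dvd t)
     then of_real ((of_bool (odd t) * chi3 t + chi3 t * chi4 t) / of_int t) else 0)"

lemma sieve_term_mult:
  assumes "odd d" "v \<noteq> 0" "s \<noteq> 0"
  shows "sieve_term d v (d * s * v) / of_int d
    = of_real ((of_bool (odd (d * s)) * chi3 (d * s) + chi3 (d * s) * chi4 (d * s)) / of_int (d * s))"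
proof -
  have d: "d \<noteq> 0" using assms(1) by auto
  have "d * s * v div (d * v) = s" using d assms(2) by (simp add: mult.assoc mult.commute[of s])
  then have "dil g (d * v) (d * s * v) = of_real (g s)" for g
    using d assms by (simp add: dil_def mult.assoc)
  then show ?thesis
    using assms d by (simp add: sieve_term_def odd_chi3_def chi12_inv_def chi3_mult chi4_mult field_simps)
qed

text \<open>Only sets of primes contained in \<open>Q\<close>, the primes of \<open>P\<close>
  dividing \<open>t\<close>, contribute, and all with the same value \<open>z\<close> up to sign;
  the alternating sum over subsets of \<open>Q\<close> is 1 if \<open>Q\<close> is empty and 0
  otherwise.\<close>

lemma sum_sieve_terms:
  assumes P: "finite P" "\<And>p. p \<in> P \<Longrightarrow> prime p \<and> odd p" and v: "v > (0::nat)"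
  shows "(\<Sum>S\<in>Pow P. (- 1) ^ card S / of_nat (\<Prod>S) * sieve_term (int (\<Prod>S)) (int v) k)
    = dilated_coeff (sieved_coeff P) v k"
proof (cases "k \<noteq> 0 \<and> int v dvd k")
  case False
  have "sieve_term d (int v) k = 0" for d
    using False by (auto simp: sieve_term_def dil_def dest: dvd_mult_right)
  then show ?thesis using False v by (auto simp: dilated_coeff_def sieved_coeff_def)
next
  case True
  then obtain t where k: "k = int v * t" by blast
  have t: "t \<noteq> 0" using True k by auto
  define z where "z = complex_of_real ((of_bool (odd t) * chi3 t + chi3 t * chi4 t) / of_int t)"
  define Q where "Q = {p\<in>P. int p dvd t}"
  have Q: "finite Q" "Q \<subseteq> P" using P by (auto simp: Q_def)
  have "(- 1) ^ card S / of_nat (\<Prod>S) * sieve_term (int (\<Prod>S)) (int v) k = (if S \<subseteq> Q then (- 1) ^ card S * z else 0)"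
    if S: "S \<in> Pow P" for S
  proof -
    let ?d = "\<Prod>S"
    have finS: "finite S" using S P(1) finite_subset by auto
    have odd: "odd ?d" using finS S P(2) by (auto simp: even_prod_iff)
    have dvd: "int ?d dvd t \<longleftrightarrow> S \<subseteq> Q"
    proof
      assume d: "int ?d dvd t"
      show "S \<subseteq> Q"
      proof
        fix p assume p: "p \<in> S"
        have "p dvd ?d" using dvd_prodI[OF finS p, of "\<lambda>x. x"] by simp
        then have "int p dvd int ?d" by (simp only: int_dvd_int_iff)
        then show "p \<in> Q" using p S dvd_trans[OF _ d] by (auto simp: Q_def)
      qed
    next
      assume "S \<subseteq> Q"
      then have "?d dvd nat \<bar>t\<bar>"
        using finS S P(2) by (intro prod_primes_dvd) (auto simp: Q_def nat_dvd_iff)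
      then have "int ?d dvd int (nat \<bar>t\<bar>)" by (simp only: int_dvd_int_iff)
      then show "int ?d dvd t" by (simp del: of_nat_prod)
    qed
    show ?thesis
    proof (cases "S \<subseteq> Q")
      case True
      then obtain s where s: "t = int ?d * s" using dvd by blast
      have kk: "k = int ?d * s * int v" unfolding k s by (rule mult.commute)
      have "s \<noteq> 0" using t s by auto
      then have "sieve_term (int ?d) (int v) k / of_int (int ?d) = z"
        unfolding kk z_def unfolding s using odd v by (intro sieve_term_mult) (auto simp del: of_nat_prod)
      moreover have "(- 1) ^ card S / of_nat ?d * X = (- 1) ^ card S * (X / of_int (int ?d))" for X :: complex
        by simp
      ultimately show ?thesis using True by (simp only: if_True)
    next
      case False
      then have "\<not> int ?d * int v dvd k" using dvd v by (simp add: k mult.commute)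
      then show ?thesis using False by (simp add: sieve_term_def dil_def)
    qed
  qed
  then have "(\<Sum>S\<in>Pow P. (- 1) ^ card S / of_nat (\<Prod>S) * sieve_term (int (\<Prod>S)) (int v) k)
      = (\<Sum>S\<in>Pow P. if S \<subseteq> Q then (- 1) ^ card S * z else 0)" by (intro sum.cong refl)
  also have "\<dots> = (\<Sum>S\<in>Pow Q. (- 1) ^ card S * z)"
    using P(1) Q by (intro sum.mono_neutral_cong_right) auto
  also have "\<dots> = (\<Sum>S\<in>Pow Q. (- 1) ^ card S) * z" by (simp add: sum_distrib_right)
  also have "(\<Sum>S\<in>Pow Q. (- 1) ^ card S) = (\<Prod>p\<in>Q. 1 - (1::complex))"
    using prod_diff_conv_sum[OF Q(1), of "\<lambda>_. 1::complex" "\<lambda>_. 1"] by simp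
  also have "\<dots> = (if Q = {} then 1 else 0)" using Q(1) by (simp add: card_gt_0_iff)
  also have "\<dots> * z = sieved_coeff P t" using t by (auto simp: sieved_coeff_def z_def Q_def)
  also have "\<dots> = dilated_coeff (sieved_coeff P) v k" using v by (simp add: dilated_coeff_def k)
  finally show ?thesis .
qed

text \<open>The pairings involved carry total weight \<open>10 * \<alpha>\<close> with
  \<open>\<alpha> = pi / sqrt 3 \<le> 2\<close>, and each is at most \<open>6 * Q\<close>.\<close>

lemma norm_sieve_dil_pairing_le:
  assumes A: "finite A" "0 \<notin> A" and d: "d \<noteq> 0" and Q: "\<And>x. arc_sum A x \<le> Q"
    and T: "trigpoly a b T" "\<And>x. cmod (T x) \<le> 3"
  shows "cmod (\<Sum>k\<in>{a..b}. cnj (fc T k) * (\<Sum>n\<in>A. sieve_dil d (int n) k)) \<le> 120 * Q"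
proof -
  let ?p = "arc_pairing a b T A"
  define \<alpha> where "\<alpha> = pi / sqrt 3"
  have \<alpha>: "0 < \<alpha>" "\<alpha> \<le> 2"
  proof -
    have "pi \<le> 3.2" using pi_approx by simp
    moreover have "1.6 \<le> sqrt (3::real)" by (rule real_le_rsqrt) (simp add: power2_eq_square)
    ultimately show "\<alpha> \<le> 2" by (simp add: \<alpha>_def divide_le_eq)
  qed (simp add: \<alpha>_def)
  have p: "cmod (?p e) \<le> 6 * Q" if "e \<noteq> 0" for e by (rule norm_arc_pairing_le[OF A that Q T])
  have Q0: "Q \<ge> 0" using p[of 1] norm_ge_zero[of "?p 1"] by linarith
  define c1 c2 where "c1 = complex_of_real (chi3 d)" and "c2 = complex_of_real (chi3 d * chi4 d)"
  have "(\<Sum>k\<in>{a..b}. cnj (fc T k) * (\<Sum>n\<in>A. sieve_dil d (int n) k))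
      = c1 * (of_real (- 2 * \<alpha>) * (?p d + ?p (- d)) + of_real (- \<alpha>) * (?p (2 * d) + ?p (- 2 * d)))
        + c2 * (\<i> * of_real \<alpha> * (?p (2 * d) - ?p (- 2 * d) + ?p (4 * d) - ?p (- 4 * d)))"
    unfolding sieve_dil_def even_dil_def odd_dil_def arc_pairing_def c1_def[symmetric] c2_def[symmetric] \<alpha>_def
    by (simp add: sum.distrib sum_subtractf sum_distrib_left distrib_left right_diff_distrib sum_negf ac_simps)
  also have "cmod \<dots> \<le> 2 * \<alpha> * (6 * Q + 6 * Q) + \<alpha> * (6 * Q + 6 * Q) + \<alpha> * (6 * Q + 6 * Q + 6 * Q + 6 * Q)"
  proof -
    have c: "cmod c1 \<le> 1" "cmod c2 \<le> 1" unfolding c1_def c2_def norm_of_real by (rule abs_chi_le)+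
    have s2: "cmod (x + y) \<le> 6 * Q + 6 * Q" if "cmod x \<le> 6 * Q" "cmod y \<le> 6 * Q" for x y
      using norm_triangle_ineq[of x y] that by linarith
    have s4: "cmod (x - y + z - w) \<le> 6 * Q + 6 * Q + 6 * Q + 6 * Q"
      if "cmod x \<le> 6 * Q" "cmod y \<le> 6 * Q" "cmod z \<le> 6 * Q" "cmod w \<le> 6 * Q" for x y z w
      using norm_triangle_ineq4[of "x - y + z" w] norm_triangle_ineq[of "x - y" z] norm_triangle_ineq4[of x y] that by linarith
    have A1: "cmod (of_real (- 2 * \<alpha>) * (?p d + ?p (- d))) \<le> 2 * \<alpha> * (6 * Q + 6 * Q)"
      using s2[OF p[of d] p[of "- d"]] d \<alpha> by (simp add: norm_mult)
    have A2: "cmod (of_real (- \<alpha>) * (?p (2 * d) + ?p (- 2 * d))) \<le> \<alpha> * (6 * Q + 6 * Q)"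
      using s2[OF p[of "2 * d"] p[of "- 2 * d"]] d \<alpha> by (simp add: norm_mult)
    have A3: "cmod (\<i> * of_real \<alpha> * (?p (2 * d) - ?p (- 2 * d) + ?p (4 * d) - ?p (- 4 * d))) \<le> \<alpha> * (6 * Q + 6 * Q + 6 * Q + 6 * Q)"
      using s4[OF p[of "2 * d"] p[of "- 2 * d"] p[of "4 * d"] p[of "- 4 * d"]] d \<alpha> by (simp add: norm_mult)
    have m: "cmod (c * z) \<le> B" if "cmod c \<le> 1" "cmod z \<le> B" for c z :: complex and B
      using mult_mono[OF that(1) that(2)] by (simp add: norm_mult)
    have "cmod (c1 * (of_real (- 2 * \<alpha>) * (?p d + ?p (- d)) + of_real (- \<alpha>) * (?p (2 * d) + ?p (- 2 * d))))
        \<le> 2 * \<alpha> * (6 * Q + 6 * Q) + \<alpha> * (6 * Q + 6 * Q)"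
      by (rule m[OF c(1) order_trans[OF norm_triangle_ineq add_mono[OF A1 A2]]])
    moreover have "cmod (c2 * (\<i> * of_real \<alpha> * (?p (2 * d) - ?p (- 2 * d) + ?p (4 * d) - ?p (- 4 * d))))
        \<le> \<alpha> * (6 * Q + 6 * Q + 6 * Q + 6 * Q)"
      by (rule m[OF c(2) A3])
    ultimately show ?thesis by (intro order_trans[OF norm_triangle_ineq add_mono])
  qed
  also have "\<dots> = \<alpha> * (60 * Q)" by (simp add: algebra_simps)
  also have "\<dots> \<le> 2 * (60 * Q)" using \<alpha> Q0 by (intro mult_right_mono) auto
  finally show ?thesis by simp
qed

text \<open>The sieve combines dilates with weights of modulus \<open>1 / d\<close>, where
  \<open>d\<close> runs over the products of distinct primes of \<open>P\<close>; these weights sum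
  to the Euler product, which is the whole cost of sieving.\<close>

lemma norm_sieved_pairing_le:
  assumes A: "finite A" "0 \<notin> A" and Q: "\<And>x. arc_sum A x \<le> Q"
    and T: "trigpoly a b T" "\<And>x. cmod (T x) \<le> 3"
    and P: "finite P" "\<And>p. p \<in> P \<Longrightarrow> prime p \<and> odd p"
  shows "cmod (\<Sum>k\<in>{a..b}. cnj (fc T k) *
      (\<Sum>n\<in>A. dilated_coeff (sieved_coeff P) (2 * n) k + dilated_coeff (sieved_coeff P) (4 * n) k))
    \<le> 120 * Q * (\<Prod>p\<in>P. 1 + 1 / real p)"
proof -
  let ?c = "\<lambda>S. (- 1) ^ card S / of_nat (\<Prod>S) :: complex"
  let ?L = "\<lambda>S. \<Sum>k\<in>{a..b}. cnj (fc T k) * (\<Sum>n\<in>A. sieve_dil (int (\<Prod>S)) (int n) k)"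
  have dpos: "\<Prod>S > 0" if "S \<in> Pow P" for S
    using that P(2) by (intro prod_pos) (auto simp: prime_gt_0_nat)
  have eq: "dilated_coeff (sieved_coeff P) (2 * n) k + dilated_coeff (sieved_coeff P) (4 * n) k
      = (\<Sum>S\<in>Pow P. ?c S * sieve_dil (int (\<Prod>S)) (int n) k)" if n: "n \<in> A" for n k
  proof -
    have n0: "n > 0" using n A by (metis gr0I)
    have "(\<Sum>S\<in>Pow P. ?c S * sieve_dil (int (\<Prod>S)) (int n) k)
        = (\<Sum>S\<in>Pow P. ?c S * sieve_term (int (\<Prod>S)) (int (2 * n)) k + ?c S * sieve_term (int (\<Prod>S)) (int (4 * n)) k)"
    proof (intro sum.cong refl)
      fix S assume "S \<in> Pow P"
      then have "int (\<Prod>S) \<noteq> 0" unfolding of_nat_eq_0_iff using dpos[of S] by (intro gr_implies_not0)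
      then show "?c S * sieve_dil (int (\<Prod>S)) (int n) k
          = ?c S * sieve_term (int (\<Prod>S)) (int (2 * n)) k + ?c S * sieve_term (int (\<Prod>S)) (int (4 * n)) k"
        using sieve_dil_eq[of "int (\<Prod>S)" "int n" k] n0 by (simp add: distrib_left)
    qed
    also have "\<dots> = dilated_coeff (sieved_coeff P) (2 * n) k + dilated_coeff (sieved_coeff P) (4 * n) k"
      unfolding sum.distrib using n0 by (subst (1 2) sum_sieve_terms[OF P]) auto
    finally show ?thesis by simp
  qed
  have "(\<Sum>k\<in>{a..b}. cnj (fc T k) *
      (\<Sum>n\<in>A. dilated_coeff (sieved_coeff P) (2 * n) k + dilated_coeff (sieved_coeff P) (4 * n) k))
    = (\<Sum>k\<in>{a..b}. cnj (fc T k) * (\<Sum>n\<in>A. \<Sum>S\<in>Pow P. ?c S * sieve_dil (int (\<Prod>S)) (int n) k))"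
    by (intro sum.cong refl arg_cong2[where f = "(*)"] eq)
  also have "\<dots> = (\<Sum>k\<in>{a..b}. \<Sum>S\<in>Pow P. ?c S * (cnj (fc T k) * (\<Sum>n\<in>A. sieve_dil (int (\<Prod>S)) (int n) k)))"
    by (subst sum.swap) (simp add: sum_distrib_left mult.left_commute)
  also have "\<dots> = (\<Sum>S\<in>Pow P. ?c S * ?L S)"
    by (subst sum.swap) (simp add: sum_distrib_left)
  also have "cmod \<dots> \<le> (\<Sum>S\<in>Pow P. 1 / real (\<Prod>S) * (120 * Q))"
  proof (rule sum_norm_le)
    fix S assume S: "S \<in> Pow P"
    have "int (\<Prod>S) \<noteq> 0" unfolding of_nat_eq_0_iff using dpos[OF S] by (rule gr_implies_not0)
    then have L: "cmod (?L S) \<le> 120 * Q" by (rule norm_sieve_dil_pairing_le[OF A _ Q T])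
    have c: "cmod (?c S) = 1 / real (\<Prod>S)" by (simp add: norm_divide norm_power del: of_nat_prod)
    show "cmod (?c S * ?L S) \<le> 1 / real (\<Prod>S) * (120 * Q)"
      unfolding norm_mult c by (rule mult_left_mono[OF L]) (simp add: prod_nonneg)
  qed
  also have "\<dots> = 120 * Q * (\<Sum>S\<in>Pow P. (\<Prod>p\<in>S. 1 / real p))"
    by (simp add: sum_distrib_left sum_distrib_right prod_dividef mult.commute)
  also have "(\<Sum>S\<in>Pow P. (\<Prod>p\<in>S. 1 / real p)) = (\<Prod>p\<in>P. 1 + 1 / real p)"
    using prod_add[OF P(1), of "\<lambda>p. 1 / real p" "\<lambda>_. 1"] by (simp add: add.commute)
  finally show ?thesis .
qed

section \<open>The lower bound\<close>

definition sieve_primes :: "nat \<Rightarrow> nat set" where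
  "sieve_primes y = {p. prime p \<and> 5 \<le> p \<and> p \<le> y}"

lemma finite_sieve_primes [simp]: "finite (sieve_primes y)"
  by (rule finite_subset[of _ "{..y}"]) (auto simp: sieve_primes_def)

lemma sieve_primes_odd: "p \<in> sieve_primes y \<Longrightarrow> prime p \<and> odd p"
  using primes_dvd_imp_eq[of 2 p] by (auto simp: sieve_primes_def)

lemma sieved_coeff_1: "sieved_coeff (sieve_primes y) 1 = 2"
proof -
  have "\<not> int p dvd 1" if "p \<in> sieve_primes y" for p
    using that by (auto simp: sieve_primes_def)
  then show ?thesis by (simp add: sieved_coeff_def chi3_def chi4_def)
qed

lemma norm_sieved_coeff_le: "cmod (sieved_coeff P m) \<le> 2 / \<bar>of_int m\<bar>"
proof (cases "sieved_coeff P m = 0")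
  case False
  have "\<bar>of_bool (odd m) * chi3 m + chi3 m * chi4 m\<bar> \<le> 2"
    by (auto simp: chi3_def chi4_def)
  then have "\<bar>(of_bool (odd m) * chi3 m + chi3 m * chi4 m) / of_int m\<bar> \<le> 2 / \<bar>of_int m\<bar>"
    by (simp add: divide_right_mono)
  then show ?thesis using False by (auto simp: sieved_coeff_def simp del: of_real_divide split: if_splits)
qed simp

text \<open>The combined character vanishes at \<open>-1\<close>; so apart from \<open>m = 1\<close> only large rough \<open>m\<close> of
  either sign survive. This asymmetry is what makes a one-sided test function usable.\<close>

lemma sieved_coeff_nonzero:
  assumes nz: "sieved_coeff (sieve_primes y) m \<noteq> 0" and m1: "m \<noteq> 1"
  shows "y < nat \<bar>m\<bar>" and "\<And>p. prime p \<Longrightarrow> p dvd nat \<bar>m\<bar> \<Longrightarrow> y < p"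
proof -
  have m: "m \<noteq> 0" "\<And>p. p \<in> sieve_primes y \<Longrightarrow> \<not> int p dvd m"
    using nz by (auto simp: sieved_coeff_def split: if_splits)
  have m3: "of_bool (odd m) * chi3 m + chi3 m * chi4 m \<noteq> 0"
  proof
    assume "of_bool (odd m) * chi3 m + chi3 m * chi4 m = 0"
    then show False using nz unfolding sieved_coeff_def by (simp only: div_0 of_real_0 if_cancel)
  qed
  have odd: "odd m"
  proof
    assume "even m"
    then have "m mod 4 \<noteq> 1" "m mod 4 \<noteq> 3" by presburger+
    then show False using m3 \<open>even m\<close> by (simp add: chi4_def)
  qed
  have c3: "chi3 m \<noteq> 0" using m3 by auto
  have "\<not> 3 dvd m" using c3 by (auto simp: chi3_def dvd_eq_mod_eq_0)
  have "m \<noteq> - 1" using m3 by (auto simp: chi3_def chi4_def)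
  then have big: "nat \<bar>m\<bar> \<noteq> 1" using m1 m(1) by linarith
  show rough: "y < p" if p: "prime p" "p dvd nat \<bar>m\<bar>" for p
  proof (rule ccontr)
    assume "\<not> y < p"
    have "int p dvd m" using p(2) by (metis dvd_abs_iff int_dvd_int_iff int_nat_eq abs_ge_zero)
    then have "p \<noteq> 2" "p \<noteq> 3" using odd \<open>\<not> 3 dvd m\<close> by auto
    moreover have "p \<noteq> 4" using primes_dvd_imp_eq[of 2 p] p(1) by auto
    moreover have "p \<ge> 2" using p(1) by (rule prime_ge_2_nat)
    ultimately have "p \<in> sieve_primes y" using p(1) \<open>\<not> y < p\<close> by (auto simp: sieve_primes_def)
    then show False using m(2) \<open>int p dvd m\<close> by blast
  qed
  obtain p where p: "prime p" "p dvd nat \<bar>m\<bar>" using big prime_factor_nat by blast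
  have "p \<le> nat \<bar>m\<bar>" using p(2) m(1) by (intro dvd_imp_le) auto
  then show "y < nat \<bar>m\<bar>" using rough[OF p] by simp
qed

text \<open>Exchanging the complementary divisors \<open>v\<close> and \<open>j div v\<close> turns
  the noise of a block into a dilation sum of its indicator.\<close>

lemma sum_cofactors:
  assumes M: "finite M" "0 \<notin> M" and B: "finite B" "0 \<notin> B" and j: "j > (0::nat)"
  shows "(\<Sum>v\<in>B. if v dvd j \<and> j div v \<in> M then 1 / real (j div v) else 0)
    = dilate_sum M (\<lambda>i. if i \<in> B then 1 else 0) j"
proof -
  have "(\<Sum>v\<in>B. if v dvd j \<and> j div v \<in> M then 1 / real (j div v) else 0)
      = (\<Sum>v\<in>{v\<in>B. v dvd j \<and> j div v \<in> M}. 1 / real (j div v))"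
    using B by (simp add: sum.inter_filter)
  also have "\<dots> = (\<Sum>m\<in>{m\<in>M. m dvd j \<and> j div m \<in> B}. 1 / real m)"
    by (rule sum.reindex_bij_witness[of _ "\<lambda>m. j div m" "\<lambda>v. j div v"]) (use j in \<open>auto simp: div_div_eq_right\<close>)
  also have "\<dots> = (\<Sum>m\<in>{m\<in>M. m dvd j}. (if j div m \<in> B then 1 else 0) / real m)"
    using M by (intro sum.mono_neutral_cong_left) auto
  finally show ?thesis by (simp add: dilate_sum_def)
qed

text \<open>The weight 2 and the coefficient \<open>2 / |m|\<close> give \<open>4 / |m|\<close>, and
  the two signs of \<open>k\<close> are folded onto \<open>|k|\<close>. The resulting factor is
  \<open>16 * 2 * 8 / sqrt y\<close>; the threshold \<open>10 ^ 11\<close> ensures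
  \<open>sqrt y \<ge> 256 * 1200\<close>.\<close>

lemma noise_bound:
  fixes B :: "nat set" and K :: "int set"
  assumes B: "finite B" "0 \<notin> B" "card B \<le> 4 ^ r" and r: "r \<ge> 1" "r\<^sup>2 \<le> y" and y: "10 ^ 11 \<le> y"
    and \<omega>: "\<And>v. 1 \<le> \<omega> v" "\<And>v. \<omega> v \<le> 2" and K: "finite K"
  shows "(\<Sum>k\<in>K. (cmod (\<Sum>v\<in>B. of_real (\<omega> v) *
      (if k = int v then 0 else dilated_coeff (sieved_coeff (sieve_primes y)) v k)))\<^sup>2) \<le> real (card B) / 1200"
proof -
  let ?\<kappa> = "sieved_coeff (sieve_primes y)"
  \<comment> \<open>Cutting the rough numbers off at the largest \<open>|k|\<close> in
    \<open>K\<close> makes \<open>M\<close> finite without losing a cofactor that occurs.\<close>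
  define M where "M = {m. m \<le> Max (insert 0 ((\<lambda>k. nat \<bar>k\<bar>) ` K)) \<and> y < m \<and> (\<forall>p. prime p \<longrightarrow> p dvd m \<longrightarrow> y < p)}"
  have finM: "finite M" by (rule finite_subset[of _ "{..Max (insert 0 ((\<lambda>k. nat \<bar>k\<bar>) ` K))}"]) (auto simp: M_def)
  have M0: "0 \<notin> M" by (auto simp: M_def)
  define g where "g = dilate_sum M (\<lambda>i. if i \<in> B then 1 else 0)"
  let ?J = "mult_set M B"
  have g0: "g j \<ge> 0" for j unfolding g_def by (rule dilate_sum_nonneg) auto
  have gz: "g j = 0" if "j \<notin> ?J" for j unfolding g_def by (rule dilate_sum_support[OF _ that]) auto
  let ?s = "\<lambda>k. \<Sum>v\<in>B. of_real (\<omega> v) * (if k = int v then 0 else dilated_coeff ?\<kappa> v k)"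
  have pt: "cmod (?s k) \<le> (if k = 0 then 0 else 4 * g (nat \<bar>k\<bar>))" if k: "k \<in> K" for k
  proof (cases "k = 0")
    case True
    have "dilated_coeff ?\<kappa> v 0 = 0" for v by (simp add: dilated_coeff_def sieved_coeff_def)
    then show ?thesis using True by (simp cong: if_cong)
  next
    case False
    define j where "j = nat \<bar>k\<bar>"
    have j: "j > 0" using False by (simp add: j_def)
    have "cmod (?s k) \<le> (\<Sum>v\<in>B. 4 * (if v dvd j \<and> j div v \<in> M then 1 / real (j div v) else 0))"
    proof (rule sum_norm_le)
      fix v assume v: "v \<in> B"
      have v0: "v > 0" using v B(2) by (metis gr0I)
      let ?z = "if k = int v then 0 else dilated_coeff ?\<kappa> v k"
      show "cmod (of_real (\<omega> v) * ?z) \<le> 4 * (if v dvd j \<and> j div v \<in> M then 1 / real (j div v) else 0)"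
      proof (cases "?z = 0")
        case False
        then have kv: "k \<noteq> int v" "int v dvd k" "?\<kappa> (k div int v) \<noteq> 0"
          by (auto simp: dilated_coeff_def split: if_splits)
        obtain m where m: "k = int v * m" using kv(2) by blast
        have km: "k div int v = m" "m \<noteq> 1" using kv(1) v0 by (auto simp: m)
        have jm: "j = v * nat \<bar>m\<bar>" by (simp add: j_def m abs_mult nat_mult_distrib)
        then have jd: "v dvd j" "j div v = nat \<bar>m\<bar>" using v0 by auto
        have "j \<le> Max (insert 0 ((\<lambda>k. nat \<bar>k\<bar>) ` K))" using k K by (auto simp: j_def)
        moreover have "nat \<bar>m\<bar> \<le> j" using jm v0 by simp
        ultimately have "nat \<bar>m\<bar> \<in> M"
          using sieved_coeff_nonzero[of y m] kv(3) km by (auto simp: M_def)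
        moreover have "cmod (of_real (\<omega> v) * ?z) \<le> 2 * (2 / \<bar>real_of_int m\<bar>)"
          unfolding norm_mult
        proof (rule mult_mono)
          show "cmod (of_real (\<omega> v)) \<le> 2" using \<omega>[of v] by simp
          show "cmod ?z \<le> 2 / \<bar>real_of_int m\<bar>"
            using norm_sieved_coeff_le[of "sieve_primes y" m] kv km by (simp add: dilated_coeff_def)
        qed auto
        ultimately show ?thesis using jd by simp
      qed simp
    qed
    also have "\<dots> = 4 * g j" unfolding g_def
      by (subst sum_cofactors[OF finM M0 B(1,2) j, symmetric]) (simp add: sum_distrib_left)
    finally show ?thesis using False by (simp add: j_def)
  qed
  have inj_part: "(\<Sum>k\<in>S. (g (nat \<bar>k\<bar>))\<^sup>2) \<le> (\<Sum>j\<in>?J. (g j)\<^sup>2)"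
    if "finite S" "inj_on (\<lambda>k. nat \<bar>k\<bar>) S" for S :: "int set"
  proof -
    have "(\<Sum>k\<in>S. (g (nat \<bar>k\<bar>))\<^sup>2) = (\<Sum>j\<in>(\<lambda>k. nat \<bar>k\<bar>) ` S. (g j)\<^sup>2)"
      using that(2) by (simp add: sum.reindex)
    also have "\<dots> = (\<Sum>j\<in>(\<lambda>k. nat \<bar>k\<bar>) ` S \<inter> ?J. (g j)\<^sup>2)"
      using that(1) gz by (intro sum.mono_neutral_right) auto
    also have "\<dots> \<le> (\<Sum>j\<in>?J. (g j)\<^sup>2)" using finM B(1) by (intro sum_mono2) auto
    finally show ?thesis .
  qed
  have "(\<Sum>k\<in>K. (cmod (?s k))\<^sup>2) \<le> (\<Sum>k\<in>K. (if k = 0 then 0 else 4 * g (nat \<bar>k\<bar>))\<^sup>2)"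
    using pt by (intro sum_mono power_mono) auto
  also have "\<dots> = (\<Sum>k\<in>{k\<in>K. k > 0} \<union> {k\<in>K. k < 0}. 16 * (g (nat \<bar>k\<bar>))\<^sup>2)"
    using K by (intro sum.mono_neutral_cong_right) (auto simp: power_mult_distrib)
  also have "\<dots> = 16 * ((\<Sum>k\<in>{k\<in>K. k > 0}. (g (nat \<bar>k\<bar>))\<^sup>2) + (\<Sum>k\<in>{k\<in>K. k < 0}. (g (nat \<bar>k\<bar>))\<^sup>2))"
    using K by (subst sum.union_disjoint) (auto simp: sum_distrib_left distrib_left)
  also have "\<dots> \<le> 16 * ((\<Sum>j\<in>?J. (g j)\<^sup>2) + (\<Sum>j\<in>?J. (g j)\<^sup>2))"
    using K by (intro mult_left_mono add_mono inj_part) (auto simp: inj_on_def)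
  also have "\<dots> \<le> 16 * (8 / sqrt (real y) * real (card B) + 8 / sqrt (real y) * real (card B))"
    unfolding g_def using B r by (intro mult_left_mono add_mono rough_dilate_norm_le finM) (auto simp: M_def)
  also have "\<dots> = 256 / sqrt (real y) * real (card B)" by simp
  also have "\<dots> \<le> 1 / 1200 * real (card B)"
  proof (rule mult_right_mono)
    have "real (10 ^ 11) \<le> real y" using y by (simp only: of_nat_le_iff)
    then have "307200 \<le> sqrt (real y)" by (intro real_le_rsqrt) (simp add: power2_eq_square)
    then have "256 / sqrt (real y) \<le> 256 / 307200" using y by (intro divide_left_mono) auto
    then show "256 / sqrt (real y) \<le> 1 / 1200" by simp
  qed simp
  finally show ?thesis by simp
qed

lemma sum_powers_le: "(\<Sum>i=1..J. 16384 ^ i) \<le> 2 * (16384::nat) ^ J"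
  by (induction J) auto

text \<open>The increasing enumeration of \<open>V\<close> is cut into consecutive runs, and
  \<open>R\<close> is what remains at the top.\<close>

lemma ordered_blocks:
  fixes V :: "nat set"
  assumes V: "finite V" and le: "(\<Sum>i=1..J. D ^ i) \<le> card V"
  shows "\<exists>B R. (\<forall>i\<in>{1..J}. card (B i) = D ^ i) \<and>
    (\<forall>i\<in>{1..J}. \<forall>j\<in>{1..J}. i < j \<longrightarrow> (\<forall>v\<in>B i. \<forall>w\<in>B j. v < w)) \<and>
    (\<forall>i\<in>{1..J}. \<forall>v\<in>B i. \<forall>w\<in>R. v < w) \<and> V = (\<Union>i\<in>{1..J}. B i) \<union> R"
proof -
  define e where "e = (\<lambda>i. sorted_list_of_set V ! i)"
  define s where "s = (\<lambda>i. \<Sum>j=1..<i. D ^ j)"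
  define B where "B = (\<lambda>i. e ` {s i..<s (Suc i)})"
  define R where "R = e ` {s (Suc J)..<card V}"
  have s_mono: "s i \<le> s j" if "i \<le> j" for i j
    unfolding s_def using that by (intro sum_mono2) auto
  have s_Suc: "s (Suc i) = s i + D ^ i" if "i \<ge> 1" for i using that by (simp add: s_def)
  have s_top: "s (Suc J) \<le> card V" using le by (simp add: s_def atLeastLessThanSuc_atLeastAtMost)
  have e_less: "e i < e j" if "i < j" "j < card V" for i j
    unfolding e_def using sorted_wrt_nth_less[OF sorted_list_of_set.strict_sorted_key_list_of_set[of V] that(1)] that(2) V
    by simp
  have e_inj: "inj_on e {..<card V}"
    by (rule inj_onI) (metis e_less lessThan_iff less_irrefl linorder_neqE_nat)
  have bound: "s (Suc i) \<le> card V" if "i \<in> {1..J}" for i using s_mono[of "Suc i" "Suc J"] s_top that by simp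
  have c1: "card (B i) = D ^ i" if i: "i \<in> {1..J}" for i
  proof -
    have "inj_on e {s i..<s (Suc i)}" by (rule inj_on_subset[OF e_inj]) (use bound[OF i] in auto)
    then show ?thesis using s_Suc[of i] i by (simp add: B_def card_image)
  qed
  have c2: "v < w" if "i \<in> {1..J}" "j \<in> {1..J}" "i < j" "v \<in> B i" "w \<in> B j" for i j v w
    using that s_mono[of "Suc i" j] bound[of j] by (auto simp: B_def intro!: e_less)
  have c3: "v < w" if "i \<in> {1..J}" "v \<in> B i" "w \<in> R" for i v w
    using that s_mono[of "Suc i" "Suc J"] by (auto simp: B_def R_def intro!: e_less)
  have c4: "V = (\<Union>i\<in>{1..J}. B i) \<union> R"
  proof -
    have "(\<Union>i\<in>{1..n}. {s i..<s (Suc i)}) = {..<s (Suc n)}" for n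
    proof (induction n)
      case 0 then show ?case by (simp add: s_def)
    next
      case (Suc n)
      have "{1..Suc n} = insert (Suc n) {1..n}" by auto
      then show ?case using Suc s_mono[of "Suc n" "Suc (Suc n)"] by auto
    qed
    then have "{..<card V} = (\<Union>i\<in>{1..J}. {s i..<s (Suc i)}) \<union> {s (Suc J)..<card V}" using s_top by auto
    then have "e ` {..<card V} = (\<Union>i\<in>{1..J}. B i) \<union> R" by (simp add: image_Un image_UN B_def R_def)
    moreover have "e ` {..<card V} = V"
    proof -
      have "V = set (sorted_list_of_set V)" using V by simp
      also have "\<dots> = e ` {..<card V}" unfolding set_conv_nth e_def using V by auto
      finally show ?thesis by simp
    qed
    ultimately show ?thesis by simp
  qed
  show ?thesis
    by (rule exI[of _ B], rule exI[of _ R], intro conjI ballI impI)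
       (rule c1, assumption, rule c2, (assumption)+, rule c3, (assumption)+, rule c4)
qed

text \<open>One pairing is evaluated twice: the test function makes it at least \<open>J\<close>,
  while the sieve bounds it by \<open>120 * Q\<close> times the Euler product.\<close>

lemma arc_sum_sup_lower_bound:
  assumes A: "finite A" "0 \<notin> A" and Q: "\<And>x. arc_sum A x \<le> Q"
    and J: "J \<ge> 1" "2 * 16384 ^ J \<le> card A" and r: "r \<ge> 1" "2 * card A \<le> 4 ^ r"
    and y: "10 ^ 11 \<le> y" "r\<^sup>2 \<le> y" "24 * J * J \<le> y"
  shows "real J \<le> 120 * Q * (exp 5 * ln (real y))"
proof -
  let ?V2 = "(\<lambda>n. 2 * n) ` A" and ?V4 = "(\<lambda>n. 4 * n) ` A"
  define V where "V = ?V2 \<union> ?V4"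
  let ?\<kappa> = "sieved_coeff (sieve_primes y)"
  have finV: "finite V" using A by (simp add: V_def)
  have V0: "0 \<notin> V" using A by (auto simp: V_def)
  have card2: "card ?V2 = card A" "card ?V4 = card A" by (simp_all add: card_image inj_on_def)
  have "card V \<ge> card ?V2" using A by (intro card_mono) (auto simp: V_def)
  then have cardV: "card A \<le> card V" using card2 by simp
  have cardV2: "card V \<le> 4 ^ r" using card_Un_le[of ?V2 ?V4] card2 r by (simp add: V_def)
  have "(\<Sum>i=1..J. 16384 ^ i) \<le> card V" using sum_powers_le[of J] J(2) cardV by linarith
  from ordered_blocks[OF finV this] obtain B R where
    b1: "\<forall>i\<in>{1..J}. card (B i) = 16384 ^ i"
    and b2: "\<forall>i\<in>{1..J}. \<forall>j\<in>{1..J}. i < j \<longrightarrow> (\<forall>v\<in>B i. \<forall>w\<in>B j. v < w)"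
    and b3: "\<forall>i\<in>{1..J}. \<forall>v\<in>B i. \<forall>w\<in>R. v < w"
    and Vd: "V = (\<Union>i\<in>{1..J}. B i) \<union> R"
    by (elim exE conjE) (rule that; assumption)
  have Bc: "card (B i) = 16384 ^ i" if "i \<in> {1..J}" for i
    by (rule b1[rule_format, OF that])
  have Bl: "v < w" if "i \<in> {1..J}" "j \<in> {1..J}" "i < j" "v \<in> B i" "w \<in> B j" for i j v w
    by (rule b2[rule_format, OF that])
  have Rl: "v < w" if "i \<in> {1..J}" "v \<in> B i" "w \<in> R" for i v w
    by (rule b3[rule_format, OF that])
  have BV: "B i \<subseteq> V" if "i \<in> {1..J}" for i using Vd that by blast
  \<comment> \<open>The dilates of \<open>A\<close> by 2 and by 4 may overlap; on their union
    \<open>\<omega>\<close> records the multiplicity 1 or 2.\<close>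
  define \<omega> :: "nat \<Rightarrow> real" where "\<omega> = (\<lambda>v. if v \<in> V then of_bool (v \<in> ?V2) + of_bool (v \<in> ?V4) else 1)"
  have \<omega>: "1 \<le> \<omega> v" "\<omega> v \<le> 2" for v by (auto simp: \<omega>_def V_def)
  have "\<exists>T a b. trigpoly a b T \<and> (\<forall>x. cmod (T x) \<le> 3) \<and>
    Re (\<Sum>k\<in>{a..b}. cnj (fc T k) * (\<Sum>v\<in>(\<Union>i\<in>{1..J}. B i) \<union> R. of_real (\<omega> v) * dilated_coeff ?\<kappa> v k)) \<ge> real J"
  proof (rule weak_littlewood[where y = "int y"])
    show "finite R" using finV Vd by (metis finite_Un)
    show "0 \<notin> B i" if "i \<in> {1..J}" for i using BV[OF that] V0 by blast
    show "24 * int J * int J \<le> int y" using y(3) by (metis of_nat_le_iff of_nat_mult of_nat_numeral)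
    show "?\<kappa> m = 0" if "m \<noteq> 1" "\<bar>m\<bar> \<le> int y" for m
      using sieved_coeff_nonzero(1)[of y m] that by linarith
    show "(\<Sum>k\<in>K. (cmod (\<Sum>v\<in>B i. of_real (\<omega> v) * (if k = int v then 0 else dilated_coeff ?\<kappa> v k)))\<^sup>2)
        \<le> real (card (B i)) / 1200" if "i \<in> {1..J}" "finite K" for i K
    proof (rule noise_bound[OF _ _ _ r(1) y(2,1) \<omega> that(2)])
      show "finite (B i)" using BV[OF that(1)] finV finite_subset by blast
      show "0 \<notin> B i" using BV[OF that(1)] V0 by blast
      show "card (B i) \<le> 4 ^ r" using card_mono[OF finV BV[OF that(1)]] cardV2 by simp
    qed
  qed (fact J(1) | rule Bc Bl Rl \<omega> sieved_coeff_1; assumption)+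
  then obtain T a b where T: "trigpoly a b T" "\<And>x. cmod (T x) \<le> 3"
    and ge: "Re (\<Sum>k\<in>{a..b}. cnj (fc T k) * (\<Sum>v\<in>V. of_real (\<omega> v) * dilated_coeff ?\<kappa> v k)) \<ge> real J"
    unfolding Vd[symmetric] by blast
  have reg: "(\<Sum>v\<in>V. of_real (\<omega> v) * dilated_coeff ?\<kappa> v k)
      = (\<Sum>n\<in>A. dilated_coeff ?\<kappa> (2 * n) k + dilated_coeff ?\<kappa> (4 * n) k)" for k
  proof -
    have "(\<Sum>v\<in>V. of_real (\<omega> v) * dilated_coeff ?\<kappa> v k)
        = (\<Sum>v\<in>V. (if v \<in> ?V2 then dilated_coeff ?\<kappa> v k else 0)) + (\<Sum>v\<in>V. (if v \<in> ?V4 then dilated_coeff ?\<kappa> v k else 0))"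
      unfolding sum.distrib[symmetric] by (intro sum.cong refl) (simp add: \<omega>_def distrib_right)
    also have "(\<Sum>v\<in>V. (if v \<in> ?V2 then dilated_coeff ?\<kappa> v k else 0)) = (\<Sum>v\<in>?V2. dilated_coeff ?\<kappa> v k)"
      using finV by (intro sum.mono_neutral_cong_right) (auto simp: V_def)
    also have "\<dots> = (\<Sum>n\<in>A. dilated_coeff ?\<kappa> (2 * n) k)" by (subst sum.reindex) (auto simp: inj_on_def)
    also have "(\<Sum>v\<in>V. (if v \<in> ?V4 then dilated_coeff ?\<kappa> v k else 0)) = (\<Sum>v\<in>?V4. dilated_coeff ?\<kappa> v k)"
      using finV by (intro sum.mono_neutral_cong_right) (auto simp: V_def)
    also have "\<dots> = (\<Sum>n\<in>A. dilated_coeff ?\<kappa> (4 * n) k)" by (subst sum.reindex) (auto simp: inj_on_def)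
    finally show ?thesis by (simp add: sum.distrib)
  qed
  have "real J \<le> cmod (\<Sum>k\<in>{a..b}. cnj (fc T k) *
      (\<Sum>n\<in>A. dilated_coeff ?\<kappa> (2 * n) k + dilated_coeff ?\<kappa> (4 * n) k))"
    using ge unfolding reg by (rule order_trans[OF _ complex_Re_le_cmod])
  also have "\<dots> \<le> 120 * Q * (\<Prod>p\<in>sieve_primes y. 1 + 1 / real p)"
    by (rule norm_sieved_pairing_le[OF A Q T]) (auto dest: sieve_primes_odd)
  finally have le: "real J \<le> 120 * Q * (\<Prod>p\<in>sieve_primes y. 1 + 1 / real p)" .
  have pr: "0 \<le> (\<Prod>p\<in>sieve_primes y. 1 + 1 / real p)" by (intro prod_nonneg) simp
  have "Q \<ge> 0"
  proof (rule ccontr)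
    assume "\<not> Q \<ge> 0"
    then have "120 * Q \<le> 0" by simp
    then have "120 * Q * (\<Prod>p\<in>sieve_primes y. 1 + 1 / real p) \<le> 0"
      using pr by (rule mult_nonpos_nonneg)
    then show False using le J by simp
  qed
  have "(\<Prod>p\<in>sieve_primes y. 1 + 1 / real p) \<le> exp 5 * ln (real y)"
    unfolding sieve_primes_def by (rule mertens_prod_le) (use y(1) in simp)
  then have "120 * Q * (\<Prod>p\<in>sieve_primes y. 1 + 1 / real p) \<le> 120 * Q * (exp 5 * ln (real y))"
    using \<open>Q \<ge> 0\<close> by (intro mult_left_mono) auto
  then show ?thesis using le by (rule order_trans[rotated])
qed

text \<open>No other element of \<open>A\<close> divides the least one, so the Fourier coefficient
  there is that of a single arc and is nonzero. This gives the sign of \<open>Q\<close> in the main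
  estimate and, by integrality, the whole gain for bounded \<open>N\<close>.\<close>

lemma arc_sum_sup_pos:
  assumes A: "finite A" "0 \<notin> A" "A \<noteq> {}" and Q: "\<And>x. arc_sum A x \<le> Q"
  shows "Q > 0"
proof -
  define a where "a = Min A"
  have a: "a \<in> A" "\<And>n. n \<in> A \<Longrightarrow> a \<le> n" using A by (auto simp: a_def)
  have a0: "a > 0" using a A(2) by (metis gr0I)
  let ?f = "\<lambda>x. complex_of_real (arc_sum A (of_int 1 * x))"
  have dil: "arc_dil (1 * int n) (int a) = (if n = a then arc_coeff (1/12) (5/12) 1 else 0)" if n: "n \<in> A" for n
  proof (cases "n = a")
    case False
    then have "\<not> n dvd a" using a(2)[OF n] a0 dvd_imp_le[of n a] by auto
    then show ?thesis using False by (simp add: arc_dil_def)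
  qed (use a0 in \<open>simp add: arc_dil_def\<close>)
  have "fc ?f (int a) = (\<Sum>n\<in>A. arc_dil (1 * int n) (int a))" by (rule fc_arc_sum[OF A(1,2)]) simp
  also have "\<dots> = (\<Sum>n\<in>A. if n = a then arc_coeff (1/12) (5/12) 1 else 0)"
    by (intro sum.cong refl dil)
  also have "\<dots> = arc_coeff (1/12) (5/12) 1" using a A by simp
  finally have fc: "fc ?f (int a) = arc_coeff (1/12) (5/12) 1" .
  have "arc_coeff (1/12) (5/12) 1 \<noteq> 0"
    using arc_coeff_even_odd[of 1] by (auto simp: cos_fourth_def chi4_def sin_sixth_def)
  then have "0 < cmod (fc ?f (int a))" using fc by simp
  also have "\<dots> \<le> (\<integral>x. cmod (?f x * ec (- int a) x) \<partial>circle)" unfolding fc_def by (rule integral_norm_bound)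
  also have "\<dots> = (\<integral>x. \<bar>arc_sum A (of_int 1 * x)\<bar> \<partial>circle)" by (simp add: norm_mult)
  also have "\<dots> \<le> 2 * Q" by (rule integral_abs_arc_sum_le[OF A(1,2) _ Q]) simp
  finally show ?thesis by simp
qed


text \<open>Everything is expressed through \<open>r\<close>, the rounded logarithm of
  \<open>2 * N\<close> to base 4: since \<open>16384 = 4 ^ 7\<close> there is room for about
  \<open>r / 7\<close> blocks, and \<open>y\<close> is a large multiple of \<open>r\<^sup>2\<close>.
  The constant is \<open>103 = 99 + 2 + 2\<close>, from \<open>11 * ln 10 \<le> 99\<close> and
  \<open>2 * ln r \<le> 2 * ln 2 + 2 * ln (ln N)\<close>, where
  \<open>ln (ln N) \<ge> 1\<close>.\<close>

lemma log_gain: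
  assumes N: "ln (real N) \<ge> 32"
  shows "\<exists>J r y. 1 \<le> J \<and> 2 * 16384 ^ J \<le> N \<and> 1 \<le> r \<and> 2 * N \<le> 4 ^ r \<and> 10 ^ 11 \<le> y \<and> r\<^sup>2 \<le> y \<and>
    24 * J * J \<le> y \<and> ln (real N) \<le> 28 * real J \<and> ln (real y) \<le> 103 * ln (ln (real N))"
proof -
  define r where "r = (LEAST r. 2 * N \<le> 4 ^ r)"
  \<comment> \<open>Minimality of \<open>r\<close> only gives \<open>4 ^ (r - 1) < 2 * N\<close>;
    subtracting 2 leaves room for the factor 2 in \<open>2 * 16384 ^ J \<le> N\<close>.\<close>
  define J where "J = (r - 2) div 7"
  define y where "y = 10 ^ 11 * r\<^sup>2"
  have N0: "real N > 0"
  proof (rule ccontr)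
    assume "\<not> real N > 0"
    then show False using N by simp
  qed
  have "2 * N \<le> 4 ^ (2 * N)"
    using less_exp[of "2 * N"] power_mono[of 2 "4::nat" "2 * N"] by simp
  then have r: "2 * N \<le> 4 ^ r" unfolding r_def by (rule LeastI)
  have ln4: "ln (4::real) = 2 * ln 2" using ln_realpow[of 2 2] by simp
  have ln2: "1/2 \<le> ln (2::real)" "ln (2::real) \<le> 1"
    using ln_le_minus_one[of "1/2::real"] ln_le_minus_one[of "2::real"] by (simp_all add: ln_div)
  have "ln (real N) \<le> ln (4 ^ r)"
  proof (subst ln_le_cancel_iff)
    have "real N \<le> real (4 ^ r)" using r by (simp only: of_nat_le_iff)
    then show "real N \<le> 4 ^ r" by simp
  qed (use N0 in auto)
  also have "\<dots> = real r * (2 * ln 2)" by (simp add: ln_realpow ln4)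
  also have "\<dots> \<le> real r * 2" using ln2 by (intro mult_left_mono) auto
  finally have lnN: "ln (real N) \<le> 2 * real r" by simp
  then have r16: "r \<ge> 16" using N by simp
  have "\<not> 2 * N \<le> 4 ^ (r - 1)" unfolding r_def
    by (rule not_less_Least) (use r16 in \<open>simp add: r_def\<close>)
  then have r1: "4 ^ (r - 1) < 2 * N" by simp
  have Jr: "7 * J \<le> r - 2" "r \<le> 7 * J + 8" unfolding J_def using r16 by linarith+
  have J1: "J \<ge> 1" using Jr r16 by linarith
  have JN: "2 * 16384 ^ J \<le> N"
  proof -
    have "(16384::nat) ^ J = 4 ^ (7 * J)" by (simp add: power_mult)
    also have "\<dots> \<le> 4 ^ (r - 2)" using Jr by (intro power_increasing) auto
    finally have "2 * (2 * 16384 ^ J) \<le> 4 * (4::nat) ^ (r - 2)" by simp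
    also have "\<dots> = 4 ^ (r - 1)"
    proof -
      have "r - 1 = Suc (r - 2)" using r16 by simp
      then show ?thesis by (simp only: power_Suc)
    qed
    also have "\<dots> < 2 * N" by (rule r1)
    finally show ?thesis by simp
  qed
  have Jle: "J \<le> r" using Jr by linarith
  have y1: "10 ^ 11 \<le> y" "r\<^sup>2 \<le> y" using r16 by (simp_all add: y_def)
  have y2: "24 * J * J \<le> y"
  proof -
    have "24 * J * J \<le> 24 * (r * r)" using Jle by (simp add: mult_le_mono)
    also have "\<dots> \<le> 10 ^ 11 * (r * r)" by (intro mult_right_mono) auto
    finally show ?thesis by (simp add: y_def power2_eq_square)
  qed
  have "real r \<le> 14 * real J"
  proof -
    have "r \<le> 14 * J" using Jr r16 by linarith
    then have "real r \<le> real (14 * J)" by (simp only: of_nat_le_iff)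
    then show ?thesis by simp
  qed
  then have lnJ: "ln (real N) \<le> 28 * real J" using lnN by linarith
  have "ln (4 ^ (r - 1)) \<le> ln (2 * real N)"
  proof (subst ln_le_cancel_iff)
    have "real (4 ^ (r - 1)) \<le> real (2 * N)" using r1 by (simp only: of_nat_le_iff)
    then show "4 ^ (r - 1) \<le> 2 * real N" by simp
  qed (use N0 in auto)
  then have "real (r - 1) * (2 * ln 2) \<le> ln 2 + ln (real N)" using N0 by (simp add: ln_realpow ln_mult ln4)
  moreover have "real (r - 1) * 1 \<le> real (r - 1) * (2 * ln 2)" using ln2 by (intro mult_left_mono) auto
  ultimately have "real (r - 1) \<le> 1 + ln (real N)" using ln2 by linarith
  then have r2: "real r \<le> 2 * ln (real N)" using r16 N by simp
  define L where "L = ln (ln (real N))"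
  have L: "L \<ge> 1"
  proof -
    have "exp 1 \<le> ln (real N)" using exp_le N by linarith
    then have "ln (exp 1) \<le> L" unfolding L_def by (subst ln_le_cancel_iff) (use N in auto)
    then show ?thesis by simp
  qed
  have "ln (real y) = 11 * ln 10 + 2 * ln (real r)"
    using r16 ln_realpow[of "10::real" 11] by (simp add: y_def ln_mult ln_realpow)
  also have "ln (real r) \<le> ln (2 * ln (real N))" using r2 r16 by (subst ln_le_cancel_iff) auto
  also have "\<dots> = ln 2 + L" using N by (simp add: ln_mult L_def)
  also have "ln (10::real) \<le> 9" using ln_le_minus_one[of "10::real"] by simp
  finally have "ln (real y) \<le> 103 * L" using ln2 L by simp
  then show ?thesis using J1 JN r16 r y1 y2 lnJ unfolding L_def
    by (intro exI[of _ J] exI[of _ r] exI[of _ y]) auto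
qed

theorem theorem1p1:
  fixes k l :: nat
  assumes "l > 0" and "k = 5 * l"
  shows "\<exists>c::real. c > 0 \<and>
    (\<forall>N::nat. N \<ge> 3 \<longrightarrow>
      real (min_max_kl_sum_free k l N)
        \<ge> real N / real (k + l) + c * (ln (real N) / ln (ln (real N))))"
proof -
  have l0: "real l > 0" using assms by simp
  define g where "g = (\<lambda>N::nat. ln (real N) / ln (ln (real N)))"
  \<comment> \<open>The finitely many \<open>N\<close> up to \<open>exp 32\<close> are served by
    \<open>c2\<close>, which divides by the largest ratio of logarithms among them; the inserted 1
    keeps that maximum positive. Larger \<open>N\<close> are served by \<open>c1\<close>.\<close>
  define N1 where "N1 = nat \<lceil>exp 32 :: real\<rceil>"
  define c1 where "c1 = 1 / (2 * real l * (28 * 120 * exp 5 * 103))"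
  define c2 where "c2 = 1 / (6 * real l) / Max (insert 1 (g ` {3..N1}))"
  have mx: "Max (insert 1 (g ` {3..N1})) \<ge> 1" by simp
  have c1: "c1 > 0" using l0 by (simp add: c1_def)
  have c2: "c2 > 0" unfolding c2_def
    by (rule divide_pos_pos[OF _ less_le_trans[OF zero_less_one mx]]) (use l0 in simp)
  note c = c1 c2
  have g_pos: "g N > 0" if "N \<ge> 3" for N
  proof -
    have "exp 1 < real N" using e_less_272 that by linarith
    then have "ln (exp 1) < ln (real N)" by (subst ln_less_cancel_iff) (use that in auto)
    then show ?thesis by (simp add: g_def)
  qed
  show ?thesis
  proof (intro exI[of _ "min c1 c2"] conjI allI impI)
    show "min c1 c2 > 0" using c by simp
    fix N :: nat assume N: "N \<ge> 3"
    let ?F = "{max_kl_sum_free k l A |A. A \<subseteq> {0<..} \<and> finite A \<and> card A = N}"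
    have "max_kl_sum_free k l {1..N} \<in> ?F" by (intro CollectI exI[of _ "{1..N}"]) auto
    then have "?F \<noteq> {}" by blast
    then have "min_max_kl_sum_free k l N \<in> ?F" unfolding min_max_kl_sum_free_def by (rule Inf_nat_def1)
    then obtain A where A: "A \<subseteq> {0<..}" "finite A" "card A = N"
      and min_eq: "min_max_kl_sum_free k l N = max_kl_sum_free k l A" by blast
    define m where "m = max_kl_sum_free k l A"
    define Q where "Q = 2 * real l * real m - real N / 3"
    have A0: "0 \<notin> A" "A \<noteq> {}" using A N by auto
    have Q: "arc_sum A x \<le> Q" for x
    proof -
      have "arc_sum A x = (\<Sum>n\<in>A. arc_ind (1/12) (5/12) (real n * x)) - real N / 3"
        by (simp add: arc_sum_def sum_subtractf A(3))
      then show ?thesis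
        using sum_arc_le_max_kl_sum_free[OF assms(1) A(2), of x] by (simp add: Q_def m_def assms(2))
    qed
    \<comment> \<open>As \<open>k + l = 6 * l\<close>, the mean \<open>N / 3\<close> of the arc
      count yields exactly \<open>N / (k + l)\<close>, and the gain is
      \<open>Q / (2 * l)\<close>.\<close>
    have m_eq: "real m = real N / real (k + l) + Q / (2 * real l)"
      using l0 assms(2) by (simp add: Q_def field_simps)
    have gain: "min c1 c2 * g N \<le> Q / (2 * real l)"
    proof (cases "ln (real N) \<ge> 32")
      case True
      obtain J r y where J: "1 \<le> J" "2 * 16384 ^ J \<le> N" "1 \<le> r" "2 * N \<le> 4 ^ r" "10 ^ 11 \<le> y"
        "r\<^sup>2 \<le> y" "24 * J * J \<le> y" and lnJ: "ln (real N) \<le> 28 * real J"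
        and lny: "ln (real y) \<le> 103 * ln (ln (real N))"
        using log_gain[OF True] by blast
      define L where "L = ln (ln (real N))"
      have "real J \<le> 120 * Q * (exp 5 * ln (real y))"
        using J A by (intro arc_sum_sup_lower_bound[OF A(2) A0(1) Q]) auto
      also have "\<dots> \<le> 120 * Q * (exp 5 * (103 * L))"
        using lny arc_sum_sup_pos[OF A(2) A0 Q] by (intro mult_left_mono) (auto simp: L_def)
      finally have "ln (real N) \<le> 28 * (120 * Q * (exp 5 * (103 * L)))" using lnJ by linarith
      moreover have "L > 0" using g_pos[OF N] True by (simp add: g_def L_def zero_less_divide_iff)
      ultimately have "g N \<le> Q * (28 * 120 * exp 5 * 103)"
        by (simp add: g_def L_def[symmetric] divide_le_eq ac_simps)
      then have "c1 * g N \<le> c1 * (Q * (28 * 120 * exp 5 * 103))" using c by (intro mult_left_mono) auto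
      also have "\<dots> = Q / (2 * real l)" by (simp add: c1_def)
      finally have "c1 * g N \<le> Q / (2 * real l)" .
      moreover have "min c1 c2 * g N \<le> c1 * g N" using g_pos[OF N] by (intro mult_right_mono) auto
      ultimately show ?thesis by linarith
    next
      case False
      have "real N \<le> exp 32"
      proof -
        have "exp (ln (real N)) \<le> exp 32" using False by (subst exp_le_cancel_iff) simp
        then show ?thesis using N by simp
      qed
      then have "N \<le> N1" unfolding N1_def by linarith
      then have "g N \<le> Max (insert 1 (g ` {3..N1}))" using N by (intro Max_ge) auto
      then have "c2 * g N \<le> c2 * Max (insert 1 (g ` {3..N1}))" using c by (intro mult_left_mono) auto
      also have "\<dots> = 1 / (6 * real l)"
        using less_imp_neq[OF less_le_trans[OF zero_less_one mx]] by (simp add: c2_def)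
      also have "\<dots> \<le> Q / (2 * real l)"
      proof -
        \<comment> \<open>\<open>3 * Q\<close> is an integer, so positivity already gives
          \<open>Q \<ge> 1 / 3\<close>, that is, a gain of \<open>1 / (6 * l)\<close>.\<close>
        have "3 * Q = real_of_int (6 * int l * int m - int N)" by (simp add: Q_def)
        moreover have "3 * Q > 0" using arc_sum_sup_pos[OF A(2) A0 Q] by simp
        ultimately have "6 * int l * int m - int N > 0" by linarith
        then have "6 * int l * int m - int N \<ge> 1" by simp
        then have "3 * Q \<ge> 1" using \<open>3 * Q = _\<close> by linarith
        then show ?thesis using l0 by (simp add: field_simps)
      qed
      finally have "c2 * g N \<le> Q / (2 * real l)" .
      moreover have "min c1 c2 * g N \<le> c2 * g N" using g_pos[OF N] by (intro mult_right_mono) auto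
      ultimately show ?thesis by linarith
    qed
    then show "real (min_max_kl_sum_free k l N)
        \<ge> real N / real (k + l) + min c1 c2 * (ln (real N) / ln (ln (real N)))"
      unfolding min_eq m_def[symmetric] m_eq by (simp add: g_def)
  qed
qed

end
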